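(* Let $\mu,\nu$ be probability measures on $\mathbb{R}$ with bounded support such that $\operatorname{Ent}(\mu|\mathcal L^1)<\infty$ and $\operatorname{Ent}(\nu|\mathcal L^1)<\infty$ (in particular both are absolutely continuous). Assume: (H1) the set $A\cap\operatorname{supp}\mu$ has Lebesgue-negligible boundary, and its interior is $\bigcup_i(a_i,b_i)$ with pairwise disjoint intervals $(a_i,b_i)$ satisfying $$-\sum_i\int_{a_i}^{b_i}\log\big(\min\{x-a_i,\,b_i-x\}\big)\,d\mu(x)<+\infty;$$ (H2) there exists an optimal plan $\gamma\in\mathcal O_1(\mu,\nu)$ such that $\operatorname{Ent}\big(\gamma\llcorner(\mathbb{R}\setminus A)^2\,\big|\,\mu\otimes\nu\big)<\infty$. Then, on $\Pi(\mu,\nu)$ with the narrow topology, the functionals $$F_\varepsilon(\gamma)=\frac1\varepsilon\Big(\int|y-x|\,d\gamma-W_1(\mu,\nu)\Big)+\operatorname{Ent}(\gamma|\mu\otimes\nu)-|\log(2\varepsilon)|\,\mu(A)$$ $\Gamma$-converge as $\varepsilon\to0$ to the functional $F$ defined by $F(\gamma)=+\infty$ if $\gamma\notin\mathcal O_1(\mu,\nu)$ and $$F(\gamma)=\operatorname{Ent}\big(\gamma\llcorner(\mathbb{R}\setminus A)^2\,\big|\,\mu\otimes\nu\big)-\int_A\log\Big(\frac{d\mu}{d\mathcal L^1}\Big)\,d\mu\quad\text{if }\gamma\in\mathcal O_1(\mu,\nu).$$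
   Context: $F_\rho(x)=\rho((-\infty,x])$; $A=\{x: F_\mu(x)=F_\nu(x)\}$. $\Pi(\mu,\nu)$ is the set of probability measures on $\mathbb{R}^2$ with marginals $\mu,\nu$; $W_1(\mu,\nu)=\min_{\gamma\in\Pi(\mu,\nu)}\int|y-x|\,d\gamma$ and $\mathcal O_1(\mu,\nu)$ is the set of minimizers. $\operatorname{Ent}(\gamma|\rho)=\int\log\frac{d\gamma}{d\rho}\,d\gamma$ if $\gamma\ll\rho$, $+\infty$ otherwise. $\gamma\llcorner E$ denotes restriction to $E$. $\Gamma$-convergence: liminf inequality along every converging family and existence of a recovery family satisfying the limsup inequality. *)

theory Defs
  imports "HOL-Probability.Probability"
begin

definition cdf_of :: "real measure \<Rightarrow> real \<Rightarrow> real" where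
  "cdf_of \<rho> x = measure \<rho> {..x}"

definition eqset :: "real measure \<Rightarrow> real measure \<Rightarrow> real set" where
  "eqset \<mu> \<nu> = {x. cdf_of \<mu> x = cdf_of \<nu> x}"

definition supp :: "real measure \<Rightarrow> real set" where
  "supp M = {x. \<forall>e>0. emeasure M (ball x e) > 0}"

definition Ent :: "'a measure \<Rightarrow> 'a measure \<Rightarrow> ereal" where
  "Ent \<gamma> \<rho> =
     (if sets \<gamma> = sets \<rho> \<and> absolutely_continuous \<rho> \<gamma> then
        (let f = (\<lambda>x. enn2real (RN_deriv \<rho> \<gamma> x)) in
          enn2ereal (\<integral>\<^sup>+ x. ennreal (f x * ln (f x)) \<partial>\<rho>)
          - enn2ereal (\<integral>\<^sup>+ x. ennreal (- (f x * ln (f x))) \<partial>\<rho>))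
      else \<infinity>)"

definition restr :: "'a measure \<Rightarrow> 'a set \<Rightarrow> 'a measure" where
  "restr \<gamma> E = density \<gamma> (indicator E)"

definition couplings :: "real measure \<Rightarrow> real measure \<Rightarrow> (real \<times> real) measure set" where
  "couplings \<mu> \<nu> = {\<gamma>. sets \<gamma> = sets (borel \<Otimes>\<^sub>M borel) \<and> prob_space \<gamma>
      \<and> distr \<gamma> borel fst = \<mu> \<and> distr \<gamma> borel snd = \<nu>}"

definition cost1 :: "(real \<times> real) measure \<Rightarrow> real" where
  "cost1 \<gamma> = (\<integral> z. \<bar>snd z - fst z\<bar> \<partial>\<gamma>)"

definition W1 :: "real measure \<Rightarrow> real measure \<Rightarrow> real" where
  "W1 \<mu> \<nu> = Inf (cost1 ` couplings \<mu> \<nu>)"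

definition opt1 :: "real measure \<Rightarrow> real measure \<Rightarrow> (real \<times> real) measure set" where
  "opt1 \<mu> \<nu> = {\<gamma> \<in> couplings \<mu> \<nu>. cost1 \<gamma> = W1 \<mu> \<nu>}"

definition narrow_conv :: "('i \<Rightarrow> (real \<times> real) measure) \<Rightarrow> (real \<times> real) measure \<Rightarrow> 'i filter \<Rightarrow> bool" where
  "narrow_conv \<gamma>s \<gamma> F \<longleftrightarrow>
     (\<forall>f :: real \<times> real \<Rightarrow> real. continuous_on UNIV f \<and> bounded (range f) \<longrightarrow>
        ((\<lambda>i. \<integral> z. f z \<partial>(\<gamma>s i)) \<longlongrightarrow> (\<integral> z. f z \<partial>\<gamma>)) F)"

definition gamma_conv :: "(real \<times> real) measure set \<Rightarrow> (real \<Rightarrow> (real \<times> real) measure \<Rightarrow> ereal)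
     \<Rightarrow> ((real \<times> real) measure \<Rightarrow> ereal) \<Rightarrow> bool" where
  "gamma_conv P Fe F \<longleftrightarrow>
     (\<forall>\<gamma>\<in>P.
        (\<forall>\<gamma>s. (\<forall>e>0. \<gamma>s e \<in> P) \<and> narrow_conv \<gamma>s \<gamma> (at_right 0)
              \<longrightarrow> F \<gamma> \<le> Liminf (at_right 0) (\<lambda>e. Fe e (\<gamma>s e)))
      \<and> (\<exists>\<gamma>s. (\<forall>e>0. \<gamma>s e \<in> P) \<and> narrow_conv \<gamma>s \<gamma> (at_right 0)
              \<and> Limsup (at_right 0) (\<lambda>e. Fe e (\<gamma>s e)) \<le> F \<gamma>))"

end

theory Submission
  imports Defs "HOL-Real_Asymp.Real_Asymp"
begin

text \<open>
  Let \<open>f\<close> be the density of \<open>\<mu>\<close> and \<open>\<phi>' = sgn (F\<^sub>\<mu> - F\<^sub>\<nu>)\<close>. The function \<open>\<phi>\<close> is a Kantorovich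
  potential, so the excess cost of a plan is the integral of \<open>w x y = \<bar>y - x\<bar> - (\<phi> y - \<phi> x) \<ge> 0\<close>, and \<open>w x y\<close>
  is at least the Lebesgue measure of the part of \<open>A\<close> between \<open>x\<close> and \<open>y\<close>. Hence optimal plans are
  diagonal on \<open>A\<close>.

  Lower bound: the entropy dominates its Legendre dual, tested with \<open>- w / \<epsilon> - ln (2 \<epsilon> f x)\<close> on \<open>x \<in> A\<close>
  and with a bounded continuous function off \<open>A\<close>. The first term cancels the excess cost, the logarithm only sees
  the fixed first marginal, and in the coordinate measuring length along \<open>A\<close> the exponential is a Laplace
  kernel of mass at most 1.

  Recovery: keep the optimal plan off \<open>A\<close> and replace the diagonal part by the symmetric density
  \<open>exp (- \<bar>x - y\<bar> / \<epsilon>) / (2 \<epsilon>) * min (f x) (f y)\<close>. Its marginals are below \<open>f\<close>, and the missing mass, which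
  tends to 0 by continuity of translations in \<open>L\<^sup>1\<close>, is coupled with itself by products on blocks of length
  \<open>\<epsilon>\<close>, at vanishing cost and relative entropy.
\<close>

section \<open>Lipschitz approximation in mean\<close>

text \<open>The divergent term \<open>ln (2 * e) * measure \<mu> A\<close> has to be matched on both
  sides with vanishing error. In the lower bound it is the normalising constant of the kernel
  \<open>laplace\<close>, integrated against the fixed first marginal on \<open>A\<close>. The two
  mixed blocks are excluded for different reasons: on \<open>A \<times> (- A)\<close> the mass of
  the plans tends to 0 because the limit plan is diagonal over \<open>A\<close>, so a penalty there
  is free in the limit; on \<open>(- A) \<times> A\<close> the exponential itself tends to 0, since
  arc length separates almost every point of \<open>A\<close> from all other points. In the upper
  bound the obstacle is the mass lost by the symmetric density, which tends to 0 without a rate.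
  Blocks of length \<open>e\<close> suit it for two reasons: moving mass inside a block costs at
  most \<open>e\<close> per unit, and only about \<open>2 * L / e\<close> blocks meet the window.
  Hence the block coupling has entropy about \<open>- ln (2 * e)\<close> per unit of mass, its exact
  share of the divergent term. The remainder is a multiple of the lost mass plus
  \<open>\<eta> * (6 * L + 4 * e)\<close> with a free parameter \<open>\<eta>\<close>.\<close>

lemma borel_measurable_lipschitz:
  fixes v :: "'a::metric_space \<Rightarrow> real"
  assumes "\<And>x y. \<bar>v x - v y\<bar> \<le> C * dist x y"
  shows "continuous_on UNIV v" "v \<in> borel_measurable borel"
proof -
  have "(\<bar>C\<bar>)-lipschitz_on UNIV v"
    unfolding lipschitz_on_def dist_real_def
    using assms by (auto intro!: order_trans[OF assms] mult_right_mono)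
  then show "continuous_on UNIV v" by (rule lipschitz_on_continuous_on)
  then show "v \<in> borel_measurable borel" by (rule borel_measurable_continuous_onI)
qed

text \<open>Outer regularity encloses \<open>B\<close> in an open \<open>U\<close> of nearly the
  same measure, and the Lipschitz functions \<open>min 1 (n * infdist x (- U))\<close> increase to
  the indicator of \<open>U\<close>.\<close>

lemma indicator_lipschitz_approx:
  fixes M :: "'a::polish_space measure"
  assumes sb[measurable_cong]: "sets M = sets borel" and fin: "finite_measure M"
    and B[measurable]: "B \<in> sets borel" and e: "e > (0::real)"
  shows "\<exists>v C. (\<forall>x y. \<bar>v x - v y\<bar> \<le> C * dist x y) \<and> (\<forall>x. 0 \<le> v x \<and> v x \<le> 1)
    \<and> (\<integral>x. \<bar>indicator B x - v x\<bar> \<partial>M) < e"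
proof -
  interpret finite_measure M by fact
  have "emeasure M B < emeasure M B + ennreal (e/2)"
    using e by (simp add: emeasure_eq_measure ennreal_plus[symmetric] ennreal_lessI add_nonneg_pos del: ennreal_plus)
  then obtain U where U: "B \<subseteq> U" "open U" "emeasure M U < emeasure M B + ennreal (e/2)"
    using outer_regular[OF sb _ B] by (auto simp: INF_less_iff)
  have [measurable]: "U \<in> sets borel" using U by auto
  have UB: "measure M U < measure M B + e/2"
    using U(3) e by (simp add: emeasure_eq_measure ennreal_plus[symmetric] ennreal_less_iff del: ennreal_plus)
  show ?thesis
  \<comment> \<open>The distance to an empty complement is 0 by convention, so this case takes the
    constant 1 instead.\<close>
  proof (cases "U = UNIV")
    case True
    have "(\<integral>x. \<bar>indicator B x - (1::real)\<bar> \<partial>M) = (\<integral>x. indicator (U - B) x \<partial>M)"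
      by (rule Bochner_Integration.integral_cong) (auto simp: True split: split_indicator)
    also have "\<dots> = measure M U - measure M B"
      using U(1) by (simp add: finite_measure_Diff sb)
    finally have "(\<integral>x. \<bar>indicator B x - (1::real)\<bar> \<partial>M) < e" using UB e by simp
    then show ?thesis by (intro exI[of _ "\<lambda>_. 1"] exI[of _ 0]) auto
  next
    case False
    then have ne: "- U \<noteq> {}" by auto
    define v where "v n x = min 1 (real n * infdist x (- U))" for n x
    have lip: "\<bar>v n x - v n y\<bar> \<le> real n * dist x y" for n x y
    proof -
      have "\<bar>v n x - v n y\<bar> \<le> \<bar>real n * infdist x (- U) - real n * infdist y (- U)\<bar>"
        unfolding v_def by (auto simp: min_def abs_if)
      also have "\<dots> = real n * \<bar>infdist x (- U) - infdist y (- U)\<bar>"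
        by (simp add: abs_mult right_diff_distrib[symmetric])
      also have "\<dots> \<le> real n * dist x y"
        by (intro mult_left_mono infdist_triangle_abs) auto
      finally show ?thesis .
    qed
    have rng: "0 \<le> v n x" "v n x \<le> 1" for n x by (auto simp: v_def infdist_nonneg)
    have [measurable]: "v n \<in> borel_measurable borel" for n
      unfolding v_def by (intro borel_measurable_continuous_onI continuous_intros)
    have lim: "(\<lambda>n. \<bar>indicator U x - v n x\<bar>) \<longlonglongrightarrow> 0" for x
    proof (cases "x \<in> U")
      case True
      have "infdist x (- U) > 0"
        using in_closed_iff_infdist_zero[of "-U" x] ne True U(2) infdist_nonneg[of x "-U"]
        by (auto simp: closed_def less_le)
      then obtain N where N: "1 / infdist x (- U) < real N" using reals_Archimedean2 by blast
      have "v n x = 1" if "n \<ge> N" for n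
      proof -
        have "1 < real N * infdist x (- U)" using N \<open>infdist x (- U) > 0\<close> by (simp add: field_simps)
        also have "\<dots> \<le> real n * infdist x (- U)" using that by (intro mult_right_mono) (auto simp: infdist_nonneg)
        finally show ?thesis by (simp add: v_def)
      qed
      then have "eventually (\<lambda>n. \<bar>indicator U x - v n x\<bar> = 0) sequentially"
        using True by (intro eventually_sequentiallyI[of N]) auto
      then show ?thesis by (rule tendsto_eventually)
    next
      case False then show ?thesis by (simp add: v_def)
    qed
    have "(\<lambda>n. \<integral>x. \<bar>indicator U x - v n x\<bar> \<partial>M) \<longlonglongrightarrow> (\<integral>x. 0 \<partial>M)"
    proof (rule integral_dominated_convergence[where w="\<lambda>_. 1"])
      have "\<bar>indicator U x - v i x\<bar> \<le> 1" for i x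
        using rng[of i x] by (auto split: split_indicator simp: abs_if)
      then show "AE x in M. norm \<bar>indicator U x - v i x\<bar> \<le> 1" for i by auto
    qed (use lim in auto)
    then have "eventually (\<lambda>n. (\<integral>x. \<bar>indicator U x - v n x\<bar> \<partial>M) < e/2) sequentially"
      using e by (intro order_tendstoD) auto
    then obtain n where n: "(\<integral>x. \<bar>indicator U x - v n x\<bar> \<partial>M) < e/2"
      using eventually_happens by fastforce
    have "\<bar>indicator S x - v n x\<bar> \<le> 1" for S x
      using rng[of n x] by (auto split: split_indicator simp: abs_if)
    then have i1: "integrable M (\<lambda>x. \<bar>indicator S x - v n x\<bar>)" if [measurable]: "S \<in> sets borel" for S
      by (intro integrable_const_bound[where B=1]) auto
    have "(\<integral>x. \<bar>indicator B x - v n x\<bar> \<partial>M) \<le> (\<integral>x. indicator (U - B) x + \<bar>indicator U x - v n x\<bar> \<partial>M)"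
    proof (rule integral_mono)
      show "integrable M (\<lambda>x. \<bar>indicator B x - v n x\<bar>)"
        using i1 by simp
      show "integrable M (\<lambda>x. indicator (U - B) x + \<bar>indicator U x - v n x\<bar>)"
        using i1 by (intro Bochner_Integration.integrable_add) (auto simp: sb emeasure_eq_measure)
      show "\<bar>indicator B x - v n x\<bar> \<le> indicator (U - B) x + \<bar>indicator U x - v n x\<bar>" for x
        using U(1) rng[of n x] by (auto split: split_indicator)
    qed
    also have "\<dots> = measure M U - measure M B + (\<integral>x. \<bar>indicator U x - v n x\<bar> \<partial>M)"
      using i1 U(1) by (subst Bochner_Integration.integral_add) (auto simp: sb emeasure_eq_measure finite_measure_Diff)
    also have "\<dots> < e" using UB n by simp
    finally show ?thesis using lip[of n] rng by blast
  qed
qed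

lemma sum_indicator_floor:
  fixes t :: real assumes "0 \<le> t" "t \<le> real n"
  shows "(\<Sum>k\<in>{1..n}. if real k \<le> t then 1 else 0 :: real) = of_int \<lfloor>t\<rfloor>"
proof -
  have "{k \<in> {1..n}. real k \<le> t} = {1..nat \<lfloor>t\<rfloor>}"
    using assms by (auto simp: le_nat_iff le_floor_iff)
  then have "(\<Sum>k\<in>{1..n}. if real k \<le> t then 1 else 0 :: real) = real (card {1..nat \<lfloor>t\<rfloor>})"
    by (subst sum.inter_filter[symmetric]) auto
  then show ?thesis using assms by simp
qed

text \<open>Layer-cake argument: the mean of the indicators of the \<open>n\<close> superlevel sets
  is within \<open>1 / n\<close> of \<open>u\<close>. The mean of their Lipschitz approximations,
  each within \<open>e / 2\<close> in mean, is then good enough once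
  \<open>K / n < e / 2\<close>.\<close>

lemma unit_lipschitz_approx:
  fixes M :: "'a::polish_space measure"
  assumes sb[measurable_cong]: "sets M = sets borel" and fin: "finite_measure M"
    and u[measurable]: "u \<in> borel_measurable borel" and u01: "\<And>x. 0 \<le> u x \<and> u x \<le> 1" and e: "e > (0::real)"
  shows "\<exists>v C. (\<forall>x y. \<bar>v x - v y\<bar> \<le> C * dist x y) \<and> (\<forall>x. 0 \<le> v x \<and> v x \<le> 1)
    \<and> (\<integral>x. \<bar>u x - v x\<bar> \<partial>M) < e"
proof -
  interpret finite_measure M by fact
  define K where "K = measure M (space M)"
  have K: "K \<ge> 0" by (simp add: K_def)
  obtain n where n: "real n > 2 * (K + 1) / e" using reals_Archimedean2 by blast
  have "2 * (K + 1) / e > 0" using K e by auto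
  then have n0: "real n > 0" using n by linarith
  have Kn: "K / n < e / 2" using n n0 K e by (simp add: field_simps)
  have "\<forall>k. \<exists>v C. (\<forall>x y. \<bar>v x - v y\<bar> \<le> C * dist x y) \<and> (\<forall>x. 0 \<le> v x \<and> v x \<le> 1)
    \<and> (\<integral>x. \<bar>indicator {x. real k \<le> real n * u x} x - v x\<bar> \<partial>M) < e/2"
    using e by (intro allI indicator_lipschitz_approx[OF sb fin]) auto
  then obtain v C where v: "\<And>k x y. \<bar>v k x - v k y\<bar> \<le> C k * dist x y" "\<And>k x. 0 \<le> v k x \<and> v k x \<le> 1"
    "\<And>k. (\<integral>x. \<bar>indicator {x. real k \<le> real n * u x} x - v k x\<bar> \<partial>M) < e/2"
    by (simp only: choice_iff) blast
  have [measurable]: "v k \<in> borel_measurable borel" for k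
    by (rule borel_measurable_lipschitz(2)[OF v(1)])
  let ?I = "\<lambda>k x. indicator {x. real k \<le> real n * u x} x :: real"
  define V where "V x = (\<Sum>k\<in>{1..n}. v k x) / n" for x
  have "\<bar>V x - V y\<bar> \<le> ((\<Sum>k\<in>{1..n}. C k) / n) * dist x y" for x y
  proof -
    have "\<bar>V x - V y\<bar> = \<bar>\<Sum>k\<in>{1..n}. v k x - v k y\<bar> / n"
      using n0 by (simp add: V_def diff_divide_distrib[symmetric] sum_subtractf)
    also have "\<dots> \<le> (\<Sum>k\<in>{1..n}. C k * dist x y) / n"
      using n0 by (intro divide_right_mono order_trans[OF sum_abs] sum_mono v(1)) auto
    finally show ?thesis by (simp add: sum_distrib_right)
  qed
  moreover have "0 \<le> V x \<and> V x \<le> 1" for x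
    using v(2) n0 sum_mono[of "{1..n}" "\<lambda>k. v k x" "\<lambda>_. 1"]
    by (auto simp: V_def field_simps intro!: divide_nonneg_nonneg sum_nonneg)
  moreover have "(\<integral>x. \<bar>u x - V x\<bar> \<partial>M) < e"
  proof -
    have i: "integrable M (\<lambda>x. \<bar>?I k x - v k x\<bar>)" for k
    proof (rule integrable_const_bound[where B=1])
      have "\<bar>?I k x - v k x\<bar> \<le> 1" for x
        using v(2)[of k x] by (auto split: split_indicator simp: abs_if)
      then show "AE x in M. norm \<bar>?I k x - v k x\<bar> \<le> 1" by auto
    qed simp
    have pt: "\<bar>u x - V x\<bar> \<le> 1 / n + (\<Sum>k\<in>{1..n}. \<bar>?I k x - v k x\<bar>) / n" for x
    proof -
      have "(\<Sum>k\<in>{1..n}. ?I k x) = of_int \<lfloor>n * u x\<rfloor>"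
        using sum_indicator_floor[of "n * u x" n] u01[of x] n0
        by (simp add: indicator_def of_bool_def mult_left_le)
      then have "\<bar>n * u x - (\<Sum>k\<in>{1..n}. ?I k x)\<bar> \<le> 1" by linarith
      moreover have "\<bar>(\<Sum>k\<in>{1..n}. ?I k x) - (\<Sum>k\<in>{1..n}. v k x)\<bar> \<le> (\<Sum>k\<in>{1..n}. \<bar>?I k x - v k x\<bar>)"
        by (simp add: sum_subtractf[symmetric] sum_abs)
      ultimately have "\<bar>n * u x - (\<Sum>k\<in>{1..n}. v k x)\<bar> \<le> 1 + (\<Sum>k\<in>{1..n}. \<bar>?I k x - v k x\<bar>)" by linarith
      moreover have "u x - V x = (n * u x - (\<Sum>k\<in>{1..n}. v k x)) / n" using n0 by (simp add: V_def field_simps)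
      ultimately show ?thesis using n0 by (simp add: abs_divide add_divide_distrib[symmetric] divide_right_mono)
    qed
    have "(\<integral>x. \<bar>u x - V x\<bar> \<partial>M) \<le> (\<integral>x. 1 / n + (\<Sum>k\<in>{1..n}. \<bar>?I k x - v k x\<bar>) / n \<partial>M)"
    proof (rule integral_mono)
      show "integrable M (\<lambda>x. 1 / n + (\<Sum>k\<in>{1..n}. \<bar>?I k x - v k x\<bar>) / n)"
        using i by auto
      show "integrable M (\<lambda>x. \<bar>u x - V x\<bar>)"
        by (rule Bochner_Integration.integrable_bound[OF \<open>integrable M (\<lambda>x. 1 / n + (\<Sum>k\<in>{1..n}. \<bar>?I k x - v k x\<bar>) / n)\<close>])
          (use pt in \<open>auto simp: V_def intro!: AE_I2 order_trans[OF _ abs_ge_self]\<close>)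
    qed (rule pt)
    also have "\<dots> = K / n + (\<Sum>k\<in>{1..n}. (\<integral>x. \<bar>?I k x - v k x\<bar> \<partial>M)) / n"
      using i by (simp add: Bochner_Integration.integral_sum K_def)
    also have "\<dots> \<le> K / n + (\<Sum>k\<in>{1..n}. e/2) / n"
      using v(3) n0 by (intro add_left_mono divide_right_mono sum_mono less_imp_le) auto
    also have "\<dots> = K / n + e / 2" using n0 by simp
    also have "\<dots> < e" using Kn by linarith
    finally show ?thesis .
  qed
  ultimately show ?thesis by blast
qed

lemma bounded_lipschitz_approx:
  fixes M :: "'a::polish_space measure"
  assumes sb[measurable_cong]: "sets M = sets borel" and fin: "finite_measure M"
    and u[measurable]: "u \<in> borel_measurable borel" and ub: "\<And>x. \<bar>u x\<bar> \<le> B" and e: "e > (0::real)"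
  shows "\<exists>v C. (\<forall>x y. \<bar>v x - v y\<bar> \<le> C * dist x y) \<and> (\<forall>x. \<bar>v x\<bar> \<le> B) \<and> (\<integral>x. \<bar>u x - v x\<bar> \<partial>M) < e"
proof (cases "B > 0")
  case False
  then have "u x = 0" for x using ub[of x] by auto
  moreover have "B = 0" using False ub[of undefined] by linarith
  ultimately show ?thesis using e by (intro exI[of _ "\<lambda>_. 0"] exI[of _ 0]) auto
next
  case True
  define u' where "u' x = (u x + B) / (2 * B)" for x
  have "0 \<le> u' x \<and> u' x \<le> 1" for x using ub[of x] True by (auto simp: u'_def field_simps abs_le_iff)
  moreover have "u' \<in> borel_measurable borel" by (simp add: u'_def[abs_def])
  ultimately obtain v C where v: "\<And>x y. \<bar>v x - v y\<bar> \<le> C * dist x y" "\<And>x. 0 \<le> v x \<and> v x \<le> 1"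
    "(\<integral>x. \<bar>u' x - v x\<bar> \<partial>M) < e / (2 * B)"
    using unit_lipschitz_approx[OF sb fin, of u' "e / (2 * B)"] e True by auto
  define V where "V x = 2 * B * v x - B" for x
  have "\<bar>V x - V y\<bar> \<le> (2 * B * C) * dist x y" for x y
  proof -
    have "V x - V y = 2 * B * (v x - v y)" by (simp add: V_def algebra_simps)
    then have "\<bar>V x - V y\<bar> = 2 * B * \<bar>v x - v y\<bar>" using True by (simp add: abs_mult)
    then show ?thesis using v(1)[of x y] True by (simp add: mult.assoc)
  qed
  moreover have "\<bar>V x\<bar> \<le> B" for x
  proof -
    have "0 \<le> B * v x" "B * v x \<le> B" using v(2)[of x] True by (auto simp: mult_left_le)
    then show ?thesis by (simp add: V_def abs_le_iff)
  qed
  moreover have "(\<integral>x. \<bar>u x - V x\<bar> \<partial>M) < e"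
  proof -
    have "\<bar>u x - V x\<bar> = 2 * B * \<bar>u' x - v x\<bar>" for x
    proof -
      have "u x - V x = 2 * B * (u' x - v x)" using True by (simp add: V_def u'_def field_simps)
      then show ?thesis using True by (simp add: abs_mult)
    qed
    then show ?thesis using v(3) True by (simp add: field_simps)
  qed
  ultimately show ?thesis by blast
qed

text \<open>Truncation at a large level reduces to the bounded case; dominated convergence makes the
  truncation error at most \<open>e / 2\<close>.\<close>

lemma integrable_lipschitz_approx:
  fixes M :: "'a::polish_space measure"
  assumes sb[measurable_cong]: "sets M = sets borel" and fin: "finite_measure M"
    and u: "integrable M u" and e: "e > (0::real)"
  shows "\<exists>v C. (\<forall>x y. \<bar>v x - v y\<bar> \<le> C * dist x y) \<and> integrable M v \<and> (\<integral>x. \<bar>u x - v x\<bar> \<partial>M) < e"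
proof -
  interpret finite_measure M by fact
  have um[measurable]: "u \<in> borel_measurable borel" using u measurable_cong_sets[OF sb refl] by (auto dest: borel_measurable_integrable)
  define c where "c n x = max (- real n) (min (real n) (u x))" for n x
  have [measurable]: "c n \<in> borel_measurable borel" for n by (simp add: c_def[abs_def])
  have "(\<lambda>n. \<integral>x. \<bar>u x - c n x\<bar> \<partial>M) \<longlonglongrightarrow> (\<integral>x. 0 \<partial>M)"
  proof (rule integral_dominated_convergence[where w="\<lambda>x. \<bar>u x\<bar>"])
    show "AE x in M. (\<lambda>n. \<bar>u x - c n x\<bar>) \<longlonglongrightarrow> 0"
    proof (rule AE_I2)
      fix x
      obtain N where "\<bar>u x\<bar> \<le> real N" using real_arch_simple by blast
      then have "eventually (\<lambda>n. \<bar>u x - c n x\<bar> = 0) sequentially"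
        by (intro eventually_sequentiallyI[of N]) (auto simp: c_def)
      then show "(\<lambda>n. \<bar>u x - c n x\<bar>) \<longlonglongrightarrow> 0" by (rule tendsto_eventually)
    qed
    show "AE x in M. norm \<bar>u x - c n x\<bar> \<le> \<bar>u x\<bar>" for n by (auto simp: c_def)
  qed (use u in auto)
  then have "eventually (\<lambda>n. (\<integral>x. \<bar>u x - c n x\<bar> \<partial>M) < e/2) sequentially"
    using e by (intro order_tendstoD) auto
  then obtain n where n: "(\<integral>x. \<bar>u x - c n x\<bar> \<partial>M) < e/2"
    using eventually_happens by fastforce
  have cb: "\<bar>c n x\<bar> \<le> n" for x by (auto simp: c_def)
  obtain v C where v: "\<And>x y. \<bar>v x - v y\<bar> \<le> C * dist x y" "\<And>x. \<bar>v x\<bar> \<le> n" "(\<integral>x. \<bar>c n x - v x\<bar> \<partial>M) < e/2"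
    using bounded_lipschitz_approx[OF sb fin, of "c n" n "e/2"] cb e by auto
  have [measurable]: "v \<in> borel_measurable borel" by (rule borel_measurable_lipschitz(2)[OF v(1)])
  have ci: "integrable M (c n)" by (rule integrable_const_bound[where B=n]) (use cb in auto)
  have vi: "integrable M v" by (rule integrable_const_bound[where B=n]) (use v(2) in auto)
  have "(\<integral>x. \<bar>u x - v x\<bar> \<partial>M) \<le> (\<integral>x. \<bar>u x - c n x\<bar> + \<bar>c n x - v x\<bar> \<partial>M)"
    using u ci vi by (intro integral_mono) auto
  also have "\<dots> < e" using n v(3) u ci vi by simp
  finally show ?thesis using v(1) vi by blast
qed

section \<open>Relative entropy\<close>

lemma xlnx_ge: "0 \<le> x \<Longrightarrow> -1 \<le> x * ln (x::real)"
proof (cases "x = 0")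
  case False
  assume "0 \<le> x"
  with False have x: "x > 0" by simp
  have "ln (1/x) \<le> 1/x - 1" using x by (intro ln_le_minus_one) auto
  then have "x * ln (1/x) \<le> x * (1/x - 1)" using x by (intro mult_left_mono) auto
  then show ?thesis using x by (simp add: ln_div algebra_simps)
qed simp

text \<open>Fenchel-Young inequality between \<open>a * ln a - a\<close> and its conjugate
  \<open>exp\<close>; it is \<open>ln t \<le> t - 1\<close> at \<open>t = exp h / a\<close>.\<close>

lemma young_entropy: "0 \<le> a \<Longrightarrow> a * h \<le> a * ln a - a + exp (h::real)"
proof (cases "a = 0")
  case False
  assume "0 \<le> a"
  with False have a: "a > 0" by simp
  have "ln (exp h / a) \<le> exp h / a - 1" using a by (intro ln_le_minus_one) auto
  then have "a * (h - ln a) \<le> a * (exp h / a - 1)" using a by (intro mult_left_mono) (auto simp: ln_div)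
  then show ?thesis using a by (simp add: algebra_simps)
qed simp

text \<open>In \<open>ereal\<close>, \<open>\<infinity> - \<infinity> = \<infinity>\<close>, so a
  finite value forces the positive part to be finite. The reference measure is merely sigma-finite
  in order to include \<open>lborel\<close>, where the negative part has to be controlled by other
  means.\<close>

lemma Ent_finiteD:
  assumes "sigma_finite_measure \<rho>" and "finite_measure \<gamma>" and "Ent \<gamma> \<rho> < \<infinity>"
  shows "\<exists>g. g \<in> borel_measurable \<rho> \<and> (\<forall>x. 0 \<le> g x) \<and> \<gamma> = density \<rho> (\<lambda>x. ennreal (g x))
    \<and> g = (\<lambda>x. enn2real (RN_deriv \<rho> \<gamma> x)) \<and> (\<integral>\<^sup>+ x. ennreal (g x * ln (g x)) \<partial>\<rho>) < \<infinity>
    \<and> Ent \<gamma> \<rho> = enn2ereal (\<integral>\<^sup>+ x. ennreal (g x * ln (g x)) \<partial>\<rho>)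
          - enn2ereal (\<integral>\<^sup>+ x. ennreal (- (g x * ln (g x))) \<partial>\<rho>)"
proof -
  interpret sigma_finite_measure \<rho> by fact
  interpret g: finite_measure \<gamma> by fact
  define g where "g x = enn2real (RN_deriv \<rho> \<gamma> x)" for x
  have ac: "sets \<gamma> = sets \<rho>" "absolutely_continuous \<rho> \<gamma>"
    using assms(3) by (auto simp: Ent_def split: if_splits)
  have [measurable]: "g \<in> borel_measurable \<rho>" unfolding g_def by measurable
  have E: "Ent \<gamma> \<rho> = enn2ereal (\<integral>\<^sup>+ x. ennreal (g x * ln (g x)) \<partial>\<rho>)
          - enn2ereal (\<integral>\<^sup>+ x. ennreal (- (g x * ln (g x))) \<partial>\<rho>)"
    using ac by (simp add: Ent_def Let_def g_def)
  have "AE x in \<rho>. RN_deriv \<rho> \<gamma> x \<noteq> \<infinity>"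
    using RN_deriv_finite[OF g.sigma_finite_measure ac(2,1)] .
  then have "AE x in \<rho>. RN_deriv \<rho> \<gamma> x = ennreal (g x)"
    by eventually_elim (simp add: g_def less_top)
  then have "density \<rho> (RN_deriv \<rho> \<gamma>) = density \<rho> (\<lambda>x. ennreal (g x))"
    by (intro density_cong) auto
  then have "\<gamma> = density \<rho> (\<lambda>x. ennreal (g x))"
    using density_RN_deriv[OF ac(2,1)] by simp
  moreover have "(\<integral>\<^sup>+ x. ennreal (g x * ln (g x)) \<partial>\<rho>) < \<infinity>"
    using assms(3) unfolding E by (auto simp: less_top[symmetric])
  ultimately show ?thesis using E by (intro exI[of _ g]) (auto simp: g_def)
qed

text \<open>Over a finite reference measure the bound \<open>x * ln x \<ge> - 1\<close> makes the
  negative part finite as well, so that the entropy is an ordinary integral.\<close>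

lemma Ent_finite_cases:
  assumes "finite_measure \<rho>" and "finite_measure \<gamma>" and "Ent \<gamma> \<rho> < \<infinity>"
  shows "\<exists>g. g \<in> borel_measurable \<rho> \<and> (\<forall>x. 0 \<le> g x) \<and> \<gamma> = density \<rho> (\<lambda>x. ennreal (g x))
    \<and> integrable \<rho> (\<lambda>x. g x * ln (g x)) \<and> Ent \<gamma> \<rho> = ereal (\<integral>x. g x * ln (g x) \<partial>\<rho>)"
proof -
  interpret finite_measure \<rho> by fact
  obtain g where g[measurable]: "g \<in> borel_measurable \<rho>" and g0: "\<And>x. 0 \<le> g x"
    and d: "\<gamma> = density \<rho> (\<lambda>x. ennreal (g x))" and P: "(\<integral>\<^sup>+ x. ennreal (g x * ln (g x)) \<partial>\<rho>) < \<infinity>"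
    and E: "Ent \<gamma> \<rho> = enn2ereal (\<integral>\<^sup>+ x. ennreal (g x * ln (g x)) \<partial>\<rho>)
          - enn2ereal (\<integral>\<^sup>+ x. ennreal (- (g x * ln (g x))) \<partial>\<rho>)"
    using Ent_finiteD[OF sigma_finite_measure_axioms assms(2,3)] by blast
  have "(\<integral>\<^sup>+ x. ennreal (- (g x * ln (g x))) \<partial>\<rho>) \<le> (\<integral>\<^sup>+ x. 1 \<partial>\<rho>)"
    using xlnx_ge[OF g0] by (intro nn_integral_mono) (auto intro!: ennreal_le_1[THEN iffD2] simp: minus_le_iff)
  also have "\<dots> < \<infinity>" by (simp add: less_top[symmetric])
  finally have N: "(\<integral>\<^sup>+ x. ennreal (- (g x * ln (g x))) \<partial>\<rho>) < \<infinity>" .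
  have i: "integrable \<rho> (\<lambda>x. g x * ln (g x))"
    using P N by (auto simp: real_integrable_def)
  have "Ent \<gamma> \<rho> = ereal (\<integral>x. g x * ln (g x) \<partial>\<rho>)"
    unfolding E real_lebesgue_integral_def[OF i] using P N
    by (cases "\<integral>\<^sup>+ x. ennreal (g x * ln (g x)) \<partial>\<rho>"; cases "\<integral>\<^sup>+ x. ennreal (- (g x * ln (g x))) \<partial>\<rho>") auto
  then show ?thesis using d i g g0 by blast
qed

lemma Ent_density:
  assumes "finite_measure \<rho>" and g[measurable]: "g \<in> borel_measurable \<rho>" and g0: "\<And>x. 0 \<le> g x"
    and i: "integrable \<rho> (\<lambda>x. g x * ln (g x))"
  shows "Ent (density \<rho> (\<lambda>x. ennreal (g x))) \<rho> = ereal (\<integral>x. g x * ln (g x) \<partial>\<rho>)"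
proof -
  interpret finite_measure \<rho> by fact
  let ?\<gamma> = "density \<rho> (\<lambda>x. ennreal (g x))"
  have "AE x in \<rho>. ennreal (g x) = RN_deriv \<rho> ?\<gamma> x"
    by (rule RN_deriv_unique) auto
  then have ae: "AE x in \<rho>. enn2real (RN_deriv \<rho> ?\<gamma> x) = g x"
    by eventually_elim (metis enn2real_ennreal g0)
  have 1: "(\<integral>\<^sup>+ x. ennreal (enn2real (RN_deriv \<rho> ?\<gamma> x) * ln (enn2real (RN_deriv \<rho> ?\<gamma> x))) \<partial>\<rho>)
     = (\<integral>\<^sup>+ x. ennreal (g x * ln (g x)) \<partial>\<rho>)"
    by (rule nn_integral_cong_AE) (use ae in eventually_elim, simp)
  have 2: "(\<integral>\<^sup>+ x. ennreal (- (enn2real (RN_deriv \<rho> ?\<gamma> x) * ln (enn2real (RN_deriv \<rho> ?\<gamma> x)))) \<partial>\<rho>)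
     = (\<integral>\<^sup>+ x. ennreal (- (g x * ln (g x))) \<partial>\<rho>)"
    by (rule nn_integral_cong_AE) (use ae in eventually_elim, simp)
  have ac: "absolutely_continuous \<rho> ?\<gamma>" by (rule absolutely_continuousI_density) simp
  have PN: "(\<integral>\<^sup>+ x. ennreal (g x * ln (g x)) \<partial>\<rho>) \<noteq> \<infinity>" "(\<integral>\<^sup>+ x. ennreal (- (g x * ln (g x))) \<partial>\<rho>) \<noteq> \<infinity>"
    using i by (auto simp: real_integrable_def)
  have "Ent ?\<gamma> \<rho> = enn2ereal (\<integral>\<^sup>+ x. ennreal (g x * ln (g x)) \<partial>\<rho>)
          - enn2ereal (\<integral>\<^sup>+ x. ennreal (- (g x * ln (g x))) \<partial>\<rho>)"
    using ac by (simp add: Ent_def Let_def 1 2)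
  then show ?thesis unfolding real_lebesgue_integral_def[OF i] using PN
    by (cases "\<integral>\<^sup>+ x. ennreal (g x * ln (g x)) \<partial>\<rho>"; cases "\<integral>\<^sup>+ x. ennreal (- (g x * ln (g x))) \<partial>\<rho>") auto
qed

text \<open>The Fenchel-Young inequality integrated pointwise. Only integrability is asked of
  \<open>h\<close> and \<open>exp h\<close>, because the weight used later contains
  \<open>ln f\<close> and is unbounded.\<close>

lemma Ent_ge_dual:
  assumes "finite_measure \<rho>" and "finite_measure \<gamma>"
    and h: "integrable \<gamma> h" and eh: "integrable \<rho> (\<lambda>x. exp (h x))"
    and hm: "h \<in> borel_measurable \<rho>"
  shows "ereal ((\<integral>x. h x \<partial>\<gamma>) + measure \<gamma> (space \<gamma>) - (\<integral>x. exp (h x) \<partial>\<rho>)) \<le> Ent \<gamma> \<rho>"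
proof (cases "Ent \<gamma> \<rho> < \<infinity>")
  case True
  interpret finite_measure \<rho> by fact
  interpret g: finite_measure \<gamma> by fact
  note hm[measurable]
  obtain g where g[measurable]: "g \<in> borel_measurable \<rho>" and g0: "\<And>x. 0 \<le> g x"
    and d: "\<gamma> = density \<rho> (\<lambda>x. ennreal (g x))" and i: "integrable \<rho> (\<lambda>x. g x * ln (g x))"
    and E: "Ent \<gamma> \<rho> = ereal (\<integral>x. g x * ln (g x) \<partial>\<rho>)"
    using Ent_finite_cases[OF assms(1,2) True] by blast
  have gh: "integrable \<rho> (\<lambda>x. g x * h x)"
    using h unfolding d by (subst (asm) integrable_density) (auto simp: g0)
  have "integrable \<gamma> (\<lambda>x. 1::real)" by simp
  then have gi: "integrable \<rho> g" unfolding d by (subst (asm) integrable_density) (auto simp: g0)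
  have "(\<integral>x. 1 \<partial>\<gamma>) = (\<integral>x. g x \<partial>\<rho>)" unfolding d by (subst integral_density) (auto simp: g0)
  then have m: "measure \<gamma> (space \<gamma>) = (\<integral>x. g x \<partial>\<rho>)" by simp
  have "(\<integral>x. h x \<partial>\<gamma>) = (\<integral>x. g x * h x \<partial>\<rho>)" unfolding d by (subst integral_density) (auto simp: g0)
  then have "(\<integral>x. h x \<partial>\<gamma>) + measure \<gamma> (space \<gamma>) - (\<integral>x. exp (h x) \<partial>\<rho>) = (\<integral>x. g x * h x + g x - exp (h x) \<partial>\<rho>)"
    using m gh gi eh by simp
  also have "\<dots> \<le> (\<integral>x. g x * ln (g x) \<partial>\<rho>)"
  proof (rule integral_mono)
    show "g x * h x + g x - exp (h x) \<le> g x * ln (g x)" for x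
      using young_entropy[OF g0[of x], of "h x"] by simp
  qed (use gh gi eh i in auto)
  finally show ?thesis using E by simp
qed (auto simp: not_less)

text \<open>Duality has no gap even among bounded test functions. If \<open>\<gamma>\<close> charges
  a null set of \<open>\<rho>\<close>, large multiples of its indicator give arbitrarily large
  values; otherwise the logarithm of the density, truncated at growing levels, is a maximising
  sequence.\<close>

lemma Ent_less_dual:
  assumes fr: "finite_measure \<rho>" and fg: "finite_measure \<gamma>" and s[measurable_cong]: "sets \<gamma> = sets \<rho>"
    and c: "ereal c < Ent \<gamma> \<rho>"
  shows "\<exists>h B. h \<in> borel_measurable \<rho> \<and> (\<forall>x. \<bar>h x\<bar> \<le> B) \<and>
    c < (\<integral>x. h x \<partial>\<gamma>) + measure \<gamma> (space \<gamma>) - (\<integral>x. exp (h x) \<partial>\<rho>)"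
proof -
  interpret finite_measure \<rho> by fact
  interpret g: finite_measure \<gamma> by fact
  have sp: "space \<gamma> = space \<rho>" by (rule sets_eq_imp_space_eq[OF s])
  show ?thesis
  proof (cases "absolutely_continuous \<rho> \<gamma>")
    case False
    then obtain N where N: "N \<in> null_sets \<rho>" "N \<notin> null_sets \<gamma>"
      by (auto simp: absolutely_continuous_def)
    have [measurable]: "N \<in> sets \<rho>" using N by auto
    have p: "measure \<gamma> N > 0" using N s by (auto simp: null_sets_def g.emeasure_eq_measure zero_less_measure_iff)
    \<comment> \<open>Multiplying the indicator of \<open>N\<close> by \<open>n\<close> leaves the
      exponential term at the total mass of \<open>\<rho>\<close>, while the linear term grows like
      \<open>n * measure \<gamma> N\<close>.\<close>
    obtain n where n: "real n > (c - measure \<gamma> (space \<gamma>) + measure \<rho> (space \<rho>)) / measure \<gamma> N"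
      using reals_Archimedean2 by blast
    let ?h = "\<lambda>x. real n * indicator N x"
    have "(\<integral>x. ?h x \<partial>\<gamma>) = n * measure \<gamma> N"
      by (simp add: Int_absorb1[OF sets.sets_into_space[of N \<gamma>]] s)
    moreover have "AE x in \<rho>. x \<notin> N" using N(1) by (rule AE_not_in)
    then have "AE x in \<rho>. exp (?h x) = 1" by eventually_elim simp
    then have "(\<integral>x. exp (?h x) \<partial>\<rho>) = (\<integral>x. 1 \<partial>\<rho>)" by (intro integral_cong_AE) auto
    ultimately have "c < (\<integral>x. ?h x \<partial>\<gamma>) + measure \<gamma> (space \<gamma>) - (\<integral>x. exp (?h x) \<partial>\<rho>)"
      using n p by (simp add: field_simps)
    then show ?thesis by (intro exI[of _ ?h] exI[of _ "real n"]) (auto split: split_indicator)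
  next
    case True
    define g where "g x = enn2real (RN_deriv \<rho> \<gamma> x)" for x
    have [measurable]: "g \<in> borel_measurable \<rho>" unfolding g_def by measurable
    have g0: "0 \<le> g x" for x by (simp add: g_def)
    have "AE x in \<rho>. RN_deriv \<rho> \<gamma> x \<noteq> \<infinity>"
      using RN_deriv_finite[OF g.sigma_finite_measure_axioms True s] .
    then have "AE x in \<rho>. RN_deriv \<rho> \<gamma> x = ennreal (g x)"
      by eventually_elim (simp add: g_def less_top)
    then have "density \<rho> (RN_deriv \<rho> \<gamma>) = density \<rho> (\<lambda>x. ennreal (g x))"
      by (intro density_cong) auto
    then have d: "\<gamma> = density \<rho> (\<lambda>x. ennreal (g x))"
      using density_RN_deriv[OF True s] by simp
    have E: "Ent \<gamma> \<rho> = enn2ereal (\<integral>\<^sup>+ x. ennreal (g x * ln (g x)) \<partial>\<rho>)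
          - enn2ereal (\<integral>\<^sup>+ x. ennreal (- (g x * ln (g x))) \<partial>\<rho>)"
      using True s by (simp add: Ent_def Let_def g_def)
    have gi: "integrable \<rho> g"
    proof -
      have "integrable \<gamma> (\<lambda>x. 1::real)" by simp
      then show ?thesis by (subst (asm) d, subst (asm) integrable_density) (auto simp: g0)
    qed
    have gm: "measure \<gamma> (space \<gamma>) = (\<integral>x. g x \<partial>\<rho>)"
    proof -
      have "(\<integral>x. 1 \<partial>\<gamma>) = (\<integral>x. g x \<partial>\<rho>)" by (subst d, subst integral_density) (auto simp: g0)
      then show ?thesis by simp
    qed
    \<comment> \<open>The density is clamped to an interval symmetric about 1 on the logarithmic
      scale, hence \<open>\<bar>ln t\<bar> \<le> ln (n + 1)\<close>.\<close>
    define t where "t n x = max (1 / real (Suc n)) (min (real (Suc n)) (g x))" for n x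
    define h where "h n x = ln (t n x)" for n x
    have t: "1 / real (Suc n) \<le> t n x" "t n x \<le> real (Suc n)" for n x
    proof -
      have "1 / real (Suc n) \<le> 1" "1 \<le> real (Suc n)" by auto
      then have "1 / real (Suc n) \<le> real (Suc n)" by linarith
      then show "1 / real (Suc n) \<le> t n x" "t n x \<le> real (Suc n)" by (auto simp: t_def)
    qed
    have tpos: "t n x > 0" for n x using t(1)[of n x] by (rule less_le_trans[rotated]) simp
    have [measurable]: "t n \<in> borel_measurable \<rho>" "h n \<in> borel_measurable \<rho>" for n
      unfolding t_def[abs_def] h_def[abs_def] by measurable
    have hb: "\<bar>h n x\<bar> \<le> ln (real (Suc n))" for n x
    proof -
      have "ln (1 / real (Suc n)) \<le> h n x" unfolding h_def using t(1)[of n x] tpos[of n x] by (subst ln_le_cancel_iff) auto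
      moreover have "h n x \<le> ln (real (Suc n))" unfolding h_def using t(2) tpos by (intro ln_mono) auto
      ultimately show ?thesis by (simp add: ln_div abs_le_iff)
    qed
    have eh: "exp (h n x) = t n x" for n x by (simp add: h_def tpos)
    define j where "j n x = g x * h n x + g x - t n x" for n x
    have [measurable]: "j n \<in> borel_measurable \<rho>" for n unfolding j_def[abs_def] by measurable
    have ti: "integrable \<rho> (t n)" for n
      by (rule integrable_const_bound[where B="Suc n"]) (use t(2)[of n] tpos[of n] in \<open>auto simp: less_imp_le\<close>)
    have ghi: "integrable \<rho> (\<lambda>x. g x * h n x)" for n
    proof (rule Bochner_Integration.integrable_bound[where f="\<lambda>x. g x * ln (real (Suc n))"])
      show "AE x in \<rho>. norm (g x * h n x) \<le> norm (g x * ln (real (Suc n)))"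
        using hb[of n] g0 by (auto simp: abs_mult intro!: mult_left_mono)
    qed (use gi in auto)
    have ji: "integrable \<rho> (j n)" for n unfolding j_def using ghi gi ti by auto
    have jv: "(\<integral>x. h n x \<partial>\<gamma>) + measure \<gamma> (space \<gamma>) - (\<integral>x. exp (h n x) \<partial>\<rho>) = (\<integral>x. j n x \<partial>\<rho>)" for n
    proof -
      have "(\<integral>x. h n x \<partial>\<gamma>) = (\<integral>x. g x * h n x \<partial>\<rho>)" by (subst d, subst integral_density) (auto simp: g0)
      then show ?thesis using ghi[of n] gi ti[of n] unfolding j_def eh gm by simp
    qed
    \<comment> \<open>Each \<open>h = ln t\<close> maximises \<open>g h - exp h\<close> over an interval containing 0, so \<open>j \<ge> - 1\<close> by comparison with \<open>h = 0\<close>.\<close>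
    have jlow: "-1 \<le> j n x" for n x
    proof -
      consider "g x \<le> 1 / real (Suc n)" | "g x \<ge> real (Suc n)" | "t n x = g x" 
        by (fastforce simp: t_def)
      then show ?thesis
      proof cases
        case 1
        then have tt: "t n x = 1 / real (Suc n)" by (auto simp: t_def)
        have "g x * ln (real (Suc n)) \<le> 1 / real (Suc n) * (real (Suc n) - 1)"
          using 1 g0[of x] by (intro mult_mono ln_le_minus_one) auto
        also have "\<dots> = 1 - 1 / real (Suc n)" by (simp add: field_simps)
        finally show ?thesis using g0[of x] by (simp add: j_def h_def tt ln_div)
      next
        case 2
        then have tt: "t n x = real (Suc n)" using t[of n x] by (auto simp: t_def)
        have "g x * h n x \<ge> 0" unfolding h_def tt using g0[of x] by (intro mult_nonneg_nonneg) auto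
        then show ?thesis using 2 by (simp add: j_def tt)
      next
        case 3
        then show ?thesis using xlnx_ge[OF g0[of x]] by (simp add: j_def h_def)
      qed
    qed
    have jlim: "(\<lambda>n. j n x) \<longlonglongrightarrow> g x * ln (g x)" for x
    proof (cases "g x = 0")
      case True
      have "j n x = - (1 / real (Suc n))" for n by (simp add: j_def True t_def)
      moreover have "(\<lambda>n. - (1 / real (Suc n))) \<longlonglongrightarrow> - 0"
        by (intro tendsto_minus LIMSEQ_Suc[OF lim_1_over_n])
      ultimately show ?thesis using True by simp
    next
      case False
      then have gp: "g x > 0" using g0[of x] by simp
      obtain N where N: "max (g x) (1 / g x) \<le> real N" using real_arch_simple by blast
      have "j n x = g x * ln (g x)" if "n \<ge> N" for n
      proof -
        have "g x \<le> real (Suc n)" "1 / g x \<le> real (Suc n)" using N that by auto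
        then have "t n x = g x" using gp by (auto simp: t_def field_simps)
        then show ?thesis by (simp add: j_def h_def)
      qed
      then show ?thesis by (intro tendsto_eventually eventually_sequentiallyI[of N]) auto
    qed
    have "\<exists>n. c < (\<integral>x. j n x \<partial>\<rho>)"
    proof (rule ccontr)
      assume "\<not> ?thesis"
      then have le: "(\<integral>x. j n x \<partial>\<rho>) \<le> c" for n by (auto simp: not_less)
      define K where "K = measure \<rho> (space \<rho>)"
      have nn: "(\<integral>\<^sup>+x. ennreal (j n x + 1) \<partial>\<rho>) = ennreal ((\<integral>x. j n x \<partial>\<rho>) + K)" for n
      proof (subst nn_integral_eq_integral)
        have "0 \<le> j n x + 1" for x using jlow[of n x] by linarith
        then show "AE x in \<rho>. 0 \<le> j n x + 1" by simp
      qed (use ji[of n] in \<open>auto simp: K_def\<close>)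
      \<comment> \<open>Fatou's lemma for \<open>j n + 1\<close>, nonnegative by
        \<open>jlow\<close>. It also yields the integrability of \<open>g * ln g\<close>, which is
        not known before.\<close>
      have "(\<integral>\<^sup>+x. ennreal (g x * ln (g x) + 1) \<partial>\<rho>) = (\<integral>\<^sup>+x. liminf (\<lambda>n. ennreal (j n x + 1)) \<partial>\<rho>)"
        using jlim by (intro nn_integral_cong lim_imp_Liminf[symmetric]) (auto intro!: tendsto_intros)
      also have "\<dots> \<le> liminf (\<lambda>n. \<integral>\<^sup>+x. ennreal (j n x + 1) \<partial>\<rho>)"
        by (rule nn_integral_liminf) auto
      also have "\<dots> \<le> liminf (\<lambda>n. ennreal (c + K))"
        unfolding nn using le by (intro Liminf_mono always_eventually allI ennreal_leI) auto
      also have "\<dots> = ennreal (c + K)" by (simp add: Liminf_const)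
      finally have 1: "(\<integral>\<^sup>+x. ennreal (g x * ln (g x) + 1) \<partial>\<rho>) \<le> ennreal (c + K)" .
      have cK: "0 \<le> c + K"
      proof -
        have "0 \<le> (\<integral>x. j 0 x + 1 \<partial>\<rho>)" by (intro Bochner_Integration.integral_nonneg) (use jlow[of 0] in \<open>smt (verit)\<close>)
        then show ?thesis using le[of 0] ji[of 0] by (simp add: K_def)
      qed
      have pos: "0 \<le> g x * ln (g x) + 1" for x using xlnx_ge[OF g0[of x]] by simp
      have i1: "integrable \<rho> (\<lambda>x. g x * ln (g x) + 1)"
        using 1 pos by (intro integrableI_nonneg) (auto intro: le_less_trans)
      then have i: "integrable \<rho> (\<lambda>x. g x * ln (g x))"
        using Bochner_Integration.integrable_diff[OF i1, of "\<lambda>_. 1"] by simp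
      have "(\<integral>x. g x * ln (g x) + 1 \<partial>\<rho>) \<le> c + K"
        using 1 i1 pos cK by (subst (asm) nn_integral_eq_integral) auto
      then have "(\<integral>x. g x * ln (g x) \<partial>\<rho>) \<le> c" using i by (simp add: K_def)
      moreover have "Ent \<gamma> \<rho> = ereal (\<integral>x. g x * ln (g x) \<partial>\<rho>)"
        using Ent_density[OF fr _ g0 i] d by simp
      ultimately show False using c by simp
    qed
    then obtain n where n: "c < (\<integral>x. j n x \<partial>\<rho>)" by blast
    then show ?thesis using jv[of n] hb[of n] by (intro exI[of _ "h n"] exI[of _ "ln (real (Suc n))"]) auto
  qed
qed

text \<open>Narrow convergence only tests continuous functions, so the bounded measurable maximiser
  is replaced by a Lipschitz one close to it in mean, for \<open>\<gamma>\<close> and for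
  \<open>\<rho>\<close>. Keeping the bound \<open>B\<close> makes \<open>exp\<close> Lipschitz on
  the range involved.\<close>

lemma Ent_less_dual_continuous:
  fixes \<rho> \<gamma> :: "'a::polish_space measure"
  assumes fr: "finite_measure \<rho>" and fg: "finite_measure \<gamma>"
    and s: "sets \<gamma> = sets borel" "sets \<rho> = sets borel" and c: "ereal c < Ent \<gamma> \<rho>"
  shows "\<exists>h B. continuous_on UNIV h \<and> (\<forall>x. \<bar>h x\<bar> \<le> B) \<and>
    c < (\<integral>x. h x \<partial>\<gamma>) + measure \<gamma> (space \<gamma>) - (\<integral>x. exp (h x) \<partial>\<rho>)"
proof -
  interpret r: finite_measure \<rho> by fact
  interpret g: finite_measure \<gamma> by fact
  note s[measurable_cong]
  obtain h B where h': "h \<in> borel_measurable \<rho>" and hB: "\<And>x. \<bar>h x\<bar> \<le> B"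
    and lt: "c < (\<integral>x. h x \<partial>\<gamma>) + measure \<gamma> (space \<gamma>) - (\<integral>x. exp (h x) \<partial>\<rho>)"
    using Ent_less_dual[OF fr fg _ c] s by auto
  have h[measurable]: "h \<in> borel_measurable borel" using h' measurable_cong_sets[OF s(2) refl] by blast
  have B0: "0 \<le> B" using hB[of undefined] by linarith
  define G where "G = (\<integral>x. h x \<partial>\<gamma>) + measure \<gamma> (space \<gamma>) - (\<integral>x. exp (h x) \<partial>\<rho>) - c"
  have G: "G > 0" using lt by (simp add: G_def)
  \<comment> \<open>The replacement loses at most \<open>d\<close> in the linear term and
    \<open>exp B * d\<close> in the exponential one, in total half of the slack
    \<open>G\<close>.\<close>
  define d where "d = G / (2 * (1 + exp B))"
  have d: "d > 0" using G by (auto simp: d_def intro!: divide_pos_pos add_pos_pos)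
  \<comment> \<open>A measure dominating both makes one approximation serve for both; the supremum
    is at most the sum, hence finite.\<close>
  define M where "M = sup_measure' \<gamma> \<rho>"
  have sM: "sets M = sets borel" using s by (simp add: M_def)
  have le: "\<gamma> \<le> M" "\<rho> \<le> M"
    using s le_emeasure_sup_measure'1[of \<rho> \<gamma>] le_emeasure_sup_measure'2[of \<rho> \<gamma>]
    by (auto simp: le_measure M_def)
  have "emeasure M UNIV \<le> emeasure \<gamma> UNIV + emeasure \<rho> UNIV"
    unfolding M_def using s
    by (subst emeasure_sup_measure') (auto intro!: SUP_least add_mono emeasure_mono)
  also have "\<dots> < \<infinity>" by (simp add: less_top[symmetric])
  finally have fM: "finite_measure M"
    using sets_eq_imp_space_eq[OF sM] by (intro finite_measureI) auto
  obtain v C where v: "\<And>x y. \<bar>v x - v y\<bar> \<le> C * dist x y" "\<And>x. \<bar>v x\<bar> \<le> B"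
    and vd: "(\<integral>x. \<bar>h x - v x\<bar> \<partial>M) < d"
    using bounded_lipschitz_approx[OF sM fM h hB d] by blast
  note vc = borel_measurable_lipschitz[OF v(1)]
  note vc(2)[measurable]
  interpret M: finite_measure M by (rule fM)
  note sM[measurable_cong]
  have hv: "\<bar>h x - v x\<bar> \<le> 2 * B" for x using hB[of x] v(2)[of x] by linarith
  have small: "(\<integral>x. \<bar>h x - v x\<bar> \<partial>N) < d" if "N \<le> M" and [measurable_cong]: "sets N = sets borel" for N
  proof -
    have "(\<integral>\<^sup>+x. ennreal \<bar>h x - v x\<bar> \<partial>N) \<le> (\<integral>\<^sup>+x. ennreal \<bar>h x - v x\<bar> \<partial>M)"
      using that sM by (intro nn_integral_mono_measure) auto
    also have "\<dots> = ennreal (\<integral>x. \<bar>h x - v x\<bar> \<partial>M)"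
      using hv by (intro nn_integral_eq_integral M.integrable_const_bound[where B="2 * B"]) auto
    finally have "(\<integral>x. \<bar>h x - v x\<bar> \<partial>N) \<le> (\<integral>x. \<bar>h x - v x\<bar> \<partial>M)"
      by (simp add: integral_eq_nn_integral enn2real_leI)
    then show ?thesis using vd by simp
  qed
  have ib: "integrable \<gamma> u" "integrable \<rho> u" if "u \<in> borel_measurable borel" "\<And>x. \<bar>u x\<bar> \<le> K" for u :: "'a \<Rightarrow> real" and K
    using that by (auto intro!: g.integrable_const_bound[where B=K] r.integrable_const_bound[where B=K])
  have "\<bar>exp (h x)\<bar> \<le> exp B" "\<bar>exp (v x)\<bar> \<le> exp B" for x using hB[of x] v(2)[of x] by auto
  then have ie: "integrable \<rho> (\<lambda>x. exp (h x))" "integrable \<rho> (\<lambda>x. exp (v x))"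
    by (auto intro!: ib[where K="exp B"])
  have ex: "exp (v x) - exp (h x) \<le> exp B * \<bar>h x - v x\<bar>" for x
  proof -
    have "1 + (h x - v x) \<le> exp (h x - v x)" by (rule exp_ge_add_one_self)
    then have "exp (v x) * (1 + (h x - v x)) \<le> exp (v x) * exp (h x - v x)" by (intro mult_left_mono) auto
    also have "\<dots> = exp (h x)" by (simp add: exp_add[symmetric])
    finally have "exp (v x) - exp (h x) \<le> exp (v x) * (v x - h x)" by (simp add: algebra_simps)
    also have "\<dots> \<le> exp (v x) * \<bar>h x - v x\<bar>" by (intro mult_left_mono) auto
    also have "\<dots> \<le> exp B * \<bar>h x - v x\<bar>"
      using v(2)[of x] by (intro mult_right_mono) auto
    finally show ?thesis .
  qed
  have "(\<integral>x. exp (v x) \<partial>\<rho>) - (\<integral>x. exp (h x) \<partial>\<rho>) = (\<integral>x. exp (v x) - exp (h x) \<partial>\<rho>)"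
    using ie by simp
  also have "\<dots> \<le> (\<integral>x. exp B * \<bar>h x - v x\<bar> \<partial>\<rho>)"
    using ie ex by (intro integral_mono) (auto intro!: ib[where K="2 * B"] hv)
  also have "\<dots> \<le> exp B * d" using small[OF le(2) s(2)] by simp
  finally have 1: "(\<integral>x. exp (v x) \<partial>\<rho>) - (\<integral>x. exp (h x) \<partial>\<rho>) \<le> exp B * d" .
  have "(\<integral>x. h x \<partial>\<gamma>) - (\<integral>x. v x \<partial>\<gamma>) = (\<integral>x. h x - v x \<partial>\<gamma>)"
    using hB v(2) by (subst Bochner_Integration.integral_diff) (auto intro!: ib[where K=B])
  also have "\<dots> \<le> (\<integral>x. \<bar>h x - v x\<bar> \<partial>\<gamma>)"
    using hv by (intro integral_mono ib[where K="2 * B"]) auto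
  also have "\<dots> \<le> d" using small[OF le(1) s(1)] by simp
  finally have 2: "(\<integral>x. h x \<partial>\<gamma>) - (\<integral>x. v x \<partial>\<gamma>) \<le> d" .
  have "(1 + exp B) * d = G / 2" by (simp add: d_def field_simps add_pos_pos less_imp_neq[symmetric])
  then have "d + exp B * d < G" using G by (simp add: algebra_simps)
  then have "c < (\<integral>x. v x \<partial>\<gamma>) + measure \<gamma> (space \<gamma>) - (\<integral>x. exp (v x) \<partial>\<rho>)"
    using 1 2 by (simp add: G_def)
  then show ?thesis using vc(1) v(2) by blast
qed

section \<open>The Laplace kernel and arc length along a set\<close>

text \<open>Two-sided exponential density of scale \<open>e\<close>. Its mass is 1 and its mean
  modulus is \<open>e\<close>; the normalisation \<open>2 * e\<close> is the one inside the
  logarithm of the functional.\<close>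

definition laplace :: "real \<Rightarrow> real \<Rightarrow> real" where
  "laplace e z = exp (- \<bar>z\<bar> / e) / (2 * e)"

lemma borel_measurable_laplace[measurable]: "laplace e \<in> borel_measurable borel"
  unfolding laplace_def[abs_def] by measurable

lemma laplace_nonneg: "0 < e \<Longrightarrow> 0 \<le> laplace e z" by (simp add: laplace_def)

lemma laplace_pos: "0 < e \<Longrightarrow> 0 < laplace e z" by (simp add: laplace_def)

lemma laplace_minus_commute: "laplace e (x - y) = laplace e (y - x)"
  by (simp add: laplace_def abs_minus_commute)

lemma nn_integral_exp_abs_power:
  "(\<integral>\<^sup>+x. ennreal (\<bar>x\<bar> ^ k * exp (- \<bar>x\<bar>)) \<partial>lborel) = ennreal (2 * fact k)"
proof -
  let ?f = "\<lambda>x::real. ennreal (x ^ k * exp (- x)) * indicator {0..} x"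
  have f: "(\<integral>\<^sup>+x. ?f x \<partial>lborel) = ennreal (fact k)"
    using nn_intergal_power_times_exp_Ici[of k] by simp
  have "(\<integral>\<^sup>+x. ?f x \<partial>lborel) = ennreal \<bar>-1::real\<bar> * (\<integral>\<^sup>+x. ?f (0 + (-1) * x) \<partial>lborel)"
    by (rule nn_integral_real_affine) auto
  then have g: "(\<integral>\<^sup>+x. ?f (- x) \<partial>lborel) = ennreal (fact k)" using f by simp
  \<comment> \<open>Both closed half-lines contain 0, where the identity fails for
    \<open>k = 0\<close>; hence equality almost everywhere.\<close>
  have "(\<integral>\<^sup>+x. ennreal (\<bar>x\<bar> ^ k * exp (- \<bar>x\<bar>)) \<partial>lborel) = (\<integral>\<^sup>+x. ?f x + ?f (- x) \<partial>lborel)"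
    by (rule nn_integral_cong_AE, rule AE_mp[OF AE_lborel_singleton[of 0]])
      (auto split: split_indicator)
  also have "\<dots> = ennreal (fact k) + ennreal (fact k)"
    using f g by (subst nn_integral_add) auto
  finally show ?thesis by (simp add: ennreal_plus[symmetric] del: ennreal_plus)
qed

lemma nn_integral_laplace_power:
  assumes e: "e > 0"
  shows "(\<integral>\<^sup>+x. ennreal (laplace e (x - c) * \<bar>x - c\<bar> ^ k) \<partial>lborel) = ennreal (e ^ k * fact k)"
proof -
  have "(\<integral>\<^sup>+x. ennreal (laplace e (x - c) * \<bar>x - c\<bar> ^ k) \<partial>lborel)
    = ennreal \<bar>e\<bar> * (\<integral>\<^sup>+x. ennreal (laplace e (c + e * x - c) * \<bar>c + e * x - c\<bar> ^ k) \<partial>lborel)"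
    using e by (intro nn_integral_real_affine) auto
  also have "(\<integral>\<^sup>+x. ennreal (laplace e (c + e * x - c) * \<bar>c + e * x - c\<bar> ^ k) \<partial>lborel)
    = (\<integral>\<^sup>+x. ennreal (e ^ k / (2 * e)) * ennreal (\<bar>x\<bar> ^ k * exp (- \<bar>x\<bar>)) \<partial>lborel)"
    using e by (intro nn_integral_cong) (simp add: laplace_def abs_mult power_mult_distrib ennreal_mult[symmetric] mult_ac)
  also have "\<dots> = ennreal (e ^ k / (2 * e)) * ennreal (2 * fact k)"
    by (subst nn_integral_cmult) (auto simp: nn_integral_exp_abs_power)
  finally show ?thesis using e by (simp add: ennreal_mult[symmetric])
qed

lemma nn_integral_laplace: "e > 0 \<Longrightarrow> (\<integral>\<^sup>+x. ennreal (laplace e (x - c)) \<partial>lborel) = 1"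
  using nn_integral_laplace_power[of e c 0] by simp

lemma nn_integral_laplace_abs:
  "e > 0 \<Longrightarrow> (\<integral>\<^sup>+x. ennreal (laplace e (x - c) * \<bar>x - c\<bar>) \<partial>lborel) = ennreal e"
  using nn_integral_laplace_power[of e c 1] by simp

section \<open>Arc length along a bounded Borel set\<close>

definition arclen :: "real set \<Rightarrow> real \<Rightarrow> real" where
  "arclen S x = measure lborel (S \<inter> {..x})"

context
  fixes S :: "real set" and L :: real
  assumes S[measurable]: "S \<in> sets borel" and SL: "S \<subseteq> {-L..L}" and L: "L > 0"
begin

lemma emeasure_subset_finite: "emeasure lborel (S \<inter> T) < \<infinity>"
proof -
  have "emeasure lborel (S \<inter> T) \<le> emeasure lborel {-L..L}" using SL by (intro emeasure_mono) auto
  then show ?thesis using L by (auto simp: emeasure_lborel_Icc le_less_trans)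
qed

lemma fmeasurable_subset: "T \<in> sets borel \<Longrightarrow> S \<inter> T \<in> fmeasurable lborel"
  using emeasure_subset_finite by (intro fmeasurableI) auto

lemma arclen_diff: "x \<le> y \<Longrightarrow> arclen S y - arclen S x = measure lborel (S \<inter> {x<..y})"
proof -
  assume "x \<le> y"
  then have "S \<inter> {..y} - S \<inter> {..x} = S \<inter> {x<..y}" by auto
  moreover have "measure lborel (S \<inter> {..y} - S \<inter> {..x}) = arclen S y - arclen S x"
    unfolding arclen_def using \<open>x \<le> y\<close>
    by (intro measurable_measure_Diff fmeasurable_subset) auto
  ultimately show ?thesis by simp
qed

lemma arclen_mono: "x \<le> y \<Longrightarrow> arclen S x \<le> arclen S y"
  using arclen_diff[of x y] measure_nonneg[of lborel "S \<inter> {x<..y}"] by linarith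

lemma arclen_lipschitz: "\<bar>arclen S x - arclen S y\<bar> \<le> \<bar>x - y\<bar>"
proof -
  have *: "\<bar>arclen S x - arclen S y\<bar> \<le> \<bar>x - y\<bar>" if "x \<le> y" for x y
  proof -
    have "measure lborel (S \<inter> {x<..y}) \<le> measure lborel {x<..y}"
      using that by (intro measure_mono_fmeasurable) (auto intro!: fmeasurableI)
    then show ?thesis using that arclen_diff[OF that] measure_nonneg[of lborel "S \<inter> {x<..y}"]
        measure_lborel_Ioc[OF that] by linarith
  qed
  show ?thesis using *[of x y] *[of y x] by (cases "x \<le> y") (auto simp: abs_minus_commute)
qed

lemma continuous_on_arclen: "continuous_on T (arclen S)"
  using borel_measurable_lipschitz(1)[of "arclen S" 1] arclen_lipschitz
  by (auto simp: dist_real_def intro: continuous_on_subset)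

lemma borel_measurable_arclen[measurable]: "arclen S \<in> borel_measurable borel"
  by (intro borel_measurable_continuous_onI continuous_on_arclen)

lemma arclen_low: "x \<le> -L \<Longrightarrow> arclen S x = 0"
proof -
  assume "x \<le> -L"
  then have "S \<inter> {..x} \<subseteq> {-L}" using SL by auto
  then have "measure lborel (S \<inter> {..x}) \<le> measure lborel {-L}" by (intro measure_mono_fmeasurable) (auto intro!: fmeasurableI)
  then show ?thesis using measure_nonneg[of lborel "S \<inter> {..x}"] by (simp add: arclen_def del: measure_nonneg)
qed

lemma arclen_high: "L \<le> x \<Longrightarrow> arclen S x = measure lborel S"
  using SL by (auto simp: arclen_def intro!: arg_cong[where f="measure lborel"])

text \<open>Arc length collapses the gaps of \<open>S\<close>. By continuity and monotonicity, the
  points of value above \<open>t\<close> are those to the right of the last point of value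
  \<open>t\<close>, and the length of \<open>S\<close> left there is the total length minus
  \<open>t\<close>. Measures of half-lines then determine the image measure.\<close>

lemma distr_arclen:
  "distr (density lborel (indicator S)) borel (arclen S) = density lborel (indicator {0..measure lborel S})"
    (is "?D = ?R")
proof (rule measure_eqI_lessThan)
  let ?T = "measure lborel S"
  have D: "emeasure ?D {t<..} = emeasure lborel (S \<inter> {y. t < arclen S y})" for t
  proof -
    have "emeasure ?D {t<..} = emeasure (density lborel (indicator S)) {y. t < arclen S y}"
      by (subst emeasure_distr) (auto intro!: arg_cong2[where f=emeasure])
    also have "\<dots> = (\<integral>\<^sup>+x. indicator S x * indicator {y. t < arclen S y} x \<partial>lborel)"
      by (rule emeasure_density) auto
    also have "\<dots> = (\<integral>\<^sup>+x. indicator (S \<inter> {y. t < arclen S y}) x \<partial>lborel)"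
      by (rule nn_integral_cong) (simp add: indicator_inter_arith)
    also have "\<dots> = emeasure lborel (S \<inter> {y. t < arclen S y})"
      by (rule nn_integral_indicator) auto
    finally show ?thesis .
  qed
  show "emeasure ?D {t<..} < \<infinity>" for t unfolding D by (rule emeasure_subset_finite)
  have R: "emeasure ?R {t<..} = emeasure lborel ({0..?T} \<inter> {t<..})" for t
  proof -
    have "emeasure ?R {t<..} = (\<integral>\<^sup>+x. indicator {0..?T} x * indicator {t<..} x \<partial>lborel)"
      by (rule emeasure_density) auto
    also have "\<dots> = (\<integral>\<^sup>+x. indicator ({0..?T} \<inter> {t<..}) x \<partial>lborel)"
      by (rule nn_integral_cong) (simp add: indicator_inter_arith)
    also have "\<dots> = emeasure lborel ({0..?T} \<inter> {t<..})"
      by (rule nn_integral_indicator) auto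
    finally show ?thesis .
  qed
  have ST: "emeasure lborel S = ennreal ?T"
    using emeasure_subset_finite[of UNIV] by (intro emeasure_eq_ennreal_measure) auto
  have "arclen S y \<le> ?T" for y
    unfolding arclen_def using fmeasurable_subset[of UNIV] by (intro measure_mono_fmeasurable) auto
  note range = this
  show "emeasure ?D {t<..} = emeasure ?R {t<..}" for t
  proof -
    consider "t < 0" | "0 \<le> t" "t < ?T" | "?T \<le> t" by linarith
    then show ?thesis
    proof cases
      case 1
      then have "S \<inter> {y. t < arclen S y} = S" "{0..?T} \<inter> {t<..} = {0..?T}"
        by (auto simp: arclen_def intro: less_le_trans)
      then show ?thesis unfolding D R by (simp add: ST)
    next
      case 3
      then have "\<not> t < arclen S y" for y using range[of y] by linarith
      then have "S \<inter> {y. t < arclen S y} = {}" "{0..?T} \<inter> {t<..} = {}"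
        using 3 by auto
      then show ?thesis unfolding D R by simp
    next
      case 2
      \<comment> \<open>Intersecting with the window makes the level set bounded, so that it has a
        last point. Nothing to the right is cut off: beyond \<open>L\<close> the value is the total
        length, which exceeds \<open>t\<close>.\<close>
      define Z where "Z = {-L..L} \<inter> {y. arclen S y = t}"
      have "\<exists>y\<ge>-L. y \<le> L \<and> arclen S y = t"
        using 2 L arclen_low[of "-L"] arclen_high[of L] by (intro IVT' continuous_on_arclen) auto
      then have Zne: "Z \<noteq> {}" by (auto simp: Z_def)
      have bd: "bdd_above Z" by (rule bdd_aboveI[of _ L]) (auto simp: Z_def)
      have "closed ({y. arclen S y = t})"
        by (intro closed_Collect_eq continuous_on_arclen continuous_intros)
      then have "closed Z" by (auto simp: Z_def)
      then have sZ: "Sup Z \<in> Z" by (rule closed_contains_Sup[OF Zne bd])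
      have set: "t < arclen S y \<longleftrightarrow> Sup Z < y" for y
      proof
        assume "t < arclen S y"
        then show "Sup Z < y" using sZ arclen_mono[of y "Sup Z"] by (force simp: Z_def)
      next
        assume y: "Sup Z < y"
        then have "t \<le> arclen S y" using sZ arclen_mono[of "Sup Z" y] by (auto simp: Z_def)
        moreover have "arclen S y \<noteq> t"
        proof
          assume "arclen S y = t"
          then have "y < L" using 2 arclen_high[of y] by (cases "L \<le> y") auto
          then have "y \<in> Z" using y sZ \<open>arclen S y = t\<close> by (auto simp: Z_def)
          then show False using y cSup_upper[OF _ bd] by force
        qed
        ultimately show "t < arclen S y" by simp
      qed
      have "S \<inter> {y. t < arclen S y} = S - S \<inter> {..Sup Z}" by (auto simp: set)
      moreover have "measure lborel (S - S \<inter> {..Sup Z}) = ?T - arclen S (Sup Z)"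
        unfolding arclen_def using fmeasurable_subset[of UNIV] by (intro measurable_measure_Diff) auto
      moreover have "emeasure lborel (S \<inter> {y. t < arclen S y}) = ennreal (measure lborel (S \<inter> {y. t < arclen S y}))"
        using emeasure_subset_finite by (intro emeasure_eq_ennreal_measure) (auto simp: less_top)
      ultimately have "emeasure ?D {t<..} = ennreal (?T - t)" unfolding D using sZ by (simp add: Z_def)
      moreover have "{0..?T} \<inter> {t<..} = {t<..?T}" using 2 by auto
      ultimately show ?thesis unfolding R using 2 by simp
    qed
  qed
qed auto

text \<open>After the change of variables to arc length the kernel is integrated over a single
  interval, so its mass is at most 1 however scattered \<open>S\<close> is.\<close>

lemma nn_integral_laplace_arclen:
  assumes e: "e > 0"
  shows "(\<integral>\<^sup>+x. ennreal (laplace e (arclen S x - c)) * indicator S x \<partial>lborel) \<le> 1"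
proof -
  have "(\<integral>\<^sup>+x. ennreal (laplace e (arclen S x - c)) * indicator S x \<partial>lborel)
    = (\<integral>\<^sup>+x. ennreal (laplace e (arclen S x - c)) \<partial>density lborel (indicator S))"
    by (subst nn_integral_density) (auto simp: mult.commute)
  also have "\<dots> = (\<integral>\<^sup>+t. ennreal (laplace e (t - c)) \<partial>distr (density lborel (indicator S)) borel (arclen S))"
    by (subst nn_integral_distr) auto
  also have "\<dots> = (\<integral>\<^sup>+t. indicator {0..measure lborel S} t * ennreal (laplace e (t - c)) \<partial>lborel)"
    unfolding distr_arclen by (subst nn_integral_density) auto
  also have "\<dots> \<le> (\<integral>\<^sup>+t. ennreal (laplace e (t - c)) \<partial>lborel)"
    by (intro nn_integral_mono) (auto split: split_indicator)
  finally show ?thesis by (simp add: nn_integral_laplace[OF e])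
qed

text \<open>Countable sets are null for Lebesgue measure on an interval, which is the image of
  Lebesgue measure on \<open>S\<close>. This is used with the countable set of values that arc
  length may take twice.\<close>

lemma AE_arclen_notin_countable:
  assumes C: "countable C"
  shows "AE x in lborel. x \<in> S \<longrightarrow> arclen S x \<notin> C"
proof -
  have [measurable]: "C \<in> sets borel" using C by (rule sets.countable[rotated]) auto
  have "AE t in lborel. t \<notin> C"
    using countable_imp_null_set_lborel[OF C] by (rule AE_not_in)
  then have "AE t in density lborel (indicator {0..measure lborel S}). t \<notin> C"
    by (subst AE_density) auto
  then have "AE x in density lborel (indicator S). arclen S x \<notin> C"
    unfolding distr_arclen[symmetric] by (subst (asm) AE_distr_iff) auto
  then show ?thesis by (subst (asm) AE_density) (auto simp: indicator_def split: if_splits)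
qed

text \<open>Two points of equal arc length bound an interval on which it is constant, and this
  interval contains a rational. So only countably many values are repeated, and almost every point
  of \<open>S\<close> is separated by arc length from every other real.\<close>

lemma arclen_eq_imp_rational_value:
  assumes "x \<noteq> y" "arclen S x = arclen S y" shows "arclen S x \<in> arclen S ` \<rat>"
proof -
  have *: "arclen S x \<in> arclen S ` \<rat>" if xy: "x < y" "arclen S x = arclen S y" for x y
  proof -
    obtain q where q: "q \<in> \<rat>" "x < q" "q < y" using Rats_dense_in_real[OF xy(1)] by blast
    then have "arclen S q = arclen S x" using arclen_mono[of x q] arclen_mono[of q y] xy by simp
    then show ?thesis using q(1) by (metis image_eqI)
  qed
  show ?thesis using *[of x y] *[of y x] assms by (cases "x < y") auto
qed

end

section \<open>Kantorovich potential\<close>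

text \<open>The entropy hypotheses in the form in which they act: integrability of
  \<open>ln f\<close> against \<open>\<mu>\<close>, absolute continuity of \<open>\<nu>\<close>.
  Only \<open>\<mu>\<close> receives a named density, since on \<open>A\<close> the same
  \<open>f\<close> will describe \<open>\<nu>\<close>.\<close>

locale line_pair =
  fixes \<mu> \<nu> :: "real measure" and f :: "real \<Rightarrow> real" and L :: real
  assumes prob_\<mu>: "prob_space \<mu>" and sets_\<mu>[measurable_cong, simp]: "sets \<mu> = sets borel"
    and prob_\<nu>: "prob_space \<nu>" and sets_\<nu>[measurable_cong, simp]: "sets \<nu> = sets borel"
    and L_pos: "L > 0"
    and AE_\<mu>: "AE x in \<mu>. \<bar>x\<bar> \<le> L" and AE_\<nu>: "AE x in \<nu>. \<bar>x\<bar> \<le> L"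
    and f_measurable[measurable]: "f \<in> borel_measurable borel" and f_nonneg: "\<And>x. 0 \<le> f x"
    and \<mu>_density: "\<mu> = density lborel (\<lambda>x. ennreal (f x))"
    and ln_f_integrable: "integrable \<mu> (\<lambda>x. ln (f x))"
    and ac_\<nu>: "absolutely_continuous lborel \<nu>"
begin

sublocale \<mu>: prob_space \<mu> by (rule prob_\<mu>)
sublocale \<nu>: prob_space \<nu> by (rule prob_\<nu>)
sublocale \<mu>\<nu>: pair_prob_space \<mu> \<nu> ..

lemma space_\<mu>[simp]: "space \<mu> = UNIV" using sets_eq_imp_space_eq[OF sets_\<mu>] by simp
lemma space_\<nu>[simp]: "space \<nu> = UNIV" using sets_eq_imp_space_eq[OF sets_\<nu>] by simp

lemma sets_product: "sets (\<mu> \<Otimes>\<^sub>M \<nu>) = sets (borel \<Otimes>\<^sub>M borel)"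
  by (intro sets_pair_measure_cong) auto

lemma AE_\<mu>I: "AE x in lborel. P x \<Longrightarrow> AE x in \<mu>. P x"
  unfolding \<mu>_density by (subst AE_density) auto

lemma AE_\<nu>I: "AE x in lborel. P x \<Longrightarrow> AE x in \<nu>. P x"
  using absolutely_continuous_AE[of \<nu> lborel P] ac_\<nu> by simp

lemma AE_f_pos: "AE x in \<mu>. 0 < f x"
  by (subst \<mu>_density, subst AE_density) auto

abbreviation "A \<equiv> eqset \<mu> \<nu>"

lemma cdf_of_measurable[measurable]: "cdf_of \<mu> \<in> borel_measurable borel" "cdf_of \<nu> \<in> borel_measurable borel"
  unfolding cdf_of_def by (auto intro!: borel_measurable_mono monoI \<mu>.finite_measure_mono \<nu>.finite_measure_mono)

lemma A_measurable[measurable]: "A \<in> sets borel"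
  unfolding eqset_def by measurable

text \<open>To the left of the window both distribution functions are 0 and to the right both are 1,
  so \<open>A\<close> contains two half-lines; the cut keeps its length finite.\<close>

definition A0 :: "real set" where "A0 = A \<inter> {-L..L}"

lemma A0_measurable[measurable]: "A0 \<in> sets borel" by (simp add: A0_def)
lemma A0_subset: "A0 \<subseteq> {-L..L}" by (simp add: A0_def)

abbreviation "m \<equiv> arclen A0"

lemmas m_measurable[measurable] = borel_measurable_arclen[OF A0_measurable A0_subset L_pos]

definition slope :: "real \<Rightarrow> real" where "slope t = sgn (cdf_of \<mu> t - cdf_of \<nu> t)"

lemma slope_measurable[measurable]: "slope \<in> borel_measurable borel"
  unfolding slope_def[abs_def] by measurable

lemma slope_abs: "\<bar>slope t\<bar> = indicator (- A) t"
  by (auto simp: slope_def eqset_def sgn_if split: split_indicator)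

text \<open>The truncation to the window makes the potential bounded, hence integrable for every
  marginal; plans do not charge the outside.\<close>

definition \<phi> :: "real \<Rightarrow> real" where
  "\<phi> x = (\<integral>t. indicator ({-L..L} \<inter> {..x}) t * slope t \<partial>lborel)"

lemma slope_integrable:
  assumes [measurable]: "T \<in> sets borel"
  shows "integrable lborel (\<lambda>t. indicator ({-L..L} \<inter> T) t * slope t)"
proof (rule Bochner_Integration.integrable_bound[where f="indicator {-L..L} :: real \<Rightarrow> real"])
  show "integrable lborel (indicator {-L..L} :: real \<Rightarrow> real)"
    by (intro integrable_real_indicator) (auto simp: emeasure_lborel_Icc_eq)
  show "AE x in lborel. norm (indicator ({- L..L} \<inter> T) x * slope x) \<le> norm (indicator {- L..L} x :: real)"
    by (auto simp: abs_mult slope_abs split: split_indicator)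
qed measurable

lemma \<phi>_diff:
  assumes "x \<le> y"
  shows "\<phi> y - \<phi> x = (\<integral>t. indicator ({-L..L} \<inter> {x<..y}) t * slope t \<partial>lborel)"
proof -
  have "\<phi> y - \<phi> x = (\<integral>t. indicator ({-L..L} \<inter> {..y}) t * slope t - indicator ({-L..L} \<inter> {..x}) t * slope t \<partial>lborel)"
    unfolding \<phi>_def by (rule Bochner_Integration.integral_diff[symmetric]) (rule slope_integrable, simp)+
  also have "\<dots> = (\<integral>t. indicator ({-L..L} \<inter> {x<..y}) t * slope t \<partial>lborel)"
    using assms by (intro Bochner_Integration.integral_cong) (auto split: split_indicator)
  finally show ?thesis .
qed

text \<open>The slope has modulus 1 off \<open>A\<close> and vanishes on it, so the length spent in
  \<open>A0\<close> is lost in the increment. This gain over the plain Lipschitz bound is what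
  bounds \<open>w\<close> from below by arc length.\<close>

lemma \<phi>_diff_le: "\<bar>\<phi> y - \<phi> x\<bar> \<le> \<bar>y - x\<bar> - \<bar>m y - m x\<bar>"
proof -
  have *: "\<bar>\<phi> y - \<phi> x\<bar> \<le> (y - x) - (m y - m x)" if xy: "x \<le> y" for x y
  proof -
    let ?W = "{-L..L} \<inter> {x<..y}"
    have fin: "?W \<in> fmeasurable lborel" "A0 \<inter> {x<..y} \<in> fmeasurable lborel"
      by (rule fmeasurable_Int_fmeasurable; auto intro!: fmeasurableI simp: emeasure_lborel_Icc_eq)
        (rule fmeasurable_subset[OF A0_measurable A0_subset L_pos], simp)
    have "\<bar>\<phi> y - \<phi> x\<bar> \<le> (\<integral>t. \<bar>indicator ?W t * slope t\<bar> \<partial>lborel)"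
      unfolding \<phi>_diff[OF xy] by (rule integral_abs_bound)
    also have "\<dots> = (\<integral>t. indicator (?W - (A0 \<inter> {x<..y})) t \<partial>lborel)"
      by (rule Bochner_Integration.integral_cong) (auto simp: abs_mult slope_abs A0_def split: split_indicator)
    also have "\<dots> = measure lborel (?W - (A0 \<inter> {x<..y}))" by simp
    also have "\<dots> = measure lborel ?W - measure lborel (A0 \<inter> {x<..y})"
      using fin by (intro measurable_measure_Diff) (auto simp: A0_def)
    also have "\<dots> \<le> measure lborel {x<..y} - measure lborel (A0 \<inter> {x<..y})"
      using fin xy by (intro diff_right_mono measure_mono_fmeasurable) (auto intro!: fmeasurableI)
    also have "\<dots> = (y - x) - (m y - m x)"
      using xy arclen_diff[OF A0_measurable A0_subset L_pos xy] by simp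
    finally show ?thesis .
  qed
  note mono = arclen_mono[OF A0_measurable A0_subset L_pos]
  show ?thesis
    using *[of x y] *[of y x] mono[of x y] mono[of y x] by (cases "x \<le> y") auto
qed

lemma \<phi>_bound: "\<bar>\<phi> x\<bar> \<le> 2 * L"
proof -
  have "\<bar>\<phi> x\<bar> \<le> (\<integral>t. \<bar>indicator ({-L..L} \<inter> {..x}) t * slope t\<bar> \<partial>lborel)"
    unfolding \<phi>_def by (rule integral_abs_bound)
  also have "\<dots> \<le> (\<integral>t. indicator {-L..L} t \<partial>lborel)"
    by (intro integral_mono integrable_abs slope_integrable)
      (auto simp: abs_mult slope_abs emeasure_lborel_Icc_eq split: split_indicator)
  finally show ?thesis using L_pos by simp
qed

lemma \<phi>_lipschitz: "\<bar>\<phi> x - \<phi> y\<bar> \<le> \<bar>x - y\<bar>"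
  using \<phi>_diff_le[of x y] by linarith

lemma \<phi>_measurable[measurable]: "\<phi> \<in> borel_measurable borel"
  using \<phi>_lipschitz by (intro borel_measurable_lipschitz(2)[of _ 1]) (simp add: dist_real_def)

definition w :: "real \<Rightarrow> real \<Rightarrow> real" where "w x y = \<bar>y - x\<bar> - (\<phi> y - \<phi> x)"

lemma w_ge: "\<bar>m x - m y\<bar> \<le> w x y"
  using \<phi>_diff_le[of y x] unfolding w_def by (simp add: abs_minus_commute)

lemma w_nonneg: "0 \<le> w x y" using w_ge[of x y] by linarith

lemma w_measurable[measurable (raw)]:
  assumes [measurable]: "g \<in> borel_measurable M" "h \<in> borel_measurable M"
  shows "(\<lambda>x. w (g x) (h x)) \<in> borel_measurable M"
  unfolding w_def by measurable

lemma \<phi>_affine: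
  assumes "-L \<le> x" "x < y" "y \<le> L" and s: "\<And>t. x < t \<Longrightarrow> t < y \<Longrightarrow> slope t = c"
  shows "\<phi> y - \<phi> x = c * (y - x)"
proof -
  have "\<phi> y - \<phi> x = (\<integral>t. indicator ({-L..L} \<inter> {x<..y}) t * slope t \<partial>lborel)"
    using assms by (intro \<phi>_diff) auto
  also have "\<dots> = (\<integral>t. c * indicator {x<..y} t \<partial>lborel)"
    by (rule integral_cong_AE, simp, simp, rule AE_mp[OF AE_lborel_singleton[of y]])
      (use assms in \<open>auto split: split_indicator\<close>)
  also have "\<dots> = c * (y - x)" using assms by simp
  finally show ?thesis .
qed

section \<open>Plans with the given marginals and their excess cost\<close>

lemma couplingsD:
  assumes "\<gamma> \<in> couplings \<mu> \<nu>"
  shows "prob_space \<gamma>" "sets \<gamma> = sets (borel \<Otimes>\<^sub>M borel)"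
    "AE x in \<mu>. P x \<Longrightarrow> AE z in \<gamma>. P (fst z)" "AE y in \<nu>. Q y \<Longrightarrow> AE z in \<gamma>. Q (snd z)"
    "distr \<gamma> borel fst = \<mu>" "distr \<gamma> borel snd = \<nu>"
proof -
  show 1: "prob_space \<gamma>" "sets \<gamma> = sets (borel \<Otimes>\<^sub>M borel)" "distr \<gamma> borel fst = \<mu>" "distr \<gamma> borel snd = \<nu>"
    using assms by (auto simp: couplings_def)
  note 1(2)[measurable_cong]
  have "fst \<in> measurable \<gamma> borel" "snd \<in> measurable \<gamma> borel" by measurable
  then show "AE x in \<mu>. P x \<Longrightarrow> AE z in \<gamma>. P (fst z)" "AE y in \<nu>. Q y \<Longrightarrow> AE z in \<gamma>. Q (snd z)"
    using AE_distrD[of fst \<gamma> borel P] AE_distrD[of snd \<gamma> borel Q] 1 by auto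
qed

lemma AE_bounds:
  assumes "\<gamma> \<in> couplings \<mu> \<nu>"
  shows "AE z in \<gamma>. \<bar>fst z\<bar> \<le> L \<and> \<bar>snd z\<bar> \<le> L"
  using couplingsD(3)[OF assms AE_\<mu>] couplingsD(4)[OF assms AE_\<nu>] by eventually_elim auto

lemma integral_marginals:
  fixes h :: "real \<Rightarrow> real"
  assumes "\<gamma> \<in> couplings \<mu> \<nu>" and [measurable]: "h \<in> borel_measurable borel"
  shows "(\<integral>z. h (fst z) \<partial>\<gamma>) = (\<integral>x. h x \<partial>\<mu>)" "(\<integral>z. h (snd z) \<partial>\<gamma>) = (\<integral>x. h x \<partial>\<nu>)"
    "integrable \<gamma> (\<lambda>z. h (fst z)) \<longleftrightarrow> integrable \<mu> h" "integrable \<gamma> (\<lambda>z. h (snd z)) \<longleftrightarrow> integrable \<nu> h"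
proof -
  note D = couplingsD[OF assms(1)]
  note D(2)[measurable_cong]
  have m: "fst \<in> measurable \<gamma> borel" "snd \<in> measurable \<gamma> borel" by measurable
  show "(\<integral>z. h (fst z) \<partial>\<gamma>) = (\<integral>x. h x \<partial>\<mu>)" "(\<integral>z. h (snd z) \<partial>\<gamma>) = (\<integral>x. h x \<partial>\<nu>)"
    using integral_distr[OF m(1), of h] integral_distr[OF m(2), of h] D by auto
  show "integrable \<gamma> (\<lambda>z. h (fst z)) \<longleftrightarrow> integrable \<mu> h" "integrable \<gamma> (\<lambda>z. h (snd z)) \<longleftrightarrow> integrable \<nu> h"
    using integrable_distr_eq[OF m(1), of h] integrable_distr_eq[OF m(2), of h] D by auto
qed

lemma integrable_dist:
  assumes "\<gamma> \<in> couplings \<mu> \<nu>"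
  shows "integrable \<gamma> (\<lambda>z. \<bar>snd z - fst z\<bar>)"
proof -
  note D = couplingsD[OF assms]
  note D(2)[measurable_cong]
  interpret prob_space \<gamma> by (rule D)
  have "AE z in \<gamma>. norm \<bar>snd z - fst z\<bar> \<le> 2 * L"
    using AE_bounds[OF assms] by eventually_elim auto
  then show ?thesis by (intro integrable_const_bound[where B="2 * L"]) auto
qed

lemma integrable_w:
  assumes "\<gamma> \<in> couplings \<mu> \<nu>"
  shows "integrable \<gamma> (\<lambda>z. w (fst z) (snd z))"
    "cost1 \<gamma> = (\<integral>z. w (fst z) (snd z) \<partial>\<gamma>) + ((\<integral>x. \<phi> x \<partial>\<nu>) - (\<integral>x. \<phi> x \<partial>\<mu>))"
proof -
  note i = integral_marginals[OF assms \<phi>_measurable]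
  have 1: "integrable \<mu> \<phi>" by (intro \<mu>.integrable_const_bound[where B="2 * L"]) (auto simp: \<phi>_bound)
  have 2: "integrable \<nu> \<phi>" by (intro \<nu>.integrable_const_bound[where B="2 * L"]) (auto simp: \<phi>_bound)
  show "integrable \<gamma> (\<lambda>z. w (fst z) (snd z))"
    unfolding w_def using integrable_dist[OF assms] i 1 2 by auto
  show "cost1 \<gamma> = (\<integral>z. w (fst z) (snd z) \<partial>\<gamma>) + ((\<integral>x. \<phi> x \<partial>\<nu>) - (\<integral>x. \<phi> x \<partial>\<mu>))"
    unfolding w_def cost1_def using integrable_dist[OF assms] i 1 2 by simp
qed

text \<open>The monotone coupling saturates the dual inequality: between the quantiles of level \<open>u\<close>
  the two distribution functions lie strictly on either side of \<open>u\<close>.\<close>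

lemma ex_coupling_w_zero: "\<exists>\<gamma>\<in>couplings \<mu> \<nu>. AE z in \<gamma>. w (fst z) (snd z) = 0"
proof -
  interpret M: cdf_distribution \<mu>
    unfolding cdf_distribution_def real_distribution_def real_distribution_axioms_def
    using prob_\<mu> by auto
  interpret N: cdf_distribution \<nu>
    unfolding cdf_distribution_def real_distribution_def real_distribution_axioms_def
    using prob_\<nu> by auto
  let ?U = "restrict_space lborel {0<..<1::real}"
  have msr[measurable]: "M.I \<in> borel_measurable ?U" "N.I \<in> borel_measurable ?U"
    using M.measurable_CI N.measurable_CI
      measurable_cong_sets[OF sets_restrict_space_cong[OF sets_lborel, of "{0<..<1}"] refl] by auto
  \<comment> \<open>\<open>M.I\<close> and \<open>N.I\<close> are the quantile functions; the
    uniform law on the unit interval drives both.\<close>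
  define \<gamma> where "\<gamma> = distr ?U (borel \<Otimes>\<^sub>M borel) (\<lambda>u. (M.I u, N.I u))"
  have [measurable]: "(\<lambda>u. (M.I u, N.I u)) \<in> measurable ?U (borel \<Otimes>\<^sub>M borel)" by measurable
  have pU: "prob_space ?U"
    by (intro prob_spaceI) (simp add: emeasure_restrict_space space_restrict_space)
  have "distr \<gamma> borel fst = distr ?U borel M.I" "distr \<gamma> borel snd = distr ?U borel N.I"
    unfolding \<gamma>_def by (auto simp: distr_distr comp_def)
  then have c: "\<gamma> \<in> couplings \<mu> \<nu>"
    using M.distr_I_eq_M N.distr_I_eq_M prob_space.prob_space_distr[OF pU, of "\<lambda>u. (M.I u, N.I u)" "borel \<Otimes>\<^sub>M borel"]
    by (auto simp: couplings_def \<gamma>_def)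
  have b: "AE u in ?U. \<bar>M.I u\<bar> \<le> L" "AE u in ?U. \<bar>N.I u\<bar> \<le> L"
    using AE_distrD[OF msr(1), unfolded M.distr_I_eq_M, OF AE_\<mu>]
      AE_distrD[OF msr(2), unfolded N.distr_I_eq_M, OF AE_\<nu>] by auto
  have cdf: "cdf_of \<mu> = cdf \<mu>" "cdf_of \<nu> = cdf \<nu>" by (auto simp: cdf_of_def cdf_def fun_eq_iff)
  have "AE u in ?U. w (M.I u) (N.I u) = 0"
    using b AE_space
  proof eventually_elim
    case (elim u)
    then have u: "0 < u" "u < 1" by (auto simp: space_restrict_space)
    have i: "u \<le> cdf_of \<mu> t \<longleftrightarrow> M.I u \<le> t" "u \<le> cdf_of \<nu> t \<longleftrightarrow> N.I u \<le> t" for t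
      unfolding cdf using M.pseudoinverse[OF u, of t] N.pseudoinverse[OF u, of t] by auto
    consider "M.I u = N.I u" | "M.I u < N.I u" | "N.I u < M.I u" by linarith
    then show ?case
    proof cases
      case 2
      have "slope t = 1" if "M.I u < t" "t < N.I u" for t
        using i[of t] that by (auto simp: slope_def sgn_if)
      moreover have "-L \<le> M.I u" "N.I u \<le> L" using elim by (auto simp: abs_le_iff)
      ultimately have "\<phi> (N.I u) - \<phi> (M.I u) = 1 * (N.I u - M.I u)" using 2 by (intro \<phi>_affine)
      then show ?thesis using 2 by (simp add: w_def)
    next
      case 3
      have "slope t = -1" if "N.I u < t" "t < M.I u" for t
        using i[of t] that by (auto simp: slope_def sgn_if)
      moreover have "-L \<le> N.I u" "M.I u \<le> L" using elim by (auto simp: abs_le_iff)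
      ultimately have "\<phi> (M.I u) - \<phi> (N.I u) = -1 * (M.I u - N.I u)" using 3 by (intro \<phi>_affine)
      then show ?thesis using 3 by (simp add: w_def)
    qed (simp add: w_def)
  qed
  then have "AE z in \<gamma>. w (fst z) (snd z) = 0"
    unfolding \<gamma>_def by (subst AE_distr_iff) auto
  then show ?thesis using c by blast
qed

text \<open>Weak duality is \<open>w \<ge> 0\<close>, and the monotone coupling attains equality, so
  the infimum is a minimum.\<close>

lemma W1_eq: "W1 \<mu> \<nu> = (\<integral>x. \<phi> x \<partial>\<nu>) - (\<integral>x. \<phi> x \<partial>\<mu>)"
proof -
  obtain \<gamma> where c: "\<gamma> \<in> couplings \<mu> \<nu>" and z: "AE z in \<gamma>. w (fst z) (snd z) = 0"
    using ex_coupling_w_zero by blast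
  have "(\<integral>z. w (fst z) (snd z) \<partial>\<gamma>) = (\<integral>z. 0 \<partial>\<gamma>)"
    using z integrable_w(1)[OF c] by (intro integral_cong_AE) auto
  then have "cost1 \<gamma> = (\<integral>x. \<phi> x \<partial>\<nu>) - (\<integral>x. \<phi> x \<partial>\<mu>)" using integrable_w(2)[OF c] by simp
  moreover have "(\<integral>x. \<phi> x \<partial>\<nu>) - (\<integral>x. \<phi> x \<partial>\<mu>) \<le> cost1 \<gamma>'" if "\<gamma>' \<in> couplings \<mu> \<nu>" for \<gamma>'
    unfolding integrable_w(2)[OF that] by (simp add: w_nonneg)
  ultimately show ?thesis unfolding W1_def using c by (intro cInf_eq_minimum) (auto intro: rev_image_eqI)
qed

lemma cost1_minus_W1: "\<gamma> \<in> couplings \<mu> \<nu> \<Longrightarrow> cost1 \<gamma> - W1 \<mu> \<nu> = (\<integral>z. w (fst z) (snd z) \<partial>\<gamma>)"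
  using W1_eq integrable_w(2) by simp

text \<open>Zero excess only says that \<open>A\<close> has no length between the two points. To
  conclude that they coincide, the points of repeated arc length in \<open>A0\<close> are discarded;
  they form a Lebesgue null set, negligible for both marginals by absolute continuity.\<close>

lemma opt1_AE_diagonal:
  assumes "\<gamma> \<in> opt1 \<mu> \<nu>"
  shows "AE z in \<gamma>. fst z \<in> A \<or> snd z \<in> A \<longrightarrow> fst z = snd z"
proof -
  have c: "\<gamma> \<in> couplings \<mu> \<nu>" and "cost1 \<gamma> = W1 \<mu> \<nu>" using assms by (auto simp: opt1_def)
  then have "(\<integral>z. w (fst z) (snd z) \<partial>\<gamma>) = 0" using cost1_minus_W1[OF c] by simp
  then have 1: "AE z in \<gamma>. w (fst z) (snd z) = 0"
    using integral_nonneg_eq_0_iff_AE[OF integrable_w(1)[OF c]] by (simp add: w_nonneg)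
  have "countable (m ` \<rat>)" by (intro countable_image countable_rat)
  then have ae: "AE x in lborel. x \<in> A0 \<longrightarrow> m x \<notin> m ` \<rat>"
    by (rule AE_arclen_notin_countable[OF A0_measurable A0_subset L_pos])
  show ?thesis
    using 1 couplingsD(3)[OF c AE_\<mu>I[OF ae]] couplingsD(4)[OF c AE_\<nu>I[OF ae]] AE_bounds[OF c]
  proof eventually_elim
    case (elim z)
    then have eq: "m (fst z) = m (snd z)" using w_ge[of "fst z" "snd z"] by simp
    then show ?case
      using arclen_eq_imp_rational_value[OF A0_measurable A0_subset L_pos, of "fst z" "snd z"] elim
      by (auto simp: A0_def abs_le_iff)
  qed
qed

end

section \<open>Lower bound\<close>

context line_pair
begin

abbreviation "\<rho> \<equiv> \<mu> \<Otimes>\<^sub>M \<nu>"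
abbreviation "E \<equiv> (- A) \<times> (- A)"
abbreviation "I\<^sub>A \<equiv> (\<integral>x\<in>A. ln (f x) \<partial>\<mu>)"

text \<open>Makes the facts about plans available for the reference measure itself.\<close>

lemma product_coupling: "\<rho> \<in> couplings \<mu> \<nu>"
proof -
  have 1: "distr \<rho> borel fst = \<mu>"
  proof -
    have "distr \<rho> borel fst = distr \<rho> \<mu> fst" by (rule distr_cong) auto
    then show ?thesis using \<nu>.distr_pair_fst by simp
  qed
  have 2: "distr \<rho> borel snd = \<nu>"
  proof (rule measure_eqI)
    fix X assume "X \<in> sets (distr \<rho> borel snd)"
    then have [measurable]: "X \<in> sets borel" by simp
    have "emeasure (distr \<rho> borel snd) X = emeasure \<rho> (UNIV \<times> X)"
      by (subst emeasure_distr) (auto intro!: arg_cong2[where f=emeasure] simp: space_pair_measure)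
    also have "\<dots> = emeasure \<nu> X"
      using \<nu>.emeasure_pair_measure_Times[of UNIV \<mu> X] \<mu>.emeasure_space_1 by simp
    finally show "emeasure (distr \<rho> borel snd) X = emeasure \<nu> X" .
  qed simp
  show ?thesis using 1 2 sets_product \<mu>\<nu>.prob_space_axioms by (simp add: couplings_def)
qed

lemma finite_measure_\<rho>: "finite_measure \<rho>" by (rule \<mu>\<nu>.finite_measure_axioms)

lemma AE_\<rho>_fst: "AE x in \<mu>. P x \<Longrightarrow> AE z in \<rho>. P (fst z)"
  by (rule couplingsD(3)[OF product_coupling])

lemma AE_\<rho>_snd: "AE y in \<nu>. P y \<Longrightarrow> AE z in \<rho>. P (snd z)"
  by (rule couplingsD(4)[OF product_coupling])

lemma bounded_integrable_coupling:
  fixes h :: "real \<times> real \<Rightarrow> real"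
  assumes "\<gamma> \<in> couplings \<mu> \<nu>" and h: "h \<in> borel_measurable (borel \<Otimes>\<^sub>M borel)" and b: "\<And>z. \<bar>h z\<bar> \<le> B"
  shows "integrable \<gamma> h"
proof -
  note D = couplingsD[OF assms(1)]
  interpret prob_space \<gamma> by (rule D)
  have "h \<in> borel_measurable \<gamma>" using h measurable_cong_sets[OF D(2) refl] by blast
  then show ?thesis using b by (intro integrable_const_bound[where B=B]) auto
qed

lemma continuous_measurable_pair:
  "continuous_on UNIV (h :: real \<times> real \<Rightarrow> real) \<Longrightarrow> h \<in> borel_measurable (borel \<Otimes>\<^sub>M borel)"
  by (simp add: borel_prod borel_measurable_continuous_onI)

text \<open>Since the marginals are fixed, product sets with arbitrary Borel factors can be approximated
  uniformly in the plan, so that they are admissible in the narrow limit.\<close>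

lemma narrow_conv_indicator:
  fixes \<psi> :: "real \<times> real \<Rightarrow> real"
  assumes \<gamma>s: "\<And>e. e > 0 \<Longrightarrow> \<gamma>s e \<in> couplings \<mu> \<nu>" and \<gamma>: "\<gamma> \<in> couplings \<mu> \<nu>"
    and nc: "narrow_conv \<gamma>s \<gamma> (at_right 0)"
    and U[measurable]: "U \<in> sets borel" and V[measurable]: "V \<in> sets borel"
    and \<psi>: "continuous_on UNIV \<psi>" and B: "\<And>z. \<bar>\<psi> z\<bar> \<le> B"
  shows "((\<lambda>e::real. \<integral>z. indicator U (fst z) * indicator V (snd z) * \<psi> z \<partial>\<gamma>s e) \<longlongrightarrow>
    (\<integral>z. indicator U (fst z) * indicator V (snd z) * \<psi> z \<partial>\<gamma>)) (at_right 0)"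
proof (rule tendstoI)
  fix \<epsilon> :: real assume \<epsilon>: "\<epsilon> > 0"
  have B0: "0 \<le> B" by (rule order_trans[OF abs_ge_zero B[of "(0, 0)"]])
  \<comment> \<open>For every plan at once, replacing the indicators costs at most
    \<open>2 * B * d \<le> \<epsilon> / 4\<close>. This is paid for \<open>\<gamma>s e\<close> and
    for \<open>\<gamma>\<close>, and the narrow limit takes another quarter. The added 1 covers
    \<open>B = 0\<close>.\<close>
  define d where "d = \<epsilon> / (8 * (B + 1))"
  have d: "d > 0" using \<epsilon> B0 by (simp add: d_def)
  have Bd: "B * d \<le> \<epsilon> / 8" using \<epsilon> B0 by (simp add: d_def field_simps)
  obtain u Cu where u: "\<And>x y. \<bar>u x - u y\<bar> \<le> Cu * dist x y" "\<And>x. 0 \<le> u x \<and> u x \<le> 1"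
    "(\<integral>x. \<bar>indicator U x - u x\<bar> \<partial>\<mu>) < d"
    using indicator_lipschitz_approx[OF sets_\<mu> \<mu>.finite_measure_axioms U d] by blast
  obtain v Cv where v: "\<And>x y. \<bar>v x - v y\<bar> \<le> Cv * dist x y" "\<And>x. 0 \<le> v x \<and> v x \<le> 1"
    "(\<integral>x. \<bar>indicator V x - v x\<bar> \<partial>\<nu>) < d"
    using indicator_lipschitz_approx[OF sets_\<nu> \<nu>.finite_measure_axioms V d] by blast
  note uc = borel_measurable_lipschitz[OF u(1)] and vc = borel_measurable_lipschitz[OF v(1)]
  note uc(2)[measurable] vc(2)[measurable] continuous_measurable_pair[OF \<psi>, measurable]
  define \<psi>0 where "\<psi>0 z = u (fst z) * v (snd z) * \<psi> z" for z
  define \<psi>1 where "\<psi>1 z = indicator U (fst z) * indicator V (snd z) * \<psi> z" for z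
  have c0: "continuous_on UNIV \<psi>0"
    unfolding \<psi>0_def using uc(1) vc(1) \<psi>
    by (intro continuous_intros) (auto intro!: continuous_on_compose2[OF uc(1)] continuous_on_compose2[OF vc(1)] continuous_intros)
  have ub: "\<bar>u x\<bar> \<le> 1" "\<bar>v x\<bar> \<le> 1" for x using u(2)[of x] v(2)[of x] by auto
  have b0: "\<bar>\<psi>0 z\<bar> \<le> B" for z
  proof -
    have "\<bar>\<psi>0 z\<bar> \<le> 1 * 1 * B"
      unfolding \<psi>0_def abs_mult using ub B by (intro mult_mono) auto
    then show ?thesis by simp
  qed
  have b1: "\<bar>\<psi>1 z\<bar> \<le> B" for z using B[of z] B0 by (auto simp: \<psi>1_def split: split_indicator)
  have m0: "\<psi>0 \<in> borel_measurable (borel \<Otimes>\<^sub>M borel)" "\<psi>1 \<in> borel_measurable (borel \<Otimes>\<^sub>M borel)"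
    unfolding \<psi>0_def[abs_def] \<psi>1_def[abs_def] by measurable
  have close: "\<bar>(\<integral>z. \<psi>1 z \<partial>\<gamma>') - (\<integral>z. \<psi>0 z \<partial>\<gamma>')\<bar> \<le> \<epsilon> / 4" if g: "\<gamma>' \<in> couplings \<mu> \<nu>" for \<gamma>'
  proof -
    note i = bounded_integrable_coupling[OF g m0(1) b0] bounded_integrable_coupling[OF g m0(2) b1]
    have ib: "\<bar>indicator U x - u x\<bar> \<le> 1" "\<bar>indicator V x - v x\<bar> \<le> 1" for x
      using u(2)[of x] v(2)[of x] by (auto split: split_indicator)
    have iu: "integrable \<gamma>' (\<lambda>z. \<bar>indicator U (fst z) - u (fst z)\<bar>)" "integrable \<gamma>' (\<lambda>z. \<bar>indicator V (snd z) - v (snd z)\<bar>)"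
      using ib by (auto intro!: bounded_integrable_coupling[OF g, where B=1])
    have "\<bar>(\<integral>z. \<psi>1 z \<partial>\<gamma>') - (\<integral>z. \<psi>0 z \<partial>\<gamma>')\<bar> = \<bar>\<integral>z. \<psi>1 z - \<psi>0 z \<partial>\<gamma>'\<bar>" using i by simp
    also have "\<dots> \<le> (\<integral>z. \<bar>\<psi>1 z - \<psi>0 z\<bar> \<partial>\<gamma>')" by (rule integral_abs_bound)
    also have "\<dots> \<le> (\<integral>z. B * (\<bar>indicator U (fst z) - u (fst z)\<bar> + \<bar>indicator V (snd z) - v (snd z)\<bar>) \<partial>\<gamma>')"
    proof (rule integral_mono)
      fix z
      have "\<bar>indicator U (fst z) * indicator V (snd z) - u (fst z) * v (snd z)\<bar>
        = \<bar>(indicator U (fst z) - u (fst z)) * indicator V (snd z) + u (fst z) * (indicator V (snd z) - v (snd z))\<bar>"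
        by (simp add: algebra_simps)
      also have "\<dots> \<le> \<bar>indicator U (fst z) - u (fst z)\<bar> * 1 + 1 * \<bar>indicator V (snd z) - v (snd z)\<bar>"
        using ub(1)[of "fst z"] by (intro order_trans[OF abs_triangle_ineq] add_mono) (auto simp: abs_mult intro!: mult_left_le mult_left_le_one_le)
      finally have "\<bar>indicator U (fst z) * indicator V (snd z) - u (fst z) * v (snd z)\<bar> * \<bar>\<psi> z\<bar>
        \<le> (\<bar>indicator U (fst z) - u (fst z)\<bar> + \<bar>indicator V (snd z) - v (snd z)\<bar>) * B"
        using B by (intro mult_mono) auto
      then show "\<bar>\<psi>1 z - \<psi>0 z\<bar> \<le> B * (\<bar>indicator U (fst z) - u (fst z)\<bar> + \<bar>indicator V (snd z) - v (snd z)\<bar>)"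
        unfolding \<psi>0_def \<psi>1_def left_diff_distrib[symmetric] abs_mult by (simp only: mult.commute)
    qed (use i iu in auto)
    also have "\<dots> = B * ((\<integral>x. \<bar>indicator U x - u x\<bar> \<partial>\<mu>) + (\<integral>x. \<bar>indicator V x - v x\<bar> \<partial>\<nu>))"
      using iu integral_marginals(1)[OF g, of "\<lambda>x. \<bar>indicator U x - u x\<bar>"]
        integral_marginals(2)[OF g, of "\<lambda>x. \<bar>indicator V x - v x\<bar>"] by simp
    also have "\<dots> \<le> B * (d + d)" using u(3) v(3) B0 by (intro mult_left_mono add_mono) auto
    also have "\<dots> \<le> \<epsilon> / 4" using Bd by (simp add: algebra_simps)
    finally show ?thesis .
  qed
  have "bounded (range \<psi>0)" using b0 by (auto simp: bounded_iff)
  then have "((\<lambda>e. \<integral>z. \<psi>0 z \<partial>\<gamma>s e) \<longlongrightarrow> (\<integral>z. \<psi>0 z \<partial>\<gamma>)) (at_right 0)"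
    using nc c0 unfolding narrow_conv_def by blast
  then have "eventually (\<lambda>e. dist (\<integral>z. \<psi>0 z \<partial>\<gamma>s e) (\<integral>z. \<psi>0 z \<partial>\<gamma>) < \<epsilon> / 4) (at_right 0)"
    using \<epsilon> by (intro tendstoD) auto
  moreover have "eventually (\<lambda>e::real. e > 0) (at_right 0)" by (rule eventually_at_right_less)
  ultimately have "eventually (\<lambda>e. dist (\<integral>z. \<psi>1 z \<partial>\<gamma>s e) (\<integral>z. \<psi>1 z \<partial>\<gamma>) < \<epsilon>) (at_right 0)"
  proof eventually_elim
    case (elim e)
    then show ?case using close[OF \<gamma>s[of e]] close[OF \<gamma>] \<epsilon>
      unfolding dist_real_def abs_less_iff abs_le_iff by argo
  qed
  then show "eventually (\<lambda>e. dist (\<integral>z. indicator U (fst z) * indicator V (snd z) * \<psi> z \<partial>\<gamma>s e)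
    (\<integral>z. indicator U (fst z) * indicator V (snd z) * \<psi> z \<partial>\<gamma>) < \<epsilon>) (at_right 0)"
    by (simp add: \<psi>1_def)
qed

lemma Ent_nonneg:
  assumes "\<gamma> \<in> couplings \<mu> \<nu>" shows "0 \<le> Ent \<gamma> \<rho>"
proof -
  interpret prob_space \<gamma> by (rule couplingsD(1)[OF assms])
  show ?thesis
    using Ent_ge_dual[OF finite_measure_\<rho> finite_measure_axioms, of "\<lambda>_. 0"]
    by (simp add: prob_space \<mu>\<nu>.prob_space zero_ereal_def)
qed

text \<open>Truncated at \<open>2 * L\<close>, a change that plans do not see, the distance is
  bounded and continuous, so the cost passes to the narrow limit. A limit excess
  \<open>\<delta> > 0\<close> contributes at least \<open>\<delta> / 2 / e\<close>, which beats the
  logarithm, while the entropy is nonnegative.\<close>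

lemma liminf_not_optimal:
  assumes \<gamma>s: "\<And>e. e > 0 \<Longrightarrow> \<gamma>s e \<in> couplings \<mu> \<nu>" and \<gamma>: "\<gamma> \<in> couplings \<mu> \<nu>"
    and nc: "narrow_conv \<gamma>s \<gamma> (at_right 0)" and no: "\<gamma> \<notin> opt1 \<mu> \<nu>"
  shows "Liminf (at_right 0) (\<lambda>e. ereal ((cost1 (\<gamma>s e) - W1 \<mu> \<nu>) / e) + Ent (\<gamma>s e) \<rho>
             - ereal (\<bar>ln (2 * e)\<bar> * measure \<mu> A)) = \<infinity>"
proof -
  define h where "h z = min (2 * L) \<bar>snd z - fst z\<bar>" for z :: "real \<times> real"
  have ch: "continuous_on UNIV h" unfolding h_def by (intro continuous_intros)
  have hb: "\<bar>h z\<bar> \<le> 2 * L" for z using L_pos by (auto simp: h_def)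
  have cost: "cost1 \<gamma>' = (\<integral>z. h z \<partial>\<gamma>')" if g: "\<gamma>' \<in> couplings \<mu> \<nu>" for \<gamma>'
  proof -
    note couplingsD(2)[OF g, measurable_cong]
    have [measurable]: "h \<in> borel_measurable (borel \<Otimes>\<^sub>M borel)" by (rule continuous_measurable_pair[OF ch])
    have "AE z in \<gamma>'. \<bar>snd z - fst z\<bar> = h z"
      using AE_bounds[OF g] by eventually_elim (auto simp: h_def)
    then show ?thesis unfolding cost1_def by (intro integral_cong_AE) auto
  qed
  define \<delta> where "\<delta> = cost1 \<gamma> - W1 \<mu> \<nu>"
  have "0 \<le> \<delta>" unfolding \<delta>_def cost1_minus_W1[OF \<gamma>] by (simp add: w_nonneg)
  then have \<delta>: "\<delta> > 0" using no \<gamma> by (auto simp: opt1_def \<delta>_def)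
  have "bounded (range h)" using hb by (auto simp: bounded_iff)
  then have "((\<lambda>e. \<integral>z. h z \<partial>\<gamma>s e) \<longlongrightarrow> (\<integral>z. h z \<partial>\<gamma>)) (at_right 0)"
    using nc ch unfolding narrow_conv_def by blast
  moreover have "W1 \<mu> \<nu> + \<delta> / 2 < (\<integral>z. h z \<partial>\<gamma>)" using \<delta> cost[OF \<gamma>] by (simp add: \<delta>_def field_simps)
  ultimately have ev1: "eventually (\<lambda>e. W1 \<mu> \<nu> + \<delta> / 2 < (\<integral>z. h z \<partial>\<gamma>s e)) (at_right 0)"
    by (rule order_tendstoD)
  have "\<infinity> \<le> Liminf (at_right 0) (\<lambda>e. ereal ((cost1 (\<gamma>s e) - W1 \<mu> \<nu>) / e) + Ent (\<gamma>s e) \<rho>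
             - ereal (\<bar>ln (2 * e)\<bar> * measure \<mu> A))"
    unfolding le_Liminf_iff
  proof (intro allI impI)
    fix y :: ereal assume "y < \<infinity>"
    then obtain c where c: "y \<le> ereal c" by (cases y) auto
    have "filterlim (\<lambda>e::real. \<delta> / 2 / e - \<bar>ln (2 * e)\<bar>) at_top (at_right 0)"
      using \<delta> by real_asymp
    then have "eventually (\<lambda>e. c < \<delta> / 2 / e - \<bar>ln (2 * e)\<bar>) (at_right 0)"
      by (simp add: filterlim_at_top_dense)
    moreover have "eventually (\<lambda>e::real. e > 0) (at_right 0)" by (rule eventually_at_right_less)
    ultimately show "eventually (\<lambda>e. y < ereal ((cost1 (\<gamma>s e) - W1 \<mu> \<nu>) / e) + Ent (\<gamma>s e) \<rho>
             - ereal (\<bar>ln (2 * e)\<bar> * measure \<mu> A)) (at_right 0)"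
      using ev1
    proof eventually_elim
      case (elim e)
      note g = \<gamma>s[OF elim(2)]
      have "\<bar>ln (2 * e)\<bar> * measure \<mu> A \<le> \<bar>ln (2 * e)\<bar>"
        using \<mu>.prob_le_1[of A] by (intro mult_left_le) auto
      moreover have "\<delta> / 2 / e \<le> (cost1 (\<gamma>s e) - W1 \<mu> \<nu>) / e"
        using elim cost[OF g] by (intro divide_right_mono) auto
      ultimately have "c < (cost1 (\<gamma>s e) - W1 \<mu> \<nu>) / e - \<bar>ln (2 * e)\<bar> * measure \<mu> A"
        using elim by linarith
      then show ?case using c Ent_nonneg[OF g]
        by (cases "Ent (\<gamma>s e) \<rho>") (auto intro: le_less_trans)
    qed
  qed
  then show ?thesis by simp
qed

end

section \<open>Liminf inequality at optimal plans\<close>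

context line_pair
begin

lemma opt1D: "\<gamma> \<in> opt1 \<mu> \<nu> \<Longrightarrow> \<gamma> \<in> couplings \<mu> \<nu>" by (simp add: opt1_def)

lemma opt1_off_diagonal:
  assumes "\<gamma> \<in> opt1 \<mu> \<nu>"
  shows "AE z in \<gamma>. (fst z \<in> A) = (snd z \<in> A)"
  using opt1_AE_diagonal[OF assms] by eventually_elim auto

lemma restr_integral:
  fixes h :: "real \<times> real \<Rightarrow> real"
  assumes "\<gamma> \<in> couplings \<mu> \<nu>" and h: "h \<in> borel_measurable (borel \<Otimes>\<^sub>M borel)"
  shows "(\<integral>z. h z \<partial>restr \<gamma> E) = (\<integral>z. indicator E z * h z \<partial>\<gamma>)"
proof -
  note D = couplingsD[OF assms(1)]
  note D(2)[measurable_cong] h[measurable]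
  have "restr \<gamma> E = density \<gamma> (\<lambda>z. ennreal (indicator E z))"
    by (simp add: restr_def ennreal_indicator)
  then show ?thesis by (simp add: integral_density)
qed

lemma restr_finite:
  assumes "\<gamma> \<in> couplings \<mu> \<nu>"
  shows "finite_measure (restr \<gamma> E)" "sets (restr \<gamma> E) = sets (borel \<Otimes>\<^sub>M borel)"
    "measure (restr \<gamma> E) (space (restr \<gamma> E)) = measure \<gamma> E"
proof -
  note D = couplingsD[OF assms(1)]
  note D(2)[measurable_cong]
  interpret prob_space \<gamma> by (rule D)
  have sp: "space \<gamma> = UNIV" using sets_eq_imp_space_eq[OF D(2)] by (simp add: space_pair_measure)
  have [measurable]: "E \<in> sets \<gamma>" by measurable
  have e: "emeasure (restr \<gamma> E) UNIV = emeasure \<gamma> E"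
    unfolding restr_def by (subst emeasure_density) (auto simp: sp[symmetric])
  then show "finite_measure (restr \<gamma> E)"
    by (intro finite_measureI) (auto simp: restr_def sp)
  show "sets (restr \<gamma> E) = sets (borel \<Otimes>\<^sub>M borel)" using D(2) by (simp add: restr_def)
  show "measure (restr \<gamma> E) (space (restr \<gamma> E)) = measure \<gamma> E"
    using e by (simp add: measure_def restr_def sp)
qed

text \<open>Identifies the mass term of the dual problem off \<open>A\<close> with the quantity
  \<open>1 - measure \<nu> A\<close> that remains in the global bound after the kernel has used mass
  \<open>measure \<nu> A\<close>.\<close>

lemma opt1_measure_A:
  assumes "\<gamma> \<in> opt1 \<mu> \<nu>"
  shows "measure \<gamma> E = 1 - measure \<nu> A"
proof -
  note c = opt1D[OF assms]
  note D = couplingsD[OF c]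
  note D(2)[measurable_cong]
  interpret prob_space \<gamma> by (rule D)
  have sp: "space \<gamma> = UNIV" using sets_eq_imp_space_eq[OF D(2)] by (simp add: space_pair_measure)
  have "measure \<gamma> E = (\<integral>z. indicator E z \<partial>\<gamma>)" by (simp add: sp)
  also have "\<dots> = (\<integral>z. indicator (- A) (snd z) \<partial>\<gamma>)"
    using opt1_off_diagonal[OF assms] by (intro integral_cong_AE) (auto split: split_indicator)
  also have "\<dots> = (\<integral>y. indicator (- A) y \<partial>\<nu>)" by (rule integral_marginals[OF c]) simp
  also have "\<dots> = measure \<nu> (- A)" by simp
  also have "\<dots> = 1 - measure \<nu> A" using \<nu>.prob_compl[of A] by (simp add: Compl_eq_Diff_UNIV)
  finally show ?thesis .
qed

text \<open>Majorant of the integral of \<open>exp (- w / e)\<close> over the mixed block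
  \<open>(- A) \<times> A\<close>, where the dual weight has no normalising term.\<close>

definition escape :: "real \<Rightarrow> real" where
  "escape e = (\<integral>z. indicator (- A) (fst z) * indicator A (snd z) * exp (- \<bar>m (fst z) - m (snd z)\<bar> / e) \<partial>\<rho>)"

text \<open>On this block the two coordinates differ and the second lies in \<open>A\<close>, so for
  almost every pair their arc lengths differ and the exponential decays to 0; dominated convergence
  concludes, without a rate.\<close>

lemma escape_tendsto_0: "(escape \<longlongrightarrow> 0) (at_right 0)"
proof -
  have "((\<lambda>t. escape (inverse t)) \<longlongrightarrow> (\<integral>z. 0 \<partial>\<rho>)) at_top"
    unfolding escape_def
  proof (rule integral_dominated_convergence_at_top[where w="\<lambda>_. 1"])
    note sets_product[measurable_cong]
    show "(\<lambda>z. indicator (- A) (fst z) * indicator A (snd z) * exp (- \<bar>m (fst z) - m (snd z)\<bar> / inverse t)) \<in> borel_measurable \<rho>" for t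
      by measurable
    have "countable (m ` \<rat>)" by (intro countable_image countable_rat)
    then have ae: "AE x in lborel. x \<in> A0 \<longrightarrow> m x \<notin> m ` \<rat>"
      by (rule AE_arclen_notin_countable[OF A0_measurable A0_subset L_pos])
    show "AE z in \<rho>. ((\<lambda>t. indicator (- A) (fst z) * indicator A (snd z) * exp (- \<bar>m (fst z) - m (snd z)\<bar> / inverse t)) \<longlongrightarrow> (0::real)) at_top"
      using AE_\<rho>_snd[OF AE_\<nu>I[OF ae]] AE_\<rho>_snd[OF AE_\<nu>]
    proof eventually_elim
      case (elim z)
      show ?case
      proof (cases "fst z \<notin> A \<and> snd z \<in> A")
        case True
        then have "snd z \<in> A0" "snd z \<noteq> fst z" using elim by (auto simp: A0_def abs_le_iff)
        then have "m (snd z) \<noteq> m (fst z)"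
          using arclen_eq_imp_rational_value[OF A0_measurable A0_subset L_pos, of "snd z" "fst z"] elim by auto
        then have "\<bar>m (fst z) - m (snd z)\<bar> > 0" by simp
        then have "((\<lambda>t. exp (- \<bar>m (fst z) - m (snd z)\<bar> / inverse t)) \<longlongrightarrow> 0) at_top" by real_asymp
        then show ?thesis using True by simp
      qed (auto split: split_indicator)
    qed
    show "\<forall>\<^sub>F t in at_top. AE z in \<rho>. norm (indicator (- A) (fst z) * indicator A (snd z) * exp (- \<bar>m (fst z) - m (snd z)\<bar> / inverse t)) \<le> (1::real)"
      by (rule eventually_mono[OF eventually_gt_at_top[of 0]]) (auto split: split_indicator)
  qed (auto simp: finite_measure.integrable_const[OF finite_measure_\<rho>])
  then show ?thesis unfolding filterlim_at_right_to_top by simp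
qed

lemma nn_integral_\<mu>:
  "g \<in> borel_measurable borel \<Longrightarrow> (\<integral>\<^sup>+x. g x \<partial>\<mu>) = (\<integral>\<^sup>+x. ennreal (f x) * g x \<partial>lborel)"
  using nn_integral_density[of "\<lambda>x. ennreal (f x)" lborel g] \<mu>_density by simp

lemma AE_f_bound: "AE x in lborel. 0 < f x \<longrightarrow> \<bar>x\<bar> \<le> L"
  using AE_density[of "\<lambda>x. ennreal (f x)" lborel "\<lambda>x. \<bar>x\<bar> \<le> L"] AE_\<mu>
  unfolding \<mu>_density[symmetric] by simp

text \<open>Dividing by \<open>f\<close> turns \<open>\<mu>\<close> into at most Lebesgue measure on
  \<open>A0\<close>, where the arc-length bound applies.\<close>

lemma nn_integral_laplace_over_density:
  assumes e: "e > 0"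
  shows "(\<integral>\<^sup>+x. ennreal (indicator A x * laplace e (m x - c) / f x) \<partial>\<mu>) \<le> 1"
proof -
  have "(\<integral>\<^sup>+x. ennreal (indicator A x * laplace e (m x - c) / f x) \<partial>\<mu>)
    = (\<integral>\<^sup>+x. ennreal (f x) * ennreal (indicator A x * laplace e (m x - c) / f x) \<partial>lborel)"
    by (rule nn_integral_\<mu>) measurable
  also have "\<dots> \<le> (\<integral>\<^sup>+x. ennreal (laplace e (m x - c)) * indicator A0 x \<partial>lborel)"
  proof (rule nn_integral_mono_AE, use AE_f_bound in eventually_elim)
    case (elim x)
    show ?case
    proof (cases "f x = 0")
      case False
      then have "f x > 0" using f_nonneg[of x] by simp
      then show ?thesis using elim laplace_nonneg[OF e, of "m x - c"]
        by (auto simp: ennreal_mult[symmetric] A0_def abs_le_iff split: split_indicator)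
    qed simp
  qed
  also have "\<dots> \<le> 1" by (rule nn_integral_laplace_arclen[OF A0_measurable A0_subset L_pos e])
  finally show ?thesis .
qed

text \<open>Fubini with the inner integral in the first variable, in which the kernel is normalised:
  each \<open>y\<close> in \<open>V\<close> contributes at most 1.\<close>

lemma integral_laplace_over_density:
  assumes e: "e > 0" and [measurable]: "V \<in> sets borel"
  defines "k \<equiv> \<lambda>z. indicator A (fst z) * indicator V (snd z) * laplace e (m (fst z) - m (snd z)) / f (fst z)"
  shows "integrable \<rho> k" "(\<integral>z. k z \<partial>\<rho>) \<le> measure \<nu> V"
proof -
  note sets_product[measurable_cong]
  have [measurable]: "k \<in> borel_measurable \<rho>" unfolding k_def by measurable
  have k0: "0 \<le> k z" for z by (simp add: k_def laplace_nonneg[OF e] f_nonneg)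
  have "(\<integral>\<^sup>+z. ennreal (k z) \<partial>\<rho>) = (\<integral>\<^sup>+y. \<integral>\<^sup>+x. ennreal (k (x, y)) \<partial>\<mu> \<partial>\<nu>)"
    by (rule \<mu>\<nu>.nn_integral_snd[symmetric]) measurable
  also have "\<dots> \<le> (\<integral>\<^sup>+y. indicator V y \<partial>\<nu>)"
  proof (rule nn_integral_mono)
    fix y
    show "(\<integral>\<^sup>+x. ennreal (k (x, y)) \<partial>\<mu>) \<le> indicator V y"
      using nn_integral_laplace_over_density[OF e, of "m y"]
      by (auto simp: k_def split: split_indicator)
  qed
  also have "\<dots> = ennreal (measure \<nu> V)" by (simp add: \<nu>.emeasure_eq_measure)
  finally have le: "(\<integral>\<^sup>+z. ennreal (k z) \<partial>\<rho>) \<le> ennreal (measure \<nu> V)" .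
  then show "integrable \<rho> k"
    using k0 by (intro integrableI_nonneg) (auto intro: le_less_trans)
  show "(\<integral>z. k z \<partial>\<rho>) \<le> measure \<nu> V"
    using le k0 by (subst integral_eq_nn_integral) (auto intro!: enn2real_leI)
qed

text \<open>Duality is applied with the weight \<open>- w / e - ln (2 e f)\<close> on \<open>A \<times> UNIV\<close>: its first term is the
  excess cost, the second depends on the first marginal only, and its exponential is the Laplace kernel
  in the coordinate \<open>m\<close>, of mass at most 1. The constant \<open>K\<close> penalises \<open>A \<times> (- A)\<close>, where the
  kernel would otherwise leave spurious mass.\<close>

lemma Ent_lower_bound:
  fixes h :: "real \<times> real \<Rightarrow> real"
  assumes g: "\<gamma> \<in> couplings \<mu> \<nu>" and e: "e > 0" and K: "K \<ge> 0"
    and h[measurable]: "h \<in> borel_measurable (borel \<Otimes>\<^sub>M borel)" and B: "\<And>z. \<bar>h z\<bar> \<le> B"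
  shows "ereal (- (cost1 \<gamma> - W1 \<mu> \<nu>) / e - ln (2 * e) * measure \<mu> A - I\<^sub>A
      - K * (\<integral>z. indicator A (fst z) * indicator (- A) (snd z) \<partial>\<gamma>) + (\<integral>z. indicator E z * h z \<partial>\<gamma>) + 1
      - (measure \<nu> A + exp (- K) + escape e + (\<integral>z. indicator E z * exp (h z) \<partial>\<rho>))) \<le> Ent \<gamma> \<rho>"
proof -
  note D = couplingsD[OF g]
  interpret prob_space \<gamma> by (rule D)
  note D(2)[measurable_cong] sets_product[measurable_cong]
  define H where "H z = - w (fst z) (snd z) / e - ln (2 * e) * indicator A (fst z)
    - indicator A (fst z) * ln (f (fst z)) - K * (indicator A (fst z) * indicator (- A) (snd z))
    + indicator E z * h z" for z
  have [measurable]: "H \<in> borel_measurable (borel \<Otimes>\<^sub>M borel)" unfolding H_def by measurable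
  have Hm: "H \<in> borel_measurable \<rho>" by measurable
  have lnA: "integrable \<mu> (\<lambda>x. indicator A x * ln (f x))"
    using ln_f_integrable by (rule Bochner_Integration.integrable_bound) (auto split: split_indicator)
  have i: "integrable \<gamma> (\<lambda>z. w (fst z) (snd z))" "integrable \<gamma> (\<lambda>z. indicator A (fst z) :: real)"
    "integrable \<gamma> (\<lambda>z. indicator A (fst z) * ln (f (fst z)))"
    "integrable \<gamma> (\<lambda>z. indicator A (fst z) * indicator (- A) (snd z) :: real)" "integrable \<gamma> (\<lambda>z. indicator E z * h z)"
    subgoal by (rule integrable_w[OF g])
    subgoal by (rule bounded_integrable_coupling[OF g, where B=1]) (auto split: split_indicator)
    subgoal using lnA integral_marginals(3)[OF g, of "\<lambda>x. indicator A x * ln (f x)"] by simp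
    subgoal by (rule bounded_integrable_coupling[OF g, where B=1]) (auto split: split_indicator)
    subgoal by (rule bounded_integrable_coupling[OF g, where B="\<bar>B\<bar>"])
       (use B in \<open>auto split: split_indicator intro: order_trans[OF B abs_ge_self]\<close>)
    done
  then have iH: "integrable \<gamma> H" unfolding H_def by auto
  have "(\<integral>z. H z \<partial>\<gamma>) = - (\<integral>z. w (fst z) (snd z) \<partial>\<gamma>) / e - ln (2 * e) * (\<integral>z. indicator A (fst z) \<partial>\<gamma>)
    - (\<integral>z. indicator A (fst z) * ln (f (fst z)) \<partial>\<gamma>)
    - K * (\<integral>z. indicator A (fst z) * indicator (- A) (snd z) \<partial>\<gamma>) + (\<integral>z. indicator E z * h z \<partial>\<gamma>)"
    unfolding H_def using i by simp
  also have "(\<integral>z. w (fst z) (snd z) \<partial>\<gamma>) = cost1 \<gamma> - W1 \<mu> \<nu>" using cost1_minus_W1[OF g] by simp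
  also have "(\<integral>z. indicator A (fst z) \<partial>\<gamma>) = measure \<mu> A"
    by (subst integral_marginals(1)[OF g]) auto
  also have "(\<integral>z. indicator A (fst z) * ln (f (fst z)) \<partial>\<gamma>) = I\<^sub>A"
    by (subst integral_marginals(1)[OF g, of "\<lambda>x. indicator A x * ln (f x)"]) (auto simp: set_lebesgue_integral_def)
  finally have vH: "(\<integral>z. H z \<partial>\<gamma>) = - (cost1 \<gamma> - W1 \<mu> \<nu>) / e - ln (2 * e) * measure \<mu> A - I\<^sub>A
    - K * (\<integral>z. indicator A (fst z) * indicator (- A) (snd z) \<partial>\<gamma>) + (\<integral>z. indicator E z * h z \<partial>\<gamma>)" .
  define k where "k V z = indicator A (fst z) * indicator V (snd z) * laplace e (m (fst z) - m (snd z)) / f (fst z)" for V z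
  define s where "s z = indicator (- A) (fst z) * indicator A (snd z) * exp (- \<bar>m (fst z) - m (snd z)\<bar> / e)" for z
  define t where "t z = indicator E z * exp (h z)" for z
  have ks: "integrable \<rho> (k A)" "integrable \<rho> (k (- A))" "(\<integral>z. k A z \<partial>\<rho>) \<le> measure \<nu> A" "(\<integral>z. k (- A) z \<partial>\<rho>) \<le> measure \<nu> (- A)"
    using integral_laplace_over_density[OF e, of A] integral_laplace_over_density[OF e, of "- A"]
    unfolding k_def by auto
  have k1: "(\<integral>z. k (- A) z \<partial>\<rho>) \<le> 1" by (rule order_trans[OF ks(4) \<nu>.prob_le_1])
  have js: "integrable \<rho> s" 
    unfolding s_def by (rule bounded_integrable_coupling[OF product_coupling, where B=1]) (use e in \<open>auto split: split_indicator\<close>)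
  have it: "integrable \<rho> t"
  proof -
    have "\<bar>t z\<bar> \<le> exp B" for z using B[of z] by (auto simp: t_def split: split_indicator)
    then show ?thesis
      by (intro bounded_integrable_coupling[OF product_coupling, where B="exp B"]) (auto simp: t_def[abs_def])
  qed
  have wm: "exp (- w x y / e) \<le> exp (- \<bar>m x - m y\<bar> / e)" for x y
    using w_ge[of x y] e by (simp add: divide_right_mono)
  \<comment> \<open>The four majorants live on the four blocks \<open>A \<times> A\<close>,
    \<open>A \<times> (- A)\<close>, \<open>(- A) \<times> A\<close> and \<open>E\<close>, one for
    each. On the last one \<open>w \<ge> 0\<close> suffices and \<open>exp h\<close>
    remains.\<close>
  have bd: "AE z in \<rho>. exp (H z) \<le> k A z + exp (- K) * k (- A) z + s z + t z"
    using AE_\<rho>_fst[OF AE_f_pos]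
  proof eventually_elim
    case (elim z)
    obtain x y where z: "z = (x, y)" by (cases z)
    have fx: "f x > 0" using elim z by simp
    have q: "exp (- w x y / e - ln (2 * e) - ln (f x)) \<le> laplace e (m x - m y) / f x"
    proof -
      have "exp (- w x y / e - ln (2 * e) - ln (f x)) = exp (- w x y / e) / (2 * e) / f x"
        using e fx by (simp add: exp_diff)
      also have "\<dots> \<le> laplace e (m x - m y) / f x"
        unfolding laplace_def using e fx by (intro divide_right_mono wm) auto
      finally show ?thesis .
    qed
    show ?case
    proof (cases "x \<in> A"; cases "y \<in> A")
      assume a: "x \<in> A" "y \<in> A"
      then show ?thesis using q by (simp add: z H_def k_def s_def t_def)
    next
      assume a: "x \<in> A" "y \<notin> A"
      then have "exp (H z) = exp (- K) * exp (- w x y / e - ln (2 * e) - ln (f x))"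
        by (simp add: z H_def exp_add[symmetric] algebra_simps)
      also have "\<dots> \<le> exp (- K) * (laplace e (m x - m y) / f x)" by (intro mult_left_mono q) auto
      finally show ?thesis using a by (simp add: z k_def s_def t_def)
    next
      assume a: "x \<notin> A" "y \<in> A"
      then show ?thesis using wm[of x y] by (simp add: z H_def k_def s_def t_def)
    next
      assume a: "x \<notin> A" "y \<notin> A"
      have "- w x y / e + h z \<le> h z" using w_nonneg[of x y] e by simp
      then show ?thesis using a by (simp add: z H_def k_def s_def t_def)
    qed
  qed
  have ib: "integrable \<rho> (\<lambda>z. k A z + exp (- K) * k (- A) z + s z + t z)" using ks js it by auto
  have ie: "integrable \<rho> (\<lambda>z. exp (H z))"
    by (rule Bochner_Integration.integrable_bound[OF ib]) (use bd in \<open>auto elim!: eventually_mono intro: order_trans[OF _ abs_ge_self]\<close>)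
  have "(\<integral>z. exp (H z) \<partial>\<rho>) \<le> (\<integral>z. k A z + exp (- K) * k (- A) z + s z + t z \<partial>\<rho>)"
    by (rule integral_mono_AE[OF ie ib bd])
  also have "\<dots> = (\<integral>z. k A z \<partial>\<rho>) + exp (- K) * (\<integral>z. k (- A) z \<partial>\<rho>) + escape e + (\<integral>z. t z \<partial>\<rho>)"
  proof -
    have "escape e = (\<integral>z. s z \<partial>\<rho>)" by (simp add: escape_def s_def)
    then show ?thesis using ks js it by simp
  qed
  also have "\<dots> \<le> measure \<nu> A + exp (- K) + escape e + (\<integral>z. t z \<partial>\<rho>)"
    using ks(3) k1 by (intro add_right_mono add_mono) (auto simp: mult_left_le)
  finally have vE: "(\<integral>z. exp (H z) \<partial>\<rho>) \<le> measure \<nu> A + exp (- K) + escape e + (\<integral>z. indicator E z * exp (h z) \<partial>\<rho>)"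
    by (simp add: t_def)
  have "ereal ((\<integral>z. H z \<partial>\<gamma>) + 1 - (\<integral>z. exp (H z) \<partial>\<rho>)) \<le> Ent \<gamma> \<rho>"
    using Ent_ge_dual[OF finite_measure_\<rho> finite_measure_axioms iH ie Hm] by (simp add: prob_space)
  then show ?thesis
    by (rule order_trans[rotated]) (use vE in \<open>simp add: vH\<close>)
qed

lemma indicator_E: "indicator E z = (indicator (- A) (fst z) * indicator (- A) (snd z) :: real)" for z :: "real \<times> real"
  by (cases z) (auto split: split_indicator)

text \<open>A nearly optimal continuous test function \<open>h\<close> for the restricted plan is
  inserted into the global dual bound. Every term that depends on \<open>e\<close> there either
  cancels against the functional or converges.\<close>

lemma liminf_optimal:
  assumes \<gamma>s: "\<And>e. e > 0 \<Longrightarrow> \<gamma>s e \<in> couplings \<mu> \<nu>" and opt: "\<gamma> \<in> opt1 \<mu> \<nu>"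
    and nc: "narrow_conv \<gamma>s \<gamma> (at_right 0)"
  shows "Ent (restr \<gamma> E) \<rho> - ereal I\<^sub>A
    \<le> Liminf (at_right 0) (\<lambda>e. ereal ((cost1 (\<gamma>s e) - W1 \<mu> \<nu>) / e) + Ent (\<gamma>s e) \<rho>
             - ereal (\<bar>ln (2 * e)\<bar> * measure \<mu> A))"
  unfolding le_Liminf_iff
proof (intro allI impI)
  note \<gamma> = opt1D[OF opt]
  note D = couplingsD[OF \<gamma>]
  interpret prob_space \<gamma> by (rule D)
  note D(2)[measurable_cong] sets_product[measurable_cong]
  fix y assume "y < Ent (restr \<gamma> E) \<rho> - ereal I\<^sub>A"
  then obtain c where c: "y < ereal c" "ereal c < Ent (restr \<gamma> E) \<rho> - ereal I\<^sub>A"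
    using ereal_dense2 by blast
  then have "ereal (c + I\<^sub>A) < Ent (restr \<gamma> E) \<rho>"
    by (cases "Ent (restr \<gamma> E) \<rho>") auto
  then obtain h B where h: "continuous_on UNIV h" "\<And>z. \<bar>h z\<bar> \<le> B"
    and lt: "c + I\<^sub>A < (\<integral>z. h z \<partial>restr \<gamma> E) + measure (restr \<gamma> E) (space (restr \<gamma> E)) - (\<integral>z. exp (h z) \<partial>\<rho>)"
    using Ent_less_dual_continuous[OF finite_measure_\<rho> restr_finite(1)[OF \<gamma>], of "c + I\<^sub>A"]
      restr_finite(2)[OF \<gamma>] sets_product unfolding borel_prod by blast
  note hm[measurable] = continuous_measurable_pair[OF h(1)]
  \<comment> \<open>\<open>h\<close> was chosen with \<open>exp h\<close> integrated over the whole
    plane; its part off \<open>E\<close> only lowers the dual value and may be dropped.\<close>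
  have "(\<integral>z. indicator E z * exp (h z) \<partial>\<rho>) \<le> (\<integral>z. exp (h z) \<partial>\<rho>)"
  proof (rule integral_mono)
    have "exp (h z) \<le> exp B" for z using h(2)[of z] by simp
    then show "integrable \<rho> (\<lambda>z. exp (h z))" "integrable \<rho> (\<lambda>z. indicator E z * exp (h z))"
      by (auto intro!: bounded_integrable_coupling[OF product_coupling, where B="exp B"] split: split_indicator)
  qed (auto split: split_indicator)
  then have lt2: "c + I\<^sub>A < (\<integral>z. indicator E z * h z \<partial>\<gamma>) + 1 - measure \<nu> A - (\<integral>z. indicator E z * exp (h z) \<partial>\<rho>)"
    using lt restr_integral[OF \<gamma> hm] restr_finite(3)[OF \<gamma>] opt1_measure_A[OF opt] by simp
  define T where "T = (\<integral>z. indicator E z * h z \<partial>\<gamma>) + 1 - measure \<nu> A - (\<integral>z. indicator E z * exp (h z) \<partial>\<rho>) - (c + I\<^sub>A)"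
  have T: "T > 0" using lt2 by (simp add: T_def)
  \<comment> \<open>The kernel mass left on \<open>A \<times> (- A)\<close> is at most
    \<open>exp (- K) \<le> T / 2\<close>, less than the slack. \<open>K\<close> is fixed before
    \<open>e\<close> tends to 0, so the penalty itself vanishes in the limit by
    \<open>lim2\<close>.\<close>
  define K where "K = max 0 (- ln (T / 2))"
  have K: "K \<ge> 0" by (simp add: K_def)
  have "exp (- K) \<le> exp (ln (T / 2))" unfolding K_def by (subst exp_le_cancel_iff) auto
  then have eK: "exp (- K) < T" using T by simp
  have lim1: "((\<lambda>e. \<integral>z. indicator E z * h z \<partial>\<gamma>s e) \<longlongrightarrow> (\<integral>z. indicator E z * h z \<partial>\<gamma>)) (at_right 0)"
    unfolding indicator_E by (rule narrow_conv_indicator[OF \<gamma>s \<gamma> nc _ _ h]) auto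
  have "((\<lambda>e. \<integral>z. indicator A (fst z) * indicator (- A) (snd z) * (\<lambda>_. 1::real) z \<partial>\<gamma>s e)
    \<longlongrightarrow> (\<integral>z. indicator A (fst z) * indicator (- A) (snd z) * (\<lambda>_. 1::real) z \<partial>\<gamma>)) (at_right 0)"
    by (rule narrow_conv_indicator[OF \<gamma>s \<gamma> nc, where B=1]) auto
  moreover have "(\<integral>z. indicator A (fst z) * indicator (- A) (snd z) \<partial>\<gamma>) = (\<integral>z. (0::real) \<partial>\<gamma>)"
    using opt1_off_diagonal[OF opt] by (intro integral_cong_AE) (auto split: split_indicator)
  ultimately have lim2: "((\<lambda>e. \<integral>z. indicator A (fst z) * indicator (- A) (snd z) \<partial>\<gamma>s e) \<longlongrightarrow> (0::real)) (at_right 0)"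
    by simp
  define \<Lambda> where "\<Lambda> e = - I\<^sub>A - K * (\<integral>z. indicator A (fst z) * indicator (- A) (snd z) \<partial>\<gamma>s e)
    + (\<integral>z. indicator E z * h z \<partial>\<gamma>s e) + 1
    - (measure \<nu> A + exp (- K) + escape e + (\<integral>z. indicator E z * exp (h z) \<partial>\<rho>))" for e
  have "(\<Lambda> \<longlongrightarrow> - I\<^sub>A - K * 0 + (\<integral>z. indicator E z * h z \<partial>\<gamma>) + 1
    - (measure \<nu> A + exp (- K) + 0 + (\<integral>z. indicator E z * exp (h z) \<partial>\<rho>))) (at_right 0)"
    unfolding \<Lambda>_def by (intro tendsto_intros lim1 lim2 escape_tendsto_0)
  moreover have "c < - I\<^sub>A - K * 0 + (\<integral>z. indicator E z * h z \<partial>\<gamma>) + 1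
    - (measure \<nu> A + exp (- K) + 0 + (\<integral>z. indicator E z * exp (h z) \<partial>\<rho>))"
    using eK by (simp add: T_def)
  ultimately have "eventually (\<lambda>e. c < \<Lambda> e) (at_right 0)" by (rule order_tendstoD)
  \<comment> \<open>Below 1/2 the modulus in the functional is \<open>- ln (2 * e)\<close>, the term
    of the dual bound.\<close>
  moreover have "eventually (\<lambda>e::real. e \<in> {0<..<1/2}) (at_right 0)"
    by (rule eventually_at_right_real) simp
  ultimately show "eventually (\<lambda>e. y < ereal ((cost1 (\<gamma>s e) - W1 \<mu> \<nu>) / e) + Ent (\<gamma>s e) \<rho>
             - ereal (\<bar>ln (2 * e)\<bar> * measure \<mu> A)) (at_right 0)"
  proof eventually_elim
    case (elim e)
    then have e: "e > 0" "\<bar>ln (2 * e)\<bar> = - ln (2 * e)" by auto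
    have "ereal (\<Lambda> e - ((cost1 (\<gamma>s e) - W1 \<mu> \<nu>) / e) - ln (2 * e) * measure \<mu> A) \<le> Ent (\<gamma>s e) \<rho>"
      by (rule order_trans[OF _ Ent_lower_bound[OF \<gamma>s[OF e(1)] e(1) K hm h(2)]])
        (simp add: \<Lambda>_def algebra_simps diff_divide_distrib)
    then show ?case using c(1) elim(1) unfolding e(2)
      by (cases "Ent (\<gamma>s e) \<rho>") (auto intro: less_trans le_less_trans)
  qed
qed

end

section \<open>Recovery sequence\<close>

locale line_optimal = line_pair +
  fixes \<gamma>0 assumes opt: "\<gamma>0 \<in> opt1 \<mu> \<nu>"
begin

lemmas cpl = opt1D[OF opt]
sublocale \<gamma>0: prob_space \<gamma>0 by (rule couplingsD(1)[OF cpl])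
lemmas sets_\<gamma>0[measurable_cong] = couplingsD(2)[OF cpl]
lemmas sets_\<rho>[measurable_cong] = sets_product

lemma nn_integral_f: "(\<integral>\<^sup>+x. ennreal (f x) \<partial>lborel) = 1"
  using \<mu>.emeasure_space_1 nn_integral_\<mu>[of "\<lambda>_. 1"] by simp

text \<open>The optimal plan is diagonal over \<open>A\<close>, so its two marginals coincide there.
  Thus \<open>f\<close> is also the density of \<open>\<nu>\<close> on \<open>A\<close>.\<close>

lemma nn_integral_A_eq:
  assumes [measurable]: "h \<in> borel_measurable borel"
  shows "(\<integral>\<^sup>+x. h x * indicator A x \<partial>\<mu>) = (\<integral>\<^sup>+y. h y * indicator A y \<partial>\<nu>)"
proof -
  have m: "fst \<in> measurable \<gamma>0 borel" "snd \<in> measurable \<gamma>0 borel" by measurable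
  have "(\<integral>\<^sup>+x. h x * indicator A x \<partial>\<mu>) = (\<integral>\<^sup>+z. h (fst z) * indicator A (fst z) \<partial>\<gamma>0)"
    using nn_integral_distr[OF m(1), of "\<lambda>x. h x * indicator A x"] couplingsD(5)[OF cpl] by simp
  also have "\<dots> = (\<integral>\<^sup>+z. h (snd z) * indicator A (snd z) \<partial>\<gamma>0)"
  proof (rule nn_integral_cong_AE, use opt1_AE_diagonal[OF opt] in eventually_elim)
    case (elim z)
    show ?case
    proof (cases "fst z = snd z")
      case False
      then have "fst z \<notin> A" "snd z \<notin> A" using elim by blast+
      then show ?thesis by simp
    qed (simp only:)
  qed
  also have "\<dots> = (\<integral>\<^sup>+y. h y * indicator A y \<partial>\<nu>)"
    using nn_integral_distr[OF m(2), of "\<lambda>x. h x * indicator A x"] couplingsD(6)[OF cpl] by simp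
  finally show ?thesis .
qed

lemma AE_A_transfer:
  assumes P: "AE x in \<mu>. x \<in> A \<longrightarrow> P x" and [measurable]: "Measurable.pred borel P"
  shows "AE y in \<nu>. y \<in> A \<longrightarrow> P y"
proof -
  have "AE z in \<gamma>0. snd z \<in> A \<longrightarrow> P (snd z)"
    using couplingsD(3)[OF cpl P] opt1_AE_diagonal[OF opt] by eventually_elim metis
  moreover have m: "snd \<in> measurable \<gamma>0 borel" by measurable
  moreover have "{y \<in> space borel. y \<in> A \<longrightarrow> P y} \<in> sets borel" by measurable
  ultimately have "AE y in distr \<gamma>0 borel snd. y \<in> A \<longrightarrow> P y" by (subst AE_distr_iff)
  then show ?thesis unfolding couplingsD(6)[OF cpl] .
qed

text \<open>The density is taken with respect to \<open>\<rho>\<close>: dividing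
  \<open>min (f x) (f y)\<close> by \<open>f x * f y\<close> leaves the reciprocal of the maximum.
  If both values vanish the quotient is 0 by convention.\<close>

definition q :: "real \<Rightarrow> real \<Rightarrow> real \<Rightarrow> real" where
  "q e x y = indicator A x * indicator A y * laplace e (x - y) / max (f x) (f y)"

lemma q_measurable[measurable (raw)]:
  assumes [measurable]: "g \<in> borel_measurable M" "h \<in> borel_measurable M"
  shows "(\<lambda>x. q e (g x) (h x)) \<in> borel_measurable M"
  unfolding q_def by measurable

lemma q_commute: "q e x y = q e y x"
  by (simp add: q_def laplace_minus_commute[of e x] max.commute mult_ac)

lemma q_nonneg: "0 < e \<Longrightarrow> 0 \<le> q e x y"
  using f_nonneg[of x] by (auto simp: q_def laplace_nonneg intro!: divide_nonneg_nonneg mult_nonneg_nonneg)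

lemma nn_integral_q_eq:
  "(\<integral>\<^sup>+y. ennreal (q e x y) \<partial>\<mu>) = (\<integral>\<^sup>+y. ennreal (q e x y) \<partial>\<nu>)"
proof -
  have *: "ennreal (q e x y) = ennreal (q e x y) * indicator A y" for y
    by (auto simp: q_def split: split_indicator)
  show ?thesis by (subst (1 2) *, rule nn_integral_A_eq) measurable
qed

lemma density_q_le: "0 < e \<Longrightarrow> f y * q e x y \<le> laplace e (x - y)"
proof -
  assume e: "0 < e"
  show ?thesis
  proof (cases "max (f x) (f y) = 0")
    case False
    then have "max (f x) (f y) > 0" using f_nonneg[of x] by (auto simp: less_le)
    then have "f y / max (f x) (f y) \<le> 1" by simp
    then have "f y / max (f x) (f y) * (indicator A x * indicator A y * laplace e (x - y)) \<le> 1 * (1 * 1 * laplace e (x - y))"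
      using f_nonneg[of y] f_nonneg[of x] laplace_nonneg[OF e, of "x - y"]
      by (intro mult_mono) (auto split: split_indicator)
    then show ?thesis by (simp add: q_def mult_ac)
  qed (simp add: q_def laplace_nonneg[OF e])
qed

lemma nn_integral_q_lborel:
  assumes "0 < e"
  shows "(\<integral>\<^sup>+y. ennreal (q e x y) \<partial>\<nu>) = (\<integral>\<^sup>+y. ennreal (f y * q e x y) \<partial>lborel)"
  unfolding nn_integral_q_eq[symmetric] using f_nonneg q_nonneg[OF assms]
  by (simp add: nn_integral_\<mu> ennreal_mult)

lemma nn_integral_q_le_1:
  assumes "0 < e" shows "(\<integral>\<^sup>+y. ennreal (q e x y) \<partial>\<nu>) \<le> 1"
proof -
  have "(\<integral>\<^sup>+y. ennreal (q e x y) \<partial>\<nu>) \<le> (\<integral>\<^sup>+y. ennreal (laplace e (y - x)) \<partial>lborel)"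
    unfolding nn_integral_q_lborel[OF assms]
    using density_q_le[OF assms] by (intro nn_integral_mono ennreal_leI) (simp add: laplace_minus_commute)
  then show ?thesis using nn_integral_laplace[OF assms] by simp
qed

text \<open>Fraction of the mass at \<open>x\<close> that \<open>q\<close> couples. Since
  \<open>q\<close> is symmetric and the marginals agree on \<open>A\<close>, the same function
  describes the second marginal; so does the complementary fraction \<open>r\<close>.\<close>

definition p :: "real \<Rightarrow> real \<Rightarrow> real" where "p e x = enn2real (\<integral>\<^sup>+y. ennreal (q e x y) \<partial>\<nu>)"

lemma p_measurable[measurable]: "p e \<in> borel_measurable borel"
  unfolding p_def[abs_def] by measurable

lemma p_bounds: assumes "0 < e" shows "0 \<le> p e x" "p e x \<le> 1"
  unfolding p_def using nn_integral_q_le_1[OF assms, of x] by (auto intro!: enn2real_leI)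

lemma p_outside: "x \<notin> A \<Longrightarrow> p e x = 0"
  by (simp add: p_def q_def)

lemma nn_integral_q:
  assumes "0 < e"
  shows "(\<integral>\<^sup>+y. ennreal (q e x y) \<partial>\<nu>) = ennreal (p e x)" "(\<integral>\<^sup>+x. ennreal (q e x y) \<partial>\<mu>) = ennreal (p e y)"
proof -
  show 1: "(\<integral>\<^sup>+y. ennreal (q e x y) \<partial>\<nu>) = ennreal (p e x)" for x
    unfolding p_def using nn_integral_q_le_1[OF assms, of x]
    by (intro ennreal_enn2real[symmetric]) (auto intro: le_less_trans)
  show "(\<integral>\<^sup>+x. ennreal (q e x y) \<partial>\<mu>) = ennreal (p e y)"
    unfolding q_commute[of e _ y] nn_integral_q_eq by (rule 1)
qed

definition r :: "real \<Rightarrow> real \<Rightarrow> real" where "r e x = indicator A x * (1 - p e x)"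

lemma r_measurable[measurable]: "r e \<in> borel_measurable borel"
  unfolding r_def[abs_def] by measurable

lemma r_bounds: assumes "0 < e" shows "0 \<le> r e x" "r e x \<le> 1"
  using p_bounds[OF assms, of x] by (auto simp: r_def split: split_indicator)

lemma r_integrable: "0 < e \<Longrightarrow> integrable \<mu> (r e)"
  by (rule \<mu>.integrable_const_bound[where B=1]) (use r_bounds[of e] in auto)

definition deficit :: "real \<Rightarrow> real" where "deficit e = (\<integral>x. r e x \<partial>\<mu>)"

abbreviation "fA x \<equiv> indicator A x * f x"

text \<open>As the kernel has mass 1, the missing density at \<open>x\<close> is the kernel average
  of \<open>f x - indicator A y * min (f x) (f y)\<close>, which for \<open>x\<close> in
  \<open>A\<close> is the positive part of \<open>fA x - fA y\<close>. The deficit is thus a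
  one-sided modulus of continuity of \<open>fA\<close> in mean.\<close>

lemma density_r_eq:
  assumes e: "0 < e"
  shows "ennreal (f x * r e x) = (\<integral>\<^sup>+y. ennreal (laplace e (y - x) * max 0 (fA x - fA y)) \<partial>lborel)"
proof (cases "x \<in> A \<and> f x > 0")
  case False
  then have 0: "f x * r e x = 0" using f_nonneg[of x] by (auto simp: r_def not_less)
  have 1: "max 0 (fA x - fA y) = 0" for y
    using False f_nonneg[of x] f_nonneg[of y] by (auto simp: max_def not_less split: split_indicator)
  show ?thesis unfolding 0 1 by simp
next
  case True
  have lap: "integrable lborel (\<lambda>y. laplace e (y - x))" "(\<integral>y. laplace e (y - x) \<partial>lborel) = 1"
  proof -
    show "integrable lborel (\<lambda>y. laplace e (y - x))"
      using nn_integral_laplace[OF e, of x] laplace_nonneg[OF e] by (intro integrableI_nonneg) auto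
    show "(\<integral>y. laplace e (y - x) \<partial>lborel) = 1"
      using nn_integral_laplace[OF e, of x] laplace_nonneg[OF e] by (subst integral_eq_nn_integral) auto
  qed
  have fq: "0 \<le> f y * q e x y" "f y * q e x y \<le> laplace e (y - x)" for y
    using f_nonneg[of y] q_nonneg[OF e, of x y] density_q_le[OF e, of y x] by (auto simp: laplace_minus_commute[of e x])
  have iq: "integrable lborel (\<lambda>y. f y * q e x y)"
    by (rule Bochner_Integration.integrable_bound[OF lap(1)]) (use fq in \<open>auto intro: order_trans[OF _ abs_ge_self]\<close>)
  have pv: "p e x = (\<integral>y. f y * q e x y \<partial>lborel)"
    unfolding p_def nn_integral_q_lborel[OF e] using fq(1) by (subst integral_eq_nn_integral) auto
  have "f x * r e x = f x * ((\<integral>y. laplace e (y - x) \<partial>lborel) - (\<integral>y. f y * q e x y \<partial>lborel))"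
    using True by (simp add: r_def lap pv)
  also have "\<dots> = (\<integral>y. f x * (laplace e (y - x) - f y * q e x y) \<partial>lborel)"
    using lap iq by simp
  also have "\<dots> = (\<integral>y. laplace e (y - x) * max 0 (fA x - fA y) \<partial>lborel)"
  proof (rule Bochner_Integration.integral_cong[OF refl])
    fix y
    have "f x * (f y / max (f x) (f y)) = min (f x) (f y)" using True by (auto simp: max_def min_def)
    then have *: "f x * f y / max (f x) (f y) = min (f x) (f y)" by simp
    have "f x * (f y * q e x y) = laplace e (y - x) * (indicator A y * (f x * f y / max (f x) (f y)))"
      using True by (simp add: q_def laplace_minus_commute[of e x])
    then have "f x * (f y * q e x y) = laplace e (y - x) * (indicator A y * min (f x) (f y))" unfolding * .
    then have "f x * (laplace e (y - x) - f y * q e x y) = laplace e (y - x) * (f x - indicator A y * min (f x) (f y))"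
      by (simp add: algebra_simps)
    also have "f x - indicator A y * min (f x) (f y) = max 0 (fA x - fA y)"
      using True by (auto split: split_indicator simp: min_def max_def)
    finally show "f x * (laplace e (y - x) - f y * q e x y) = laplace e (y - x) * max 0 (fA x - fA y)" .
  qed
  finally have eq: "f x * r e x = (\<integral>y. laplace e (y - x) * max 0 (fA x - fA y) \<partial>lborel)" .
  have "integrable lborel (\<lambda>y. laplace e (y - x) * max 0 (fA x - fA y))"
  proof (rule Bochner_Integration.integrable_bound[where f="\<lambda>y. laplace e (y - x) * f x"])
    show "AE y in lborel. norm (laplace e (y - x) * max 0 (fA x - fA y)) \<le> norm (laplace e (y - x) * f x)"
      using True f_nonneg laplace_nonneg[OF e]
      by (intro AE_I2) (auto simp: abs_mult max_def split: split_indicator intro!: mult_left_mono)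
  qed (use lap in auto)
  then show ?thesis unfolding eq
    using laplace_nonneg[OF e] by (subst nn_integral_eq_integral) auto
qed

lemma nn_integral_laplace': "e > 0 \<Longrightarrow> (\<integral>\<^sup>+x. ennreal (laplace e (c - x)) \<partial>lborel) = 1"
  using nn_integral_laplace[of e c] by (simp add: laplace_minus_commute[of e c])

text \<open>Comparison of \<open>fA\<close> with a Lipschitz \<open>v\<close>: each of the two
  replacements costs \<open>d\<close>, since the kernel has mass 1 in either variable, and the
  oscillation of \<open>v\<close> costs \<open>\<bar>C\<bar>\<close> times the kernel moment
  \<open>e\<close> over a window of length \<open>2 * L + 2\<close>.\<close>

lemma deficit_le:
  assumes e: "0 < e" and v: "\<And>x y. \<bar>v x - v y\<bar> \<le> C * \<bar>x - y\<bar>"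
    and d: "(\<integral>\<^sup>+x. ennreal \<bar>fA x - v x\<bar> * indicator {-(L+1)..L+1} x \<partial>lborel) \<le> ennreal d" "0 \<le> d"
  shows "deficit e \<le> 2 * d + e * (\<bar>C\<bar> * (2 * L + 2) + 1)"
proof -
  let ?W = "{-(L+1)..L+1}"
  have [measurable]: "v \<in> borel_measurable borel"
    using v by (intro borel_measurable_lipschitz(2)[of v C]) (simp add: dist_real_def)
  let ?D = "\<lambda>x. ennreal \<bar>fA x - v x\<bar> * indicator ?W x"
  let ?lap = "\<lambda>x y. ennreal (laplace e (y - x))"
  let ?G = "\<lambda>x y. ?D x * ?lap x y + (?D y * ?lap x y
    + (ennreal \<bar>C\<bar> * indicator ?W x * ennreal (laplace e (y - x) * \<bar>y - x\<bar>)
    + ennreal (f x) * ennreal (laplace e (y - x) * \<bar>y - x\<bar>)))"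
  have pt: "ennreal (laplace e (y - x) * max 0 (fA x - fA y)) \<le> ?G x y" if x: "0 < f x \<longrightarrow> \<bar>x\<bar> \<le> L" for x y
  proof -
    note lp = laplace_nonneg[OF e, of "y - x"]
    show ?thesis
    proof (cases "fA x - fA y \<le> 0")
      case False
      have "0 \<le> fA y" using f_nonneg[of y] by simp
      then have "0 < fA x" using False by linarith
      then have "0 < f x" by (auto split: split_indicator_asm)
      then have xL: "\<bar>x\<bar> \<le> L" using x by simp
      show ?thesis
      proof (cases "y \<in> ?W")
        case True
        have xW: "x \<in> ?W" using xL by auto
        have "max 0 (fA x - fA y) \<le> \<bar>fA x - v x\<bar> + \<bar>fA y - v y\<bar> + \<bar>C\<bar> * \<bar>y - x\<bar>"
        proof -
          have "C * \<bar>x - y\<bar> \<le> \<bar>C\<bar> * \<bar>y - x\<bar>" by (simp add: abs_minus_commute mult_right_mono)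
          then have "\<bar>v x - v y\<bar> \<le> \<bar>C\<bar> * \<bar>y - x\<bar>" using v[of x y] by linarith
          then show ?thesis using False by linarith
        qed
        then have "laplace e (y - x) * max 0 (fA x - fA y) \<le> laplace e (y - x) * (\<bar>fA x - v x\<bar> + \<bar>fA y - v y\<bar> + \<bar>C\<bar> * \<bar>y - x\<bar>)"
          using lp by (rule mult_left_mono)
        also have "\<dots> = \<bar>fA x - v x\<bar> * laplace e (y - x) + (\<bar>fA y - v y\<bar> * laplace e (y - x) + \<bar>C\<bar> * (laplace e (y - x) * \<bar>y - x\<bar>))"
          by (simp add: algebra_simps)
        finally have "ennreal (laplace e (y - x) * max 0 (fA x - fA y))
          \<le> ennreal (\<bar>fA x - v x\<bar> * laplace e (y - x) + (\<bar>fA y - v y\<bar> * laplace e (y - x) + \<bar>C\<bar> * (laplace e (y - x) * \<bar>y - x\<bar>)))"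
          by (rule ennreal_leI)
        also have "\<dots> = ?D x * ?lap x y + (?D y * ?lap x y + ennreal \<bar>C\<bar> * indicator ?W x * ennreal (laplace e (y - x) * \<bar>y - x\<bar>))"
          using lp True xW by (simp add: ennreal_plus ennreal_mult del: ennreal_plus[symmetric])
        also have "\<dots> \<le> ?G x y" by (intro add_mono order_refl) simp
        finally show ?thesis .
      next
        case False
        \<comment> \<open>The window exceeds the support by 1 on each side, so a \<open>y\<close>
          outside it is at distance at least 1. The bound \<open>f x\<close> may then be multiplied
          by this distance and is paid for by the first moment of the kernel, the summand
          \<open>e * 1\<close>.\<close>
        then have "1 \<le> \<bar>y - x\<bar>" using xL by auto
        have "max 0 (fA x - fA y) \<le> f x * 1"
          using f_nonneg[of x] f_nonneg[of y] by (auto split: split_indicator)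
        also have "\<dots> \<le> f x * \<bar>y - x\<bar>" using \<open>1 \<le> \<bar>y - x\<bar>\<close> f_nonneg[of x] by (intro mult_left_mono) auto
        finally have "laplace e (y - x) * max 0 (fA x - fA y) \<le> laplace e (y - x) * (f x * \<bar>y - x\<bar>)"
          using lp by (rule mult_left_mono)
        then have "ennreal (laplace e (y - x) * max 0 (fA x - fA y)) \<le> ennreal (f x) * ennreal (laplace e (y - x) * \<bar>y - x\<bar>)"
          using lp f_nonneg[of x] by (subst ennreal_mult[symmetric]) (auto intro!: ennreal_leI simp: mult_ac)
        also have "\<dots> \<le> ?G x y" by (simp add: add.assoc[symmetric])
        finally show ?thesis .
      qed
    qed (simp add: max_def)
  qed
  have "ennreal (deficit e) = (\<integral>\<^sup>+x. ennreal (r e x) \<partial>\<mu>)"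
    unfolding deficit_def using r_integrable[OF e] r_bounds[OF e] by (subst nn_integral_eq_integral) auto
  also have "\<dots> = (\<integral>\<^sup>+x. ennreal (f x * r e x) \<partial>lborel)"
    using f_nonneg r_bounds[OF e] by (simp add: nn_integral_\<mu> ennreal_mult)
  also have "\<dots> = (\<integral>\<^sup>+x. \<integral>\<^sup>+y. ennreal (laplace e (y - x) * max 0 (fA x - fA y)) \<partial>lborel \<partial>lborel)"
    unfolding density_r_eq[OF e] ..
  also have "\<dots> \<le> (\<integral>\<^sup>+x. \<integral>\<^sup>+y. ?G x y \<partial>lborel \<partial>lborel)"
    by (rule nn_integral_mono_AE, use AE_f_bound in eventually_elim, rule nn_integral_mono, rule pt)
  also have "\<dots> = (\<integral>\<^sup>+x. \<integral>\<^sup>+y. ?D x * ?lap x y \<partial>lborel \<partial>lborel) + ((\<integral>\<^sup>+x. \<integral>\<^sup>+y. ?D y * ?lap x y \<partial>lborel \<partial>lborel)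
    + ((\<integral>\<^sup>+x. \<integral>\<^sup>+y. ennreal \<bar>C\<bar> * indicator ?W x * ennreal (laplace e (y - x) * \<bar>y - x\<bar>) \<partial>lborel \<partial>lborel)
    + (\<integral>\<^sup>+x. \<integral>\<^sup>+y. ennreal (f x) * ennreal (laplace e (y - x) * \<bar>y - x\<bar>) \<partial>lborel \<partial>lborel)))"
    by (simp add: nn_integral_add)
  also have "(\<integral>\<^sup>+x. \<integral>\<^sup>+y. ?D x * ?lap x y \<partial>lborel \<partial>lborel) = (\<integral>\<^sup>+x. ?D x \<partial>lborel)"
    by (simp add: nn_integral_cmult nn_integral_laplace[OF e])
  also have "(\<integral>\<^sup>+x. \<integral>\<^sup>+y. ?D y * ?lap x y \<partial>lborel \<partial>lborel) = (\<integral>\<^sup>+y. \<integral>\<^sup>+x. ?D y * ?lap x y \<partial>lborel \<partial>lborel)"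
    by (rule lborel_pair.Fubini') simp
  also have "\<dots> = (\<integral>\<^sup>+x. ?D x \<partial>lborel)"
    by (simp add: nn_integral_cmult nn_integral_laplace'[OF e])
  also have "(\<integral>\<^sup>+x. \<integral>\<^sup>+y. ennreal \<bar>C\<bar> * indicator ?W x * ennreal (laplace e (y - x) * \<bar>y - x\<bar>) \<partial>lborel \<partial>lborel)
    = (\<integral>\<^sup>+x. ennreal (\<bar>C\<bar> * e) * indicator ?W x \<partial>lborel)"
    using e by (intro nn_integral_cong, subst nn_integral_cmult)
      (simp, subst nn_integral_laplace_abs[OF e], auto simp: ennreal_mult split: split_indicator)
  also have "\<dots> = ennreal (\<bar>C\<bar> * e) * ennreal (2 * L + 2)"
    using L_pos by (subst nn_integral_cmult_indicator) (auto simp: algebra_simps)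
  also have "\<dots> = ennreal (\<bar>C\<bar> * (2 * L + 2) * e)"
    using L_pos e by (subst ennreal_mult[symmetric]) (auto simp: mult_ac)
  also have "(\<integral>\<^sup>+x. \<integral>\<^sup>+y. ennreal (f x) * ennreal (laplace e (y - x) * \<bar>y - x\<bar>) \<partial>lborel \<partial>lborel) = ennreal e"
    by (simp add: nn_integral_cmult nn_integral_multc nn_integral_laplace_abs[OF e] nn_integral_f)
  also have "(\<integral>\<^sup>+x. ?D x \<partial>lborel) + ((\<integral>\<^sup>+x. ?D x \<partial>lborel) + (ennreal (\<bar>C\<bar> * (2 * L + 2) * e) + ennreal e))
    \<le> ennreal d + (ennreal d + (ennreal (\<bar>C\<bar> * (2 * L + 2) * e) + ennreal e))"
    by (intro add_mono d order_refl)
  also have "\<dots> = ennreal (2 * d + e * (\<bar>C\<bar> * (2 * L + 2) + 1))"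
    using d(2) e L_pos by (simp add: ennreal_plus[symmetric] algebra_simps del: ennreal_plus)
  finally show ?thesis
    using d(2) e L_pos by (subst (asm) ennreal_le_iff) (auto intro!: add_nonneg_nonneg mult_nonneg_nonneg)
qed

lemma deficit_tendsto_0: "(deficit \<longlongrightarrow> 0) (at_right 0)"
proof (rule tendstoI)
  fix \<epsilon> :: real assume \<epsilon>: "\<epsilon> > 0"
  let ?W = "{-(L+1)..L+1}"
  let ?M = "density lborel (indicator ?W)"
  have fin: "finite_measure ?M"
    using L_pos by (intro finite_measureI) (simp add: emeasure_density emeasure_lborel_Icc_eq)
  have fint: "integrable lborel f"
    using nn_integral_f f_nonneg by (intro integrableI_nonneg) auto
  then have "integrable lborel fA"
    by (rule Bochner_Integration.integrable_bound) (auto split: split_indicator)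
  then have iM: "integrable ?M fA"
    unfolding ennreal_indicator[symmetric] by (subst integrable_density) (auto intro: integrable_real_mult_indicator simp: mult.commute)
  obtain v C where v: "\<And>x y. \<bar>v x - v y\<bar> \<le> C * dist x y" and vi: "integrable ?M v" and d: "(\<integral>x. \<bar>fA x - v x\<bar> \<partial>?M) < \<epsilon> / 4"
    using integrable_lipschitz_approx[OF _ fin iM, of "\<epsilon> / 4"] \<epsilon> by auto
  have [measurable]: "v \<in> borel_measurable borel" by (rule borel_measurable_lipschitz(2)[OF v])
  have "(\<integral>\<^sup>+x. ennreal \<bar>fA x - v x\<bar> * indicator ?W x \<partial>lborel) = (\<integral>\<^sup>+x. ennreal \<bar>fA x - v x\<bar> \<partial>?M)"
    by (subst nn_integral_density) (auto simp: mult.commute)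
  also have "\<dots> = ennreal (\<integral>x. \<bar>fA x - v x\<bar> \<partial>?M)"
    using iM vi by (intro nn_integral_eq_integral) auto
  also have "\<dots> \<le> ennreal (\<epsilon> / 4)" using d by (intro ennreal_leI) auto
  finally have d': "(\<integral>\<^sup>+x. ennreal \<bar>fA x - v x\<bar> * indicator ?W x \<partial>lborel) \<le> ennreal (\<epsilon> / 4)" .
  have "((\<lambda>e. 2 * (\<epsilon> / 4) + e * (\<bar>C\<bar> * (2 * L + 2) + 1)) \<longlongrightarrow> 2 * (\<epsilon> / 4) + 0 * (\<bar>C\<bar> * (2 * L + 2) + 1)) (at_right 0)"
    by (intro tendsto_intros)
  then have "eventually (\<lambda>e. 2 * (\<epsilon> / 4) + e * (\<bar>C\<bar> * (2 * L + 2) + 1) < \<epsilon>) (at_right 0)"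
    by (rule order_tendstoD) (use \<epsilon> in simp)
  moreover have "eventually (\<lambda>e::real. e > 0) (at_right 0)" by (rule eventually_at_right_less)
  ultimately show "eventually (\<lambda>e. dist (deficit e) 0 < \<epsilon>) (at_right 0)"
  proof eventually_elim
    case (elim e)
    have "deficit e \<le> 2 * (\<epsilon> / 4) + e * (\<bar>C\<bar> * (2 * L + 2) + 1)"
      by (rule deficit_le[OF elim(2) _ d']) (use v \<epsilon> in \<open>auto simp: dist_real_def\<close>)
    moreover have "0 \<le> deficit e" unfolding deficit_def using r_bounds[OF elim(2)] by simp
    ultimately show ?case using elim by simp
  qed
qed

text \<open>Uniform integrability: where \<open>\<bar>h\<bar> \<le> n\<close> the integral is at
  most \<open>n\<close> times the deficit, and the tail of \<open>h\<close> is small because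
  \<open>r \<le> 1\<close>. It is applied to \<open>ln f\<close>.\<close>

lemma integral_r_tendsto_0:
  assumes h: "integrable \<mu> h"
  shows "((\<lambda>e. \<integral>x. r e x * \<bar>h x\<bar> \<partial>\<mu>) \<longlongrightarrow> 0) (at_right 0)"
proof (rule tendstoI)
  fix \<epsilon> :: real assume \<epsilon>: "\<epsilon> > 0"
  have hm[measurable]: "h \<in> borel_measurable borel" using h measurable_cong_sets[OF sets_\<mu> refl] by (auto dest: borel_measurable_integrable)
  have "(\<lambda>n. \<integral>x. indicator {x. real n < \<bar>h x\<bar>} x * \<bar>h x\<bar> \<partial>\<mu>) \<longlonglongrightarrow> (\<integral>x. 0 \<partial>\<mu>)"
  proof (rule integral_dominated_convergence[where w="\<lambda>x. \<bar>h x\<bar>"])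
    show "AE x in \<mu>. (\<lambda>n. indicator {x. real n < \<bar>h x\<bar>} x * \<bar>h x\<bar>) \<longlonglongrightarrow> 0"
    proof (rule AE_I2)
      fix x
      obtain N where "\<bar>h x\<bar> \<le> real N" using real_arch_simple by blast
      then have "eventually (\<lambda>n. indicator {x. real n < \<bar>h x\<bar>} x * \<bar>h x\<bar> = 0) sequentially"
        by (intro eventually_sequentiallyI[of N]) auto
      then show "(\<lambda>n. indicator {x. real n < \<bar>h x\<bar>} x * \<bar>h x\<bar>) \<longlonglongrightarrow> 0" by (rule tendsto_eventually)
    qed
  qed (use h in \<open>auto split: split_indicator\<close>)
  then have "eventually (\<lambda>n. (\<integral>x. indicator {x. real n < \<bar>h x\<bar>} x * \<bar>h x\<bar> \<partial>\<mu>) < \<epsilon> / 2) sequentially"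
    using \<epsilon> by (intro order_tendstoD) auto
  then obtain n where n: "(\<integral>x. indicator {x. real n < \<bar>h x\<bar>} x * \<bar>h x\<bar> \<partial>\<mu>) < \<epsilon> / 2"
    using eventually_happens by fastforce
  have "((\<lambda>e. real n * deficit e) \<longlongrightarrow> real n * 0) (at_right 0)" by (intro tendsto_intros deficit_tendsto_0)
  then have "eventually (\<lambda>e. real n * deficit e < \<epsilon> / 2) (at_right 0)"
    by (rule order_tendstoD) (use \<epsilon> in simp)
  moreover have "eventually (\<lambda>e::real. e > 0) (at_right 0)" by (rule eventually_at_right_less)
  ultimately show "eventually (\<lambda>e. dist (\<integral>x. r e x * \<bar>h x\<bar> \<partial>\<mu>) 0 < \<epsilon>) (at_right 0)"
  proof eventually_elim
    case (elim e)
    note rb = r_bounds[OF elim(2)]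
    have i1: "integrable \<mu> (\<lambda>x. indicator {x. real n < \<bar>h x\<bar>} x * \<bar>h x\<bar>)"
      by (rule Bochner_Integration.integrable_bound[OF h]) (auto split: split_indicator)
    have i2: "integrable \<mu> (\<lambda>x. r e x * \<bar>h x\<bar>)"
      by (rule Bochner_Integration.integrable_bound[OF h]) (use rb in \<open>auto simp: abs_mult intro!: mult_left_le_one_le\<close>)
    have "(\<integral>x. r e x * \<bar>h x\<bar> \<partial>\<mu>) \<le> (\<integral>x. real n * r e x + indicator {x. real n < \<bar>h x\<bar>} x * \<bar>h x\<bar> \<partial>\<mu>)"
    proof (rule integral_mono[OF i2])
      show "integrable \<mu> (\<lambda>x. real n * r e x + indicator {x. real n < \<bar>h x\<bar>} x * \<bar>h x\<bar>)"
        using i1 r_integrable[OF elim(2)] by auto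
      show "r e x * \<bar>h x\<bar> \<le> real n * r e x + indicator {x. real n < \<bar>h x\<bar>} x * \<bar>h x\<bar>" for x
      proof (cases "real n < \<bar>h x\<bar>")
        case True
        then have "r e x * \<bar>h x\<bar> \<le> \<bar>h x\<bar>" using rb[of x] by (intro mult_left_le_one_le) auto
        moreover have "0 \<le> real n * r e x" using rb(1)[of x] by simp
        ultimately show ?thesis using True by simp
      next
        case False
        then have "r e x * \<bar>h x\<bar> \<le> r e x * real n" using rb(1)[of x] by (intro mult_left_mono) auto
        then show ?thesis using False by (simp add: mult.commute)
      qed
    qed
    also have "\<dots> = real n * deficit e + (\<integral>x. indicator {x. real n < \<bar>h x\<bar>} x * \<bar>h x\<bar> \<partial>\<mu>)"
      using i1 r_integrable[OF elim(2)] by (simp add: deficit_def)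
    also have "\<dots> < \<epsilon>" using n elim by simp
    finally have "(\<integral>x. r e x * \<bar>h x\<bar> \<partial>\<mu>) < \<epsilon>" .
    moreover have "0 \<le> (\<integral>x. r e x * \<bar>h x\<bar> \<partial>\<mu>)" using rb by simp
    ultimately show ?case by simp
  qed
qed

end

section \<open>Coupling the missing mass on blocks of length \<open>e\<close>\<close>

context line_optimal
begin

definition R :: "real \<Rightarrow> int \<Rightarrow> real" where
  "R e k = (\<integral>x. (if \<lfloor>x / e\<rfloor> = k then r e x else 0) \<partial>\<mu>)"

text \<open>Normalised product of the missing mass with itself inside each block. In a block with
  nothing missing the quotient is 0 by convention.\<close>

definition b :: "real \<Rightarrow> real \<Rightarrow> real \<Rightarrow> real" where
  "b e x y = (if \<lfloor>x / e\<rfloor> = \<lfloor>y / e\<rfloor> then r e x * r e y / R e \<lfloor>x / e\<rfloor> else 0)"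

lemma R_measurable[measurable]: "(\<lambda>x. R e \<lfloor>x / e\<rfloor>) \<in> borel_measurable borel"
  by (rule measurable_compose[of "\<lambda>x. \<lfloor>x / e\<rfloor>" borel "count_space UNIV" "R e"]) auto

lemma b_measurable[measurable (raw)]:
  assumes [measurable]: "g \<in> borel_measurable M" "h \<in> borel_measurable M"
  shows "(\<lambda>x. b e (g x) (h x)) \<in> borel_measurable M"
proof -
  have [measurable]: "(\<lambda>x. R e \<lfloor>g x / e\<rfloor>) \<in> borel_measurable M"
    using measurable_compose[OF assms(1) R_measurable[of e]] by simp
  show ?thesis unfolding b_def by measurable
qed

lemma R_nonneg: "0 < e \<Longrightarrow> 0 \<le> R e k"
  unfolding R_def using r_bounds[of e] by (intro Bochner_Integration.integral_nonneg) auto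

lemma b_nonneg: "0 < e \<Longrightarrow> 0 \<le> b e x y"
  using r_bounds[of e] R_nonneg[of e] by (simp add: b_def)

lemma b_commute: "b e x y = b e y x"
  by (simp add: b_def mult.commute)

lemma nn_integral_block:
  assumes e: "0 < e"
  shows "(\<integral>\<^sup>+x. ennreal (if \<lfloor>x / e\<rfloor> = k then r e x else 0) \<partial>\<mu>) = ennreal (R e k)"
    "(\<integral>\<^sup>+x. ennreal (if \<lfloor>x / e\<rfloor> = k then r e x else 0) \<partial>\<nu>) = ennreal (R e k)"
proof -
  have "integrable \<mu> (\<lambda>x. if \<lfloor>x / e\<rfloor> = k then r e x else 0)"
    by (rule \<mu>.integrable_const_bound[where B=1]) (use r_bounds[OF e] in auto)
  then show 1: "(\<integral>\<^sup>+x. ennreal (if \<lfloor>x / e\<rfloor> = k then r e x else 0) \<partial>\<mu>) = ennreal (R e k)"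
    unfolding R_def by (rule nn_integral_eq_integral) (use r_bounds[OF e] in auto)
  have *: "ennreal (if \<lfloor>x / e\<rfloor> = k then r e x else 0) = ennreal (if \<lfloor>x / e\<rfloor> = k then r e x else 0) * indicator A x" for x
    by (simp add: r_def indicator_def)
  show "(\<integral>\<^sup>+x. ennreal (if \<lfloor>x / e\<rfloor> = k then r e x else 0) \<partial>\<nu>) = ennreal (R e k)"
    unfolding 1[symmetric] by (subst (1 2) *, rule nn_integral_A_eq[symmetric]) measurable
qed

text \<open>A block of total 0 has \<open>r = 0\<close> almost everywhere in it, and there are
  countably many blocks. Hence the division by zero in \<open>b\<close> loses no mass.\<close>

lemma AE_R_zero:
  assumes e: "0 < e"
  shows "AE x in \<mu>. R e \<lfloor>x / e\<rfloor> = 0 \<longrightarrow> r e x = 0"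
proof -
  have "AE x in \<mu>. R e k = 0 \<longrightarrow> \<lfloor>x / e\<rfloor> = k \<longrightarrow> r e x = 0" for k
  proof (cases "R e k = 0")
    case True
    then have "(\<integral>\<^sup>+x. ennreal (if \<lfloor>x / e\<rfloor> = k then r e x else 0) \<partial>\<mu>) = 0"
      unfolding nn_integral_block[OF e] by simp
    then have "AE x in \<mu>. ennreal (if \<lfloor>x / e\<rfloor> = k then r e x else 0) = 0"
      by (subst (asm) nn_integral_0_iff_AE) auto
    then show ?thesis
      by eventually_elim (use r_bounds(1)[OF e] in \<open>auto simp: ennreal_eq_0_iff split: if_splits intro: antisym\<close>)
  qed simp
  then have "AE x in \<mu>. \<forall>k. R e k = 0 \<longrightarrow> \<lfloor>x / e\<rfloor> = k \<longrightarrow> r e x = 0"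
    unfolding AE_all_countable by blast
  then show ?thesis by eventually_elim blast
qed

lemma nn_integral_b_eq:
  assumes e: "0 < e" and x: "R e \<lfloor>x / e\<rfloor> = 0 \<longrightarrow> r e x = 0"
  shows "(\<integral>\<^sup>+y. ennreal (b e x y) \<partial>\<nu>) = ennreal (r e x)" "(\<integral>\<^sup>+y. ennreal (b e x y) \<partial>\<mu>) = ennreal (r e x)"
proof -
  let ?k = "\<lfloor>x / e\<rfloor>"
  have *: "ennreal (b e x y) = ennreal (r e x / R e ?k) * ennreal (if \<lfloor>y / e\<rfloor> = ?k then r e y else 0)" for y
    using r_bounds[OF e] R_nonneg[OF e] by (auto simp: b_def ennreal_mult[symmetric])
  have v: "ennreal (r e x / R e ?k) * ennreal (R e ?k) = ennreal (r e x)"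
    using x r_bounds[OF e] R_nonneg[OF e] by (cases "R e ?k = 0") (auto simp: ennreal_mult[symmetric])
  show "(\<integral>\<^sup>+y. ennreal (b e x y) \<partial>\<nu>) = ennreal (r e x)"
    unfolding * by (subst nn_integral_cmult) (simp_all add: nn_integral_block[OF e] v)
  show "(\<integral>\<^sup>+y. ennreal (b e x y) \<partial>\<mu>) = ennreal (r e x)"
    unfolding * by (subst nn_integral_cmult) (simp_all add: nn_integral_block[OF e] v)
qed

lemma nn_integral_b:
  assumes e: "0 < e"
  shows "AE x in \<mu>. (\<integral>\<^sup>+y. ennreal (b e x y) \<partial>\<nu>) = ennreal (r e x)"
    "AE y in \<nu>. (\<integral>\<^sup>+x. ennreal (b e x y) \<partial>\<mu>) = ennreal (r e y)"
proof -
  show "AE x in \<mu>. (\<integral>\<^sup>+y. ennreal (b e x y) \<partial>\<nu>) = ennreal (r e x)"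
    using AE_R_zero[OF e] by eventually_elim (rule nn_integral_b_eq[OF e])
  have "AE y in \<nu>. y \<in> A \<longrightarrow> (R e \<lfloor>y / e\<rfloor> = 0 \<longrightarrow> r e y = 0)"
    by (rule AE_A_transfer) (use AE_R_zero[OF e] in \<open>auto elim: eventually_mono\<close>)
  then show "AE y in \<nu>. (\<integral>\<^sup>+x. ennreal (b e x y) \<partial>\<mu>) = ennreal (r e y)"
  proof eventually_elim
    case (elim y)
    then have "R e \<lfloor>y / e\<rfloor> = 0 \<longrightarrow> r e y = 0" by (cases "y \<in> A") (auto simp: r_def)
    then show ?case unfolding b_commute[of e _ y] by (rule nn_integral_b_eq[OF e])
  qed
qed

definition s :: "real \<Rightarrow> real \<Rightarrow> real \<Rightarrow> real" where "s e x y = q e x y + b e x y"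

lemma s_measurable[measurable (raw)]:
  assumes [measurable]: "g \<in> borel_measurable M" "h \<in> borel_measurable M"
  shows "(\<lambda>x. s e (g x) (h x)) \<in> borel_measurable M"
  unfolding s_def by measurable

lemma s_nonneg: "0 < e \<Longrightarrow> 0 \<le> s e x y"
  using q_nonneg[of e x y] b_nonneg[of e x y] by (simp add: s_def)

lemma s_outside: "\<not> (x \<in> A \<and> y \<in> A) \<Longrightarrow> q e x y = 0" "\<not> (x \<in> A \<and> y \<in> A) \<Longrightarrow> b e x y = 0"
  "\<not> (x \<in> A \<and> y \<in> A) \<Longrightarrow> s e x y = 0"
  by (auto simp: s_def q_def b_def r_def)

text \<open>\<open>p + r\<close> is the indicator of \<open>A\<close>: the block part restores
  exactly what \<open>q\<close> loses, in both marginals.\<close>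

lemma nn_integral_s:
  assumes e: "0 < e"
  shows "AE x in \<mu>. (\<integral>\<^sup>+y. ennreal (s e x y) \<partial>\<nu>) = ennreal (indicator A x)"
    "AE y in \<nu>. (\<integral>\<^sup>+x. ennreal (s e x y) \<partial>\<mu>) = ennreal (indicator A y)"
proof -
  have *: "p e x + r e x = indicator A x" for x by (auto simp: r_def p_outside split: split_indicator)
  note pr = p_bounds(1)[OF e] r_bounds(1)[OF e]
  show "AE x in \<mu>. (\<integral>\<^sup>+y. ennreal (s e x y) \<partial>\<nu>) = ennreal (indicator A x)"
    using nn_integral_b(1)[OF e]
  proof eventually_elim
    case (elim x)
    have "(\<integral>\<^sup>+y. ennreal (s e x y) \<partial>\<nu>) = (\<integral>\<^sup>+y. ennreal (q e x y) + ennreal (b e x y) \<partial>\<nu>)"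
      using q_nonneg[OF e] b_nonneg[OF e] by (simp add: s_def)
    also have "\<dots> = ennreal (p e x) + ennreal (r e x)"
      by (subst nn_integral_add) (auto simp: nn_integral_q[OF e] elim)
    finally show ?case using pr by (simp add: ennreal_plus[symmetric] * del: ennreal_plus)
  qed
  show "AE y in \<nu>. (\<integral>\<^sup>+x. ennreal (s e x y) \<partial>\<mu>) = ennreal (indicator A y)"
    using nn_integral_b(2)[OF e]
  proof eventually_elim
    case (elim y)
    have "(\<integral>\<^sup>+x. ennreal (s e x y) \<partial>\<mu>) = (\<integral>\<^sup>+x. ennreal (q e x y) + ennreal (b e x y) \<partial>\<mu>)"
      using q_nonneg[OF e] b_nonneg[OF e] by (simp add: s_def)
    also have "\<dots> = ennreal (p e y) + ennreal (r e y)"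
      by (subst nn_integral_add) (auto simp: nn_integral_q[OF e] elim)
    finally show ?case using pr by (simp add: ennreal_plus[symmetric] * del: ennreal_plus)
  qed
qed

lemma nn_kernel_fst:
  assumes [measurable]: "(\<lambda>z. \<kappa> (fst z) (snd z)) \<in> borel_measurable (borel \<Otimes>\<^sub>M borel)" "\<Theta> \<in> borel_measurable borel"
    and P: "AE x in \<mu>. (\<integral>\<^sup>+y. ennreal (\<kappa> x y) \<partial>\<nu>) = P x"
  shows "(\<integral>\<^sup>+z. ennreal (\<kappa> (fst z) (snd z)) * \<Theta> (fst z) \<partial>\<rho>) = (\<integral>\<^sup>+x. P x * \<Theta> x \<partial>\<mu>)"
proof -
  have [measurable]: "(\<lambda>y. \<kappa> x y) \<in> borel_measurable borel" for x
    using measurable_compose[OF measurable_Pair1' assms(1), of x] by simp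
  have "(\<integral>\<^sup>+z. ennreal (\<kappa> (fst z) (snd z)) * \<Theta> (fst z) \<partial>\<rho>)
    = (\<integral>\<^sup>+x. \<integral>\<^sup>+y. ennreal (\<kappa> x y) * \<Theta> x \<partial>\<nu> \<partial>\<mu>)"
    using \<nu>.nn_integral_fst[of "\<lambda>z. ennreal (\<kappa> (fst z) (snd z)) * \<Theta> (fst z)" \<mu>] by simp
  also have "\<dots> = (\<integral>\<^sup>+x. (\<integral>\<^sup>+y. ennreal (\<kappa> x y) \<partial>\<nu>) * \<Theta> x \<partial>\<mu>)"
    by (intro nn_integral_cong nn_integral_multc) simp
  also have "\<dots> = (\<integral>\<^sup>+x. P x * \<Theta> x \<partial>\<mu>)"
    by (rule nn_integral_cong_AE, use P in eventually_elim, simp only:)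
  finally show ?thesis .
qed

lemma nn_kernel_snd:
  assumes [measurable]: "(\<lambda>z. \<kappa> (fst z) (snd z)) \<in> borel_measurable (borel \<Otimes>\<^sub>M borel)" "\<Theta> \<in> borel_measurable borel"
    and P: "AE y in \<nu>. (\<integral>\<^sup>+x. ennreal (\<kappa> x y) \<partial>\<mu>) = P y"
  shows "(\<integral>\<^sup>+z. ennreal (\<kappa> (fst z) (snd z)) * \<Theta> (snd z) \<partial>\<rho>) = (\<integral>\<^sup>+y. P y * \<Theta> y \<partial>\<nu>)"
proof -
  have [measurable]: "(\<lambda>x. \<kappa> x y) \<in> borel_measurable borel" for y
    using measurable_compose[OF measurable_Pair2' assms(1), of y] by simp
  have "(\<integral>\<^sup>+z. ennreal (\<kappa> (fst z) (snd z)) * \<Theta> (snd z) \<partial>\<rho>)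
    = (\<integral>\<^sup>+y. \<integral>\<^sup>+x. ennreal (\<kappa> x y) * \<Theta> y \<partial>\<mu> \<partial>\<nu>)"
    using \<mu>\<nu>.nn_integral_snd[of "\<lambda>z. ennreal (\<kappa> (fst z) (snd z)) * \<Theta> (snd z)"] by simp
  also have "\<dots> = (\<integral>\<^sup>+y. (\<integral>\<^sup>+x. ennreal (\<kappa> x y) \<partial>\<mu>) * \<Theta> y \<partial>\<nu>)"
    by (intro nn_integral_cong nn_integral_multc) simp
  also have "\<dots> = (\<integral>\<^sup>+y. P y * \<Theta> y \<partial>\<nu>)"
    by (rule nn_integral_cong_AE, use P in eventually_elim, simp only:)
  finally show ?thesis .
qed

text \<open>Signed version, for \<open>ln f\<close> and the reciprocals of \<open>f\<close> and
  \<open>R\<close> in the entropy estimate; all of them depend on the first coordinate only and need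
  not be bounded.\<close>

lemma kernel_integral:
  assumes \<kappa>[measurable]: "(\<lambda>z. \<kappa> (fst z) (snd z)) \<in> borel_measurable (borel \<Otimes>\<^sub>M borel)" and \<kappa>0: "\<And>x y. 0 \<le> \<kappa> x y"
    and [measurable]: "\<Theta> \<in> borel_measurable borel" "P \<in> borel_measurable borel" and P0: "\<And>x. 0 \<le> P x"
    and P: "AE x in \<mu>. (\<integral>\<^sup>+y. ennreal (\<kappa> x y) \<partial>\<nu>) = ennreal (P x)"
    and i: "integrable \<mu> (\<lambda>x. P x * \<Theta> x)"
  shows "integrable \<rho> (\<lambda>z. \<kappa> (fst z) (snd z) * \<Theta> (fst z))"
    "(\<integral>z. \<kappa> (fst z) (snd z) * \<Theta> (fst z) \<partial>\<rho>) = (\<integral>x. P x * \<Theta> x \<partial>\<mu>)"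
proof -
  have m[measurable]: "(\<lambda>y. \<kappa> x y) \<in> borel_measurable borel" for x
    using measurable_compose[OF measurable_Pair1' \<kappa>, of x] by simp
  have "(\<integral>\<^sup>+z. ennreal (norm (\<kappa> (fst z) (snd z) * \<Theta> (fst z))) \<partial>\<rho>)
    = (\<integral>\<^sup>+z. ennreal (\<kappa> (fst z) (snd z)) * ennreal \<bar>\<Theta> (fst z)\<bar> \<partial>\<rho>)"
    using \<kappa>0 by (intro nn_integral_cong) (simp add: abs_mult ennreal_mult)
  also have "\<dots> = (\<integral>\<^sup>+x. ennreal (P x) * ennreal \<bar>\<Theta> x\<bar> \<partial>\<mu>)"
    by (rule nn_kernel_fst[OF _ _ P]) auto
  also have "\<dots> = (\<integral>\<^sup>+x. ennreal (norm (P x * \<Theta> x)) \<partial>\<mu>)"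
    using P0 by (intro nn_integral_cong) (simp add: abs_mult ennreal_mult)
  also have "\<dots> < \<infinity>" using i by (simp add: integrable_iff_bounded)
  finally show int: "integrable \<rho> (\<lambda>z. \<kappa> (fst z) (snd z) * \<Theta> (fst z))"
    by (intro integrableI_bounded) auto
  have "(\<integral>z. \<kappa> (fst z) (snd z) * \<Theta> (fst z) \<partial>\<rho>) = (\<integral>x. \<integral>y. \<kappa> x y * \<Theta> x \<partial>\<nu> \<partial>\<mu>)"
    using \<mu>\<nu>.integral_fst'[OF int] by simp
  also have "\<dots> = (\<integral>x. P x * \<Theta> x \<partial>\<mu>)"
  proof (rule integral_cong_AE)
    show "AE x in \<mu>. (\<integral>y. \<kappa> x y * \<Theta> x \<partial>\<nu>) = P x * \<Theta> x"
      using P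
    proof eventually_elim
      case (elim x)
      have "(\<integral>y. \<kappa> x y \<partial>\<nu>) = P x"
        using \<kappa>0 elim P0 by (subst integral_eq_nn_integral) auto
      then show ?case by simp
    qed
    have "(\<lambda>z. \<kappa> (fst z) (snd z) * \<Theta> (fst z)) \<in> borel_measurable (\<mu> \<Otimes>\<^sub>M \<nu>)" by measurable
    then have "(\<lambda>(x, y). \<kappa> x y * \<Theta> x) \<in> borel_measurable (\<mu> \<Otimes>\<^sub>M \<nu>)" by (simp add: case_prod_beta')
    then show "(\<lambda>x. \<integral>y. \<kappa> x y * \<Theta> x \<partial>\<nu>) \<in> borel_measurable \<mu>"
      by (rule \<nu>.borel_measurable_lebesgue_integral)
  qed auto
  finally show "(\<integral>z. \<kappa> (fst z) (snd z) * \<Theta> (fst z) \<partial>\<rho>) = (\<integral>x. P x * \<Theta> x \<partial>\<mu>)" .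
qed

lemma q_le: "0 < e \<Longrightarrow> 0 < f x \<Longrightarrow> q e x y \<le> laplace e (x - y) / f x"
proof -
  assume a: "0 < e" "0 < f x"
  have "q e x y \<le> laplace e (x - y) / max (f x) (f y)"
    unfolding q_def using a laplace_nonneg[OF a(1)]
    by (intro divide_right_mono) (auto split: split_indicator)
  also have "\<dots> \<le> laplace e (x - y) / f x"
    using a laplace_nonneg[OF a(1)] by (intro divide_left_mono) auto
  finally show ?thesis .
qed

lemma same_block_dist:
  fixes x y e :: real
  assumes "0 < e" "\<lfloor>x / e\<rfloor> = \<lfloor>y / e\<rfloor>" shows "\<bar>y - x\<bar> \<le> e"
proof -
  have "\<bar>v - u\<bar> \<le> 1" if "\<lfloor>u\<rfloor> = \<lfloor>v\<rfloor>" for u v :: real using that by linarith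
  from this[OF assms(2)] have "\<bar>y / e - x / e\<bar> \<le> 1" .
  then have "\<bar>(y - x) / e\<bar> \<le> 1" by (simp add: diff_divide_distrib)
  then show ?thesis using assms(1) by (simp add: abs_divide)
qed

lemma b_dist_le: "0 < e \<Longrightarrow> b e x y * \<bar>y - x\<bar> \<le> b e x y * e"
  using mult_left_mono[OF same_block_dist[of e x y] b_nonneg[of e x y]]
  by (cases "\<lfloor>x / e\<rfloor> = \<lfloor>y / e\<rfloor>") (simp_all add: b_def)

text \<open>Both densities are bounded by a quantity depending on \<open>x\<close> only, so the logarithm of \<open>b\<close> is controlled
  by its tangent at \<open>1 / \<eta>\<close>.\<close>

lemma s_entropy_bound:
  assumes e: "0 < e" and \<eta>: "0 < \<eta>" and fx: "0 < f x"
  shows "s e x y * ln (s e x y) + s e x y * \<bar>y - x\<bar> / e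
    \<le> - ln (2 * e) * s e x y - q e x y * ln (f x)
      + b e x y * (1 + \<eta> / f x + 2 * \<eta> * e / R e \<lfloor>x / e\<rfloor> - ln \<eta>)"
proof (cases "x \<in> A \<and> y \<in> A")
  case False
  then show ?thesis by (simp add: s_outside)
next
  case True
  let ?q = "q e x y" and ?b = "b e x y" and ?R = "R e \<lfloor>x / e\<rfloor>"
  \<comment> \<open>\<open>Z / (2 * e)\<close> bounds \<open>q + b\<close>, from
    \<open>q \<le> 1 / (2 * e * f x)\<close> and \<open>b \<le> 1 / R\<close>. Pulling out
    \<open>2 * e\<close> gives the block part the same factor \<open>- ln (2 * e)\<close> per unit
    of mass as \<open>q\<close>.\<close>
  define Z where "Z = 1 / f x + 2 * e / ?R"
  have q: "0 < ?q" using True fx laplace_pos[OF e] by (auto simp: q_def less_max_iff_disj)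
  have b: "0 \<le> ?b" by (rule b_nonneg[OF e])
  \<comment> \<open>Adding \<open>b\<close> under the logarithm costs at most \<open>b\<close>, by
    \<open>ln (1 + t) \<le> t\<close> at \<open>t = b / q\<close>.\<close>
  have h1: "?q * ln (?q + ?b) \<le> ?q * ln ?q + ?b"
  proof -
    have "ln (?q + ?b) = ln (?q * (1 + ?b / ?q))" using q by (simp add: distrib_left)
    also have "\<dots> = ln ?q + ln (1 + ?b / ?q)" using q b by (intro ln_mult_pos) (auto intro: add_pos_nonneg)
    also have "\<dots> \<le> ln ?q + ?b / ?q" using q b by (intro add_left_mono ln_add_one_self_le_self) auto
    finally have "?q * ln (?q + ?b) \<le> ?q * (ln ?q + ?b / ?q)" using q by (intro mult_left_mono) auto
    then show ?thesis using q by (simp add: distrib_left)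
  qed
  have h2: "?q * ln ?q \<le> ?q * (- \<bar>y - x\<bar> / e - ln (2 * e) - ln (f x))"
  proof -
    have "ln ?q \<le> ln (laplace e (x - y) / f x)" using q_le[OF e fx, of y] q by (subst ln_le_cancel_iff) auto
    also have "\<dots> = - \<bar>y - x\<bar> / e - ln (2 * e) - ln (f x)"
      using e fx ln_mult_pos[of "2 * e" "f x"] by (simp add: laplace_def ln_div abs_minus_commute)
    finally show ?thesis using q by (intro mult_left_mono) auto
  qed
  have h3: "?b * ln (?q + ?b) \<le> ?b * (- ln (2 * e) + \<eta> * Z - 1 - ln \<eta>)"
  proof (cases "?b = 0")
    case False
    then have R: "0 < ?R" using R_nonneg[OF e, of "\<lfloor>x / e\<rfloor>"] by (auto simp: b_def less_le split: if_splits)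
    have "exp (- \<bar>x - y\<bar> / e) \<le> 1" using e by simp
    then have "laplace e (x - y) / f x \<le> 1 / (2 * e) / f x"
      unfolding laplace_def using e fx by (intro divide_right_mono) auto
    then have "?q \<le> 1 / (2 * e) / f x" using q_le[OF e fx, of y] by linarith
    moreover have "r e x * r e y \<le> 1 * 1" using r_bounds[OF e] by (intro mult_mono) auto
    then have "?b \<le> 1 / ?R" using R by (auto simp: b_def intro!: divide_right_mono)
    moreover have "1 / (2 * e) / f x + 1 / ?R = Z / (2 * e)"
      using e fx R by (simp add: Z_def field_simps)
    ultimately have "?q + ?b \<le> Z / (2 * e)" by linarith
    moreover have Z: "Z > 0" using e fx R by (auto simp: Z_def intro!: add_pos_pos)
    ultimately have "ln (?q + ?b) \<le> ln (Z / (2 * e))"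
      using q b e by (subst ln_le_cancel_iff) (auto intro: add_pos_nonneg)
    also have "\<dots> = ln Z - ln (2 * e)" using Z e by (simp add: ln_div)
    also have "ln Z = ln (\<eta> * Z) - ln \<eta>" using Z \<eta> by (simp add: ln_mult)
    also have "ln (\<eta> * Z) \<le> \<eta> * Z - 1" using Z \<eta> by (intro ln_le_minus_one) auto
    finally have "ln (?q + ?b) \<le> - ln (2 * e) + \<eta> * Z - 1 - ln \<eta>" by simp
    then show ?thesis using b by (intro mult_left_mono) auto
  qed simp
  have h4: "?b * \<bar>y - x\<bar> / e \<le> ?b" using b_dist_le[OF e, of x y] e by (simp add: field_simps)
  have "s e x y * ln (s e x y) + s e x y * \<bar>y - x\<bar> / e
    = ?q * ln (?q + ?b) + ?b * ln (?q + ?b) + ?q * (\<bar>y - x\<bar> / e) + ?b * \<bar>y - x\<bar> / e"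
    by (simp add: s_def algebra_simps add_divide_distrib)
  also have "\<dots> \<le> (?q * (- \<bar>y - x\<bar> / e - ln (2 * e) - ln (f x)) + ?b) + ?b * (- ln (2 * e) + \<eta> * Z - 1 - ln \<eta>)
    + ?q * (\<bar>y - x\<bar> / e) + ?b"
    using h1 h2 h3 h4 by linarith
  \<comment> \<open>The distance in the exponent of the kernel cancels the transport cost of
    \<open>q\<close>. The constant 1 collects \<open>+ 1\<close> from \<open>h1\<close>,
    \<open>- 1\<close> from the tangent and \<open>+ 1\<close> from the cost inside a block.\<close>
  also have "\<dots> = - ln (2 * e) * s e x y - ?q * ln (f x) + ?b * (1 + \<eta> * Z - ln \<eta>)"
    by (simp add: s_def algebra_simps)
  also have "\<eta> * Z = \<eta> / f x + 2 * \<eta> * e / ?R" by (simp add: Z_def algebra_simps)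
  finally show ?thesis by (simp add: add.assoc)
qed

text \<open>Against \<open>\<mu>\<close> the factor \<open>1 / f\<close> leaves Lebesgue measure, so
  the integral is at most the length of the window.\<close>

lemma integral_r_over_f:
  assumes e: "0 < e"
  shows "integrable \<mu> (\<lambda>x. r e x * (1 / f x))" "(\<integral>x. r e x * (1 / f x) \<partial>\<mu>) \<le> 2 * L"
proof -
  have pos: "0 \<le> r e x * (1 / f x)" for x using r_bounds[OF e] f_nonneg by simp
  have "(\<integral>\<^sup>+x. ennreal (r e x * (1 / f x)) \<partial>\<mu>) = (\<integral>\<^sup>+x. ennreal (f x) * ennreal (r e x * (1 / f x)) \<partial>lborel)"
    by (rule nn_integral_\<mu>) simp
  also have "\<dots> \<le> (\<integral>\<^sup>+x. indicator {-L..L} x \<partial>lborel)"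
  proof (rule nn_integral_mono_AE, use AE_f_bound in eventually_elim)
    case (elim x)
    show ?case
    proof (cases "f x = 0")
      case False
      then have "f x > 0" using f_nonneg[of x] by simp
      then show ?thesis using elim r_bounds[OF e, of x]
        by (auto simp: ennreal_mult[symmetric] abs_le_iff split: split_indicator)
    qed simp
  qed
  also have "\<dots> = ennreal (2 * L)" using L_pos by simp
  finally have le: "(\<integral>\<^sup>+x. ennreal (r e x * (1 / f x)) \<partial>\<mu>) \<le> ennreal (2 * L)" .
  then show "integrable \<mu> (\<lambda>x. r e x * (1 / f x))"
    using pos by (intro integrableI_nonneg) (auto intro: le_less_trans)
  show "(\<integral>x. r e x * (1 / f x) \<partial>\<mu>) \<le> 2 * L"
    using le pos L_pos by (subst integral_eq_nn_integral) (auto intro!: enn2real_leI)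
qed

text \<open>Each block contributes at most \<open>R / R = 1\<close>, so the integral is bounded by
  the number of blocks meeting the window; each of the two end blocks may be partial, whence the
  \<open>+ 2\<close>. The factor \<open>e\<close> in front of \<open>1 / R\<close> in the entropy
  estimate absorbs this growth.\<close>

lemma integral_r_over_R:
  assumes e: "0 < e"
  shows "integrable \<mu> (\<lambda>x. r e x * (1 / R e \<lfloor>x / e\<rfloor>))" "(\<integral>x. r e x * (1 / R e \<lfloor>x / e\<rfloor>) \<partial>\<mu>) \<le> 2 * L / e + 2"
proof -
  define S where "S = {\<lfloor>- L / e\<rfloor>..\<lfloor>L / e\<rfloor>}"
  have pos: "0 \<le> r e x * (1 / R e \<lfloor>x / e\<rfloor>)" for x using r_bounds[OF e] R_nonneg[OF e] by simp
  have "\<lfloor>- L / e\<rfloor> \<le> \<lfloor>L / e\<rfloor>" using L_pos e by (intro floor_mono divide_right_mono) auto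
  then have "real (card S) = of_int \<lfloor>L / e\<rfloor> - of_int \<lfloor>- (L / e)\<rfloor> + 1" by (simp add: S_def)
  moreover have "of_int \<lfloor>L / e\<rfloor> \<le> L / e" "- (L / e) < of_int \<lfloor>- (L / e)\<rfloor> + 1" by linarith+
  ultimately have "real (card S) \<le> 2 * (L / e) + 2" by linarith
  then have card: "real (card S) \<le> 2 * L / e + 2" by simp
  have "(\<integral>\<^sup>+x. ennreal (r e x * (1 / R e \<lfloor>x / e\<rfloor>)) \<partial>\<mu>)
    \<le> (\<integral>\<^sup>+x. (\<Sum>k\<in>S. ennreal (1 / R e k) * ennreal (if \<lfloor>x / e\<rfloor> = k then r e x else 0)) \<partial>\<mu>)"
  proof (rule nn_integral_mono_AE, use AE_\<mu> in eventually_elim)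
    case (elim x)
    then have "- L / e \<le> x / e" "x / e \<le> L / e"
      using e divide_right_mono[of "- L" x e] divide_right_mono[of x L e] by (auto simp: abs_le_iff)
    then have "\<lfloor>x / e\<rfloor> \<in> S" by (auto simp: S_def intro!: floor_mono)
    then have "ennreal (1 / R e \<lfloor>x / e\<rfloor>) * ennreal (if \<lfloor>x / e\<rfloor> = \<lfloor>x / e\<rfloor> then r e x else 0)
      \<le> (\<Sum>k\<in>S. ennreal (1 / R e k) * ennreal (if \<lfloor>x / e\<rfloor> = k then r e x else 0))"
      by (intro member_le_sum) (auto simp: S_def)
    then show ?case using r_bounds[OF e, of x] R_nonneg[OF e] by (simp add: ennreal_mult[symmetric])
  qed
  also have "\<dots> = (\<Sum>k\<in>S. ennreal (1 / R e k) * ennreal (R e k))"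
    by (subst nn_integral_sum) (auto simp: nn_integral_cmult nn_integral_block[OF e])
  also have "\<dots> \<le> (\<Sum>k\<in>S. 1)"
    using R_nonneg[OF e] by (intro sum_mono) (auto simp: ennreal_mult[symmetric])
  also have "\<dots> = ennreal (real (card S))" by (simp add: ennreal_of_nat_eq_real_of_nat)
  also have "\<dots> \<le> ennreal (2 * L / e + 2)" using card by (rule ennreal_leI)
  finally have le: "(\<integral>\<^sup>+x. ennreal (r e x * (1 / R e \<lfloor>x / e\<rfloor>)) \<partial>\<mu>) \<le> ennreal (2 * L / e + 2)" .
  then show "integrable \<mu> (\<lambda>x. r e x * (1 / R e \<lfloor>x / e\<rfloor>))"
    using pos by (intro integrableI_nonneg) (auto intro: le_less_trans)
  show "(\<integral>x. r e x * (1 / R e \<lfloor>x / e\<rfloor>) \<partial>\<mu>) \<le> 2 * L / e + 2"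
    using le pos L_pos e by (subst integral_eq_nn_integral) (auto intro!: enn2real_leI add_nonneg_nonneg)
qed

text \<open>One \<open>e\<close> is the first moment of the kernel, the other is the length of a
  block.\<close>

lemma integral_s_dist:
  assumes e: "0 < e"
  shows "integrable \<rho> (\<lambda>z. s e (fst z) (snd z) * \<bar>snd z - fst z\<bar>)"
    "(\<integral>z. s e (fst z) (snd z) * \<bar>snd z - fst z\<bar> \<partial>\<rho>) \<le> 2 * e"
proof -
  have pos: "0 \<le> s e x y * \<bar>y - x\<bar>" for x y using s_nonneg[OF e] by simp
  have "(\<integral>\<^sup>+y. ennreal (q e x y * \<bar>y - x\<bar>) \<partial>\<nu>) \<le> ennreal e" for x
  proof -
    have *: "ennreal (q e x y * \<bar>y - x\<bar>) = ennreal (q e x y * \<bar>y - x\<bar>) * indicator A y" for y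
      by (auto simp: q_def split: split_indicator)
    have "(\<integral>\<^sup>+y. ennreal (q e x y * \<bar>y - x\<bar>) \<partial>\<nu>) = (\<integral>\<^sup>+y. ennreal (q e x y * \<bar>y - x\<bar>) \<partial>\<mu>)"
      by (subst (1 2) *, rule nn_integral_A_eq[symmetric]) measurable
    also have "\<dots> = (\<integral>\<^sup>+y. ennreal (f y) * ennreal (q e x y * \<bar>y - x\<bar>) \<partial>lborel)"
      by (rule nn_integral_\<mu>) measurable
    also have "\<dots> \<le> (\<integral>\<^sup>+y. ennreal (laplace e (y - x) * \<bar>y - x\<bar>) \<partial>lborel)"
    proof (rule nn_integral_mono)
      fix y
      have "f y * (q e x y * \<bar>y - x\<bar>) \<le> laplace e (y - x) * \<bar>y - x\<bar>"
        using mult_right_mono[OF density_q_le[OF e, of y x], of "\<bar>y - x\<bar>"]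
        by (simp add: laplace_minus_commute[of e x] mult.assoc)
      then show "ennreal (f y) * ennreal (q e x y * \<bar>y - x\<bar>) \<le> ennreal (laplace e (y - x) * \<bar>y - x\<bar>)"
        using f_nonneg q_nonneg[OF e] by (subst ennreal_mult[symmetric]) (auto intro: ennreal_leI)
    qed
    finally show ?thesis using nn_integral_laplace_abs[OF e] by simp
  qed
  note qd = this
  have "(\<integral>\<^sup>+z. ennreal (s e (fst z) (snd z) * \<bar>snd z - fst z\<bar>) \<partial>\<rho>)
    \<le> (\<integral>\<^sup>+z. ennreal (q e (fst z) (snd z) * \<bar>snd z - fst z\<bar>) + ennreal (b e (fst z) (snd z)) * ennreal e \<partial>\<rho>)"
  proof (rule nn_integral_mono)
    fix z :: "real \<times> real"
    have "s e (fst z) (snd z) * \<bar>snd z - fst z\<bar> \<le> q e (fst z) (snd z) * \<bar>snd z - fst z\<bar> + b e (fst z) (snd z) * e"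
      using b_dist_le[OF e, of "fst z" "snd z"] by (simp add: s_def distrib_right)
    then show "ennreal (s e (fst z) (snd z) * \<bar>snd z - fst z\<bar>)
      \<le> ennreal (q e (fst z) (snd z) * \<bar>snd z - fst z\<bar>) + ennreal (b e (fst z) (snd z)) * ennreal e"
      using b_nonneg[OF e] q_nonneg[OF e] e
      by (simp add: ennreal_mult[symmetric] ennreal_plus[symmetric] ennreal_leI del: ennreal_plus)
  qed
  also have "\<dots> = (\<integral>\<^sup>+z. ennreal (q e (fst z) (snd z) * \<bar>snd z - fst z\<bar>) \<partial>\<rho>)
    + (\<integral>\<^sup>+z. ennreal (b e (fst z) (snd z)) * (\<lambda>_. ennreal e) (fst z) \<partial>\<rho>)"
    by (simp add: nn_integral_add)
  also have "(\<integral>\<^sup>+z. ennreal (b e (fst z) (snd z)) * (\<lambda>_. ennreal e) (fst z) \<partial>\<rho>) = (\<integral>\<^sup>+x. ennreal (r e x) * ennreal e \<partial>\<mu>)"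
    by (rule nn_kernel_fst[OF _ _ nn_integral_b(1)[OF e]]) auto
  also have "\<dots> \<le> (\<integral>\<^sup>+x. ennreal e \<partial>\<mu>)"
  proof (rule nn_integral_mono)
    show "ennreal (r e x) * ennreal e \<le> ennreal e" for x
      using r_bounds[OF e, of x] e by (subst ennreal_mult[symmetric]) (auto intro!: ennreal_leI mult_left_le_one_le)
  qed
  also have "(\<integral>\<^sup>+x. ennreal e \<partial>\<mu>) = ennreal e" by (simp add: \<mu>.emeasure_space_1[simplified])
  also have "(\<integral>\<^sup>+z. ennreal (q e (fst z) (snd z) * \<bar>snd z - fst z\<bar>) \<partial>\<rho>)
    = (\<integral>\<^sup>+x. \<integral>\<^sup>+y. ennreal (q e x y * \<bar>y - x\<bar>) \<partial>\<nu> \<partial>\<mu>)"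
    using \<nu>.nn_integral_fst[of "\<lambda>z. ennreal (q e (fst z) (snd z) * \<bar>snd z - fst z\<bar>)" \<mu>] by simp
  also have "\<dots> \<le> (\<integral>\<^sup>+x. ennreal e \<partial>\<mu>)" by (intro nn_integral_mono qd)
  also have "(\<integral>\<^sup>+x. ennreal e \<partial>\<mu>) = ennreal e" by (simp add: \<mu>.emeasure_space_1[simplified])
  finally have le: "(\<integral>\<^sup>+z. ennreal (s e (fst z) (snd z) * \<bar>snd z - fst z\<bar>) \<partial>\<rho>) \<le> ennreal (2 * e)"
    using e by (simp add: ennreal_plus[symmetric] add_mono del: ennreal_plus)
  then show "integrable \<rho> (\<lambda>z. s e (fst z) (snd z) * \<bar>snd z - fst z\<bar>)"
    using pos by (intro integrableI_nonneg) (auto intro: le_less_trans)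
  show "(\<integral>z. s e (fst z) (snd z) * \<bar>snd z - fst z\<bar> \<partial>\<rho>) \<le> 2 * e"
    using le pos e by (subst integral_eq_nn_integral) (auto intro!: enn2real_leI)
qed

end

section \<open>The recovery plan: marginals, cost, entropy and narrow limit\<close>

context line_optimal
begin

text \<open>The density is modified on a null set to vanish everywhere off \<open>E\<close>. Then
  \<open>g\<close> and \<open>s\<close> are nowhere both nonzero, and the entropy of their sum
  splits pointwise.\<close>

lemma ex_density:
  assumes fin: "Ent (restr \<gamma>0 E) \<rho> < \<infinity>"
  shows "\<exists>g. g \<in> borel_measurable \<rho> \<and> (\<forall>z. 0 \<le> g z) \<and> (\<forall>z. z \<notin> E \<longrightarrow> g z = 0) \<and>
    restr \<gamma>0 E = density \<rho> (\<lambda>z. ennreal (g z)) \<and> integrable \<rho> (\<lambda>z. g z * ln (g z)) \<and>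
    Ent (restr \<gamma>0 E) \<rho> = ereal (\<integral>z. g z * ln (g z) \<partial>\<rho>)"
proof -
  obtain g where g[measurable]: "g \<in> borel_measurable \<rho>" and g0: "\<And>z. 0 \<le> g z"
    and d: "restr \<gamma>0 E = density \<rho> (\<lambda>z. ennreal (g z))"
    and i: "integrable \<rho> (\<lambda>z. g z * ln (g z))" and v: "Ent (restr \<gamma>0 E) \<rho> = ereal (\<integral>z. g z * ln (g z) \<partial>\<rho>)"
    using Ent_finite_cases[OF finite_measure_\<rho> restr_finite(1)[OF cpl] fin] by blast
  have Em[measurable]: "E \<in> sets \<rho>" by measurable
  then have Eg: "E \<in> sets \<gamma>0" using sets_\<gamma>0 sets_\<rho> by simp
  have sp: "space \<rho> = UNIV" by (simp add: space_pair_measure)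
  have "AE z in restr \<gamma>0 E. z \<in> E"
    unfolding restr_def using Eg by (subst AE_density) (auto simp: indicator_def)
  then have ae: "AE z in \<rho>. z \<notin> E \<longrightarrow> g z = 0"
    unfolding d by (subst (asm) AE_density) (auto elim!: eventually_mono intro: antisym g0 simp: not_less[symmetric])
  define g' where "g' z = indicator E z * g z" for z
  have eq: "AE z in \<rho>. g' z = g z" using ae by eventually_elim (auto simp: g'_def split: split_indicator)
  have [measurable]: "g' \<in> borel_measurable \<rho>" unfolding g'_def[abs_def] by measurable
  have "density \<rho> (\<lambda>z. ennreal (g' z)) = density \<rho> (\<lambda>z. ennreal (g z))"
    by (rule density_cong) (use eq in auto)
  moreover have "integrable \<rho> (\<lambda>z. g' z * ln (g' z))"
    by (rule integrable_cong_AE_imp[OF i]) (use eq in auto)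
  moreover have "(\<integral>z. g' z * ln (g' z) \<partial>\<rho>) = (\<integral>z. g z * ln (g z) \<partial>\<rho>)"
    by (rule integral_cong_AE) (use eq in auto)
  ultimately show ?thesis using d v g0 by (intro exI[of _ g']) (auto simp: g'_def)
qed

context
  fixes g :: "real \<times> real \<Rightarrow> real"
  assumes g[measurable]: "g \<in> borel_measurable \<rho>" and g0: "\<And>z. 0 \<le> g z" and gE: "\<And>z. z \<notin> E \<Longrightarrow> g z = 0"
    and d: "restr \<gamma>0 E = density \<rho> (\<lambda>z. ennreal (g z))" and gi: "integrable \<rho> (\<lambda>z. g z * ln (g z))"
    and Eg: "Ent (restr \<gamma>0 E) \<rho> = ereal (\<integral>z. g z * ln (g z) \<partial>\<rho>)"
begin

definition plan :: "real \<Rightarrow> (real \<times> real) measure" where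
  "plan e = density \<rho> (\<lambda>z. ennreal (g z + s e (fst z) (snd z)))"

lemma g_measurable'[measurable]: "g \<in> borel_measurable (borel \<Otimes>\<^sub>M borel)"
  using g measurable_cong_sets[OF sets_\<rho> refl] by blast

lemma E_measurable[measurable]: "E \<in> sets (borel \<Otimes>\<^sub>M borel)" "E \<in> sets \<gamma>0" "E \<in> sets \<rho>"
  by measurable

lemma sets_plan[measurable_cong]: "sets (plan e) = sets (borel \<Otimes>\<^sub>M borel)"
  using sets_\<rho> by (simp add: plan_def)

lemma nn_integral_g:
  assumes [measurable]: "h \<in> borel_measurable (borel \<Otimes>\<^sub>M borel)"
  shows "(\<integral>\<^sup>+z. ennreal (g z) * h z \<partial>\<rho>) = (\<integral>\<^sup>+z. indicator E z * h z \<partial>\<gamma>0)"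
proof -
  have "(\<integral>\<^sup>+z. h z \<partial>restr \<gamma>0 E) = (\<integral>\<^sup>+z. indicator E z * h z \<partial>\<gamma>0)"
    unfolding restr_def by (rule nn_integral_density) auto
  moreover have "(\<integral>\<^sup>+z. h z \<partial>density \<rho> (\<lambda>z. ennreal (g z))) = (\<integral>\<^sup>+z. ennreal (g z) * h z \<partial>\<rho>)"
    by (rule nn_integral_density) auto
  ultimately show ?thesis unfolding d by simp
qed

lemma integral_g:
  fixes h :: "real \<times> real \<Rightarrow> real"
  assumes [measurable]: "h \<in> borel_measurable (borel \<Otimes>\<^sub>M borel)" and i: "integrable \<gamma>0 h"
  shows "integrable \<rho> (\<lambda>z. g z * h z)" "(\<integral>z. g z * h z \<partial>\<rho>) = (\<integral>z. indicator E z * h z \<partial>\<gamma>0)"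
proof -
  have "integrable \<gamma>0 (\<lambda>z. indicator E z * h z)" using integrable_real_mult_indicator[OF E_measurable(2) i] by (simp add: mult.commute)
  then have "integrable (density \<gamma>0 (\<lambda>z. ennreal (indicator E z))) h"
    by (subst integrable_density) (auto simp: mult.commute)
  then have "integrable (density \<rho> (\<lambda>z. ennreal (g z))) h"
    unfolding ennreal_indicator restr_def[symmetric] d .
  then show "integrable \<rho> (\<lambda>z. g z * h z)"
    by (subst (asm) integrable_density) (auto simp: g0)
  have "(\<integral>z. h z \<partial>density \<rho> (\<lambda>z. ennreal (g z))) = (\<integral>z. g z * h z \<partial>\<rho>)"
    by (subst integral_density) (auto simp: g0)
  then show "(\<integral>z. g z * h z \<partial>\<rho>) = (\<integral>z. indicator E z * h z \<partial>\<gamma>0)"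
    using restr_integral[OF cpl, of h] unfolding d by simp
qed

lemma nn_integral_plan:
  assumes e: "0 < e" and [measurable]: "h \<in> borel_measurable (borel \<Otimes>\<^sub>M borel)"
  shows "(\<integral>\<^sup>+z. h z \<partial>plan e) = (\<integral>\<^sup>+z. indicator E z * h z \<partial>\<gamma>0) + (\<integral>\<^sup>+z. ennreal (s e (fst z) (snd z)) * h z \<partial>\<rho>)"
proof -
  have "(\<integral>\<^sup>+z. h z \<partial>plan e) = (\<integral>\<^sup>+z. ennreal (g z + s e (fst z) (snd z)) * h z \<partial>\<rho>)"
    unfolding plan_def by (rule nn_integral_density) auto
  also have "\<dots> = (\<integral>\<^sup>+z. ennreal (g z) * h z + ennreal (s e (fst z) (snd z)) * h z \<partial>\<rho>)"
    using g0 s_nonneg[OF e] by (simp add: distrib_right)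
  also have "\<dots> = (\<integral>\<^sup>+z. ennreal (g z) * h z \<partial>\<rho>) + (\<integral>\<^sup>+z. ennreal (s e (fst z) (snd z)) * h z \<partial>\<rho>)"
    by (rule nn_integral_add) auto
  finally show ?thesis by (simp add: nn_integral_g)
qed

text \<open>The optimal plan does not charge the mixed blocks, so its restriction to
  \<open>E\<close> has as marginals the parts of \<open>\<mu>\<close> and \<open>\<nu>\<close> off
  \<open>A\<close>; \<open>s\<close> supplies the parts on \<open>A\<close>.\<close>

lemma plan_coupling:
  assumes e: "0 < e" shows "plan e \<in> couplings \<mu> \<nu>"
proof -
  have m: "fst \<in> measurable (plan e) borel" "snd \<in> measurable (plan e) borel"
    "fst \<in> measurable \<gamma>0 borel" "snd \<in> measurable \<gamma>0 borel" by measurable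
  have one: "distr (plan e) borel fst = \<mu>"
  proof (rule measure_eqI)
    fix X assume "X \<in> sets (distr (plan e) borel fst)"
    then have X[measurable]: "X \<in> sets borel" by simp
    have "emeasure (distr (plan e) borel fst) X = (\<integral>\<^sup>+x. indicator X x \<partial>distr (plan e) borel fst)" by simp
    also have "\<dots> = (\<integral>\<^sup>+z. indicator X (fst z) \<partial>plan e)" by (rule nn_integral_distr[OF m(1)]) simp
    also have "\<dots> = (\<integral>\<^sup>+z. indicator E z * indicator X (fst z) \<partial>\<gamma>0) + (\<integral>\<^sup>+z. ennreal (s e (fst z) (snd z)) * indicator X (fst z) \<partial>\<rho>)"
      by (rule nn_integral_plan[OF e]) measurable
    also have "(\<integral>\<^sup>+z. indicator E z * indicator X (fst z) \<partial>\<gamma>0) = (\<integral>\<^sup>+z. indicator (X - A) (fst z) \<partial>\<gamma>0)"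
      by (rule nn_integral_cong_AE, use opt1_off_diagonal[OF opt] in eventually_elim)
        (auto split: split_indicator)
    also have "\<dots> = (\<integral>\<^sup>+x. indicator (X - A) x \<partial>\<mu>)"
      using nn_integral_distr[OF m(3), of "indicator (X - A)"] couplingsD(5)[OF cpl] by simp
    also have "(\<integral>\<^sup>+z. ennreal (s e (fst z) (snd z)) * indicator X (fst z) \<partial>\<rho>) = (\<integral>\<^sup>+x. ennreal (indicator A x) * indicator X x \<partial>\<mu>)"
      by (rule nn_kernel_fst[OF _ _ nn_integral_s(1)[OF e]]) auto
    also have "(\<integral>\<^sup>+x. indicator (X - A) x \<partial>\<mu>) + (\<integral>\<^sup>+x. ennreal (indicator A x) * indicator X x \<partial>\<mu>)
      = (\<integral>\<^sup>+x. indicator (X - A) x + ennreal (indicator A x) * indicator X x \<partial>\<mu>)"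
      by (rule nn_integral_add[symmetric]) auto
    also have "\<dots> = (\<integral>\<^sup>+x. indicator X x \<partial>\<mu>)"
      by (rule nn_integral_cong) (auto split: split_indicator)
    finally show "emeasure (distr (plan e) borel fst) X = emeasure \<mu> X" by simp
  qed simp
  have two: "distr (plan e) borel snd = \<nu>"
  proof (rule measure_eqI)
    fix X assume "X \<in> sets (distr (plan e) borel snd)"
    then have X[measurable]: "X \<in> sets borel" by simp
    have "emeasure (distr (plan e) borel snd) X = (\<integral>\<^sup>+x. indicator X x \<partial>distr (plan e) borel snd)" by simp
    also have "\<dots> = (\<integral>\<^sup>+z. indicator X (snd z) \<partial>plan e)" by (rule nn_integral_distr[OF m(2)]) simp
    also have "\<dots> = (\<integral>\<^sup>+z. indicator E z * indicator X (snd z) \<partial>\<gamma>0) + (\<integral>\<^sup>+z. ennreal (s e (fst z) (snd z)) * indicator X (snd z) \<partial>\<rho>)"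
      by (rule nn_integral_plan[OF e]) measurable
    also have "(\<integral>\<^sup>+z. indicator E z * indicator X (snd z) \<partial>\<gamma>0) = (\<integral>\<^sup>+z. indicator (X - A) (snd z) \<partial>\<gamma>0)"
      by (rule nn_integral_cong_AE, use opt1_off_diagonal[OF opt] in eventually_elim)
        (auto split: split_indicator)
    also have "\<dots> = (\<integral>\<^sup>+x. indicator (X - A) x \<partial>\<nu>)"
      using nn_integral_distr[OF m(4), of "indicator (X - A)"] couplingsD(6)[OF cpl] by simp
    also have "(\<integral>\<^sup>+z. ennreal (s e (fst z) (snd z)) * indicator X (snd z) \<partial>\<rho>) = (\<integral>\<^sup>+x. ennreal (indicator A x) * indicator X x \<partial>\<nu>)"
      by (rule nn_kernel_snd[OF _ _ nn_integral_s(2)[OF e]]) auto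
    also have "(\<integral>\<^sup>+x. indicator (X - A) x \<partial>\<nu>) + (\<integral>\<^sup>+x. ennreal (indicator A x) * indicator X x \<partial>\<nu>)
      = (\<integral>\<^sup>+x. indicator (X - A) x + ennreal (indicator A x) * indicator X x \<partial>\<nu>)"
      by (rule nn_integral_add[symmetric]) auto
    also have "\<dots> = (\<integral>\<^sup>+x. indicator X x \<partial>\<nu>)"
      by (rule nn_integral_cong) (auto split: split_indicator)
    finally show "emeasure (distr (plan e) borel snd) X = emeasure \<nu> X" by simp
  qed simp
  have "prob_space (distr (plan e) borel fst)" unfolding one by (rule prob_\<mu>)
  then have "prob_space (plan e)" by (rule prob_space_distrD[OF m(1)])
  then show ?thesis using one two sets_plan by (simp add: couplings_def)
qed

lemma integral_plan:
  fixes h :: "real \<times> real \<Rightarrow> real"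
  assumes e: "0 < e" and [measurable]: "h \<in> borel_measurable (borel \<Otimes>\<^sub>M borel)" and i: "integrable \<gamma>0 h"
    and si: "integrable \<rho> (\<lambda>z. s e (fst z) (snd z) * h z)"
  shows "(\<integral>z. h z \<partial>plan e) = (\<integral>z. indicator E z * h z \<partial>\<gamma>0) + (\<integral>z. s e (fst z) (snd z) * h z \<partial>\<rho>)"
proof -
  have "(\<integral>z. h z \<partial>plan e) = (\<integral>z. (g z + s e (fst z) (snd z)) * h z \<partial>\<rho>)"
    unfolding plan_def using g0 s_nonneg[OF e] by (subst integral_density) auto
  also have "\<dots> = (\<integral>z. g z * h z \<partial>\<rho>) + (\<integral>z. s e (fst z) (snd z) * h z \<partial>\<rho>)"
    using integral_g(1)[OF _ i] si by (simp add: distrib_right)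
  finally show ?thesis using integral_g(2)[OF _ i] by simp
qed

text \<open>Outside \<open>E\<close> the optimal plan is diagonal and free of cost, so the part that
  is kept already costs \<open>W1 \<mu> \<nu>\<close> and the excess is the cost of \<open>s\<close>
  alone.\<close>

lemma cost1_plan:
  assumes e: "0 < e"
  shows "cost1 (plan e) - W1 \<mu> \<nu> = (\<integral>z. s e (fst z) (snd z) * \<bar>snd z - fst z\<bar> \<partial>\<rho>)"
proof -
  have "cost1 (plan e) = (\<integral>z. indicator E z * \<bar>snd z - fst z\<bar> \<partial>\<gamma>0) + (\<integral>z. s e (fst z) (snd z) * \<bar>snd z - fst z\<bar> \<partial>\<rho>)"
    unfolding cost1_def by (rule integral_plan[OF e _ integrable_dist[OF cpl] integral_s_dist(1)[OF e]]) measurable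
  moreover have "(\<integral>z. indicator E z * \<bar>snd z - fst z\<bar> \<partial>\<gamma>0) = cost1 \<gamma>0"
    unfolding cost1_def
  proof (rule integral_cong_AE)
    show "AE z in \<gamma>0. indicator E z * \<bar>snd z - fst z\<bar> = \<bar>snd z - fst z\<bar>"
      using opt1_AE_diagonal[OF opt]
    proof eventually_elim
      case (elim z)
      show ?case
      proof (cases "z \<in> E")
        case False
        then have "fst z = snd z" using elim by (cases z) auto
        then have "\<bar>snd z - fst z\<bar> = 0" by simp
        then show ?thesis by (simp only: mult_zero_right)
      qed simp
    qed
  qed measurable
  moreover have "cost1 \<gamma>0 = W1 \<mu> \<nu>" using opt by (simp add: opt1_def)
  ultimately show ?thesis by simp
qed

lemma integral_s_total:
  assumes e: "0 < e"
  shows "integrable \<rho> (\<lambda>z. s e (fst z) (snd z))" "(\<integral>z. s e (fst z) (snd z) \<partial>\<rho>) = measure \<mu> A"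
  using kernel_integral[of "s e" "\<lambda>_. 1" "indicator A", OF _ s_nonneg[OF e] _ _ _ nn_integral_s(1)[OF e]]
  by (auto simp: \<mu>.emeasure_eq_measure)

text \<open>Integration of \<open>s_entropy_bound\<close>: its distance term is the scaled excess
  cost of the plan. The parameter \<open>\<eta>\<close> remains free, to be fixed before the limit
  in \<open>e\<close>.\<close>

lemma plan_upper_bound:
  assumes e: "0 < e" and \<eta>: "0 < \<eta>"
  shows "ereal ((cost1 (plan e) - W1 \<mu> \<nu>) / e) + Ent (plan e) \<rho> \<le>
    Ent (restr \<gamma>0 E) \<rho> + ereal (- ln (2 * e) * measure \<mu> A - I\<^sub>A
      + (\<integral>x. r e x * \<bar>ln (f x)\<bar> \<partial>\<mu>) + (1 - ln \<eta>) * deficit e + \<eta> * (6 * L + 4 * e))"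
proof -
  let ?s = "\<lambda>z. s e (fst z) (snd z)" and ?q = "\<lambda>z. q e (fst z) (snd z)" and ?b = "\<lambda>z. b e (fst z) (snd z)"
  let ?Q = "\<lambda>x. ln (f x)" and ?B = "\<lambda>x. 1 + \<eta> / f x + 2 * \<eta> * e / R e \<lfloor>x / e\<rfloor> - ln \<eta>"
  define T where "T z = - ln (2 * e) * ?s z - ?q z * ?Q (fst z) + ?b z * ?B (fst z)" for z
  note si = integral_s_total[OF e] and sd = integral_s_dist[OF e]
  have ip: "integrable \<mu> (\<lambda>x. p e x * ?Q x)"
    by (rule Bochner_Integration.integrable_bound[OF ln_f_integrable])
      (use p_bounds[OF e] in \<open>auto simp: abs_mult intro!: mult_left_le_one_le\<close>)
  have qi: "integrable \<rho> (\<lambda>z. ?q z * ?Q (fst z))" "(\<integral>z. ?q z * ?Q (fst z) \<partial>\<rho>) = (\<integral>x. p e x * ?Q x \<partial>\<mu>)"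
    by (rule kernel_integral[OF _ q_nonneg[OF e] _ _ p_bounds(1)[OF e] _ ip]; simp add: nn_integral_q[OF e])+
  note rf = integral_r_over_f[OF e] and rR = integral_r_over_R[OF e] and ri = r_integrable[OF e]
  have rB: "r e x * ?B x = (1 - ln \<eta>) * r e x + \<eta> * (r e x * (1 / f x)) + 2 * \<eta> * e * (r e x * (1 / R e \<lfloor>x / e\<rfloor>))" for x
    by (simp add: algebra_simps)
  have ri3: "integrable \<mu> (\<lambda>x. (1 - ln \<eta>) * r e x)" "integrable \<mu> (\<lambda>x. \<eta> * (r e x * (1 / f x)))"
    "integrable \<mu> (\<lambda>x. 2 * \<eta> * e * (r e x * (1 / R e \<lfloor>x / e\<rfloor>)))"
    by (intro Bochner_Integration.integrable_mult_right rf(1) rR(1) ri)+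
  have ir: "integrable \<mu> (\<lambda>x. r e x * ?B x)" unfolding rB
    by (intro Bochner_Integration.integrable_add ri3)
  have bi: "integrable \<rho> (\<lambda>z. ?b z * ?B (fst z))" "(\<integral>z. ?b z * ?B (fst z) \<partial>\<rho>) = (\<integral>x. r e x * ?B x \<partial>\<mu>)"
    by (rule kernel_integral[OF _ b_nonneg[OF e] _ _ r_bounds(1)[OF e] nn_integral_b(1)[OF e] ir]; measurable)+
  have "(\<integral>x. r e x * ?B x \<partial>\<mu>) = (1 - ln \<eta>) * deficit e + \<eta> * (\<integral>x. r e x * (1 / f x) \<partial>\<mu>)
    + 2 * \<eta> * e * (\<integral>x. r e x * (1 / R e \<lfloor>x / e\<rfloor>) \<partial>\<mu>)"
    unfolding rB deficit_def Bochner_Integration.integral_add[OF Bochner_Integration.integrable_add[OF ri3(1,2)] ri3(3)]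
      Bochner_Integration.integral_add[OF ri3(1,2)] by (simp only: integral_mult_right_zero)
  \<comment> \<open>The term \<open>1 / f\<close> yields \<open>2 * L\<close>, the blocks yield
    \<open>4 * L + 4 * e\<close>, together \<open>6 * L + 4 * e\<close>.\<close>
  also have "\<dots> \<le> (1 - ln \<eta>) * deficit e + \<eta> * (2 * L) + 2 * \<eta> * e * (2 * L / e + 2)"
    by (rule add_mono[OF add_mono[OF order_refl mult_left_mono[OF rf(2)]] mult_left_mono[OF rR(2)]])
      (use \<eta> e in auto)
  also have "\<dots> = (1 - ln \<eta>) * deficit e + \<eta> * (6 * L + 4 * e)" using e by (simp add: field_simps)
  finally have bb: "(\<integral>z. ?b z * ?B (fst z) \<partial>\<rho>) \<le> (1 - ln \<eta>) * deficit e + \<eta> * (6 * L + 4 * e)" using bi by simp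
  have iA: "integrable \<mu> (\<lambda>x. indicator A x * ?Q x)"
    by (rule Bochner_Integration.integrable_bound[OF ln_f_integrable]) (auto split: split_indicator)
  have ira: "integrable \<mu> (\<lambda>x. r e x * \<bar>?Q x\<bar>)"
    by (rule Bochner_Integration.integrable_bound[OF ln_f_integrable])
      (use r_bounds[OF e] in \<open>auto simp: abs_mult intro!: mult_left_le_one_le\<close>)
  \<comment> \<open>The kernel part sees \<open>ln f\<close> with weight \<open>p\<close>, not with
    the indicator of \<open>A\<close>; the difference is \<open>r * ln f\<close>, of which no sign
    is known.\<close>
  have "I\<^sub>A - (\<integral>x. r e x * \<bar>?Q x\<bar> \<partial>\<mu>) = (\<integral>x. indicator A x * ?Q x - r e x * \<bar>?Q x\<bar> \<partial>\<mu>)"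
    using iA ira by (simp add: set_lebesgue_integral_def)
  also have "\<dots> \<le> (\<integral>x. p e x * ?Q x \<partial>\<mu>)"
  proof (rule integral_mono)
    fix x
    have "indicator A x = p e x + r e x" by (auto simp: r_def p_outside split: split_indicator)
    then have "indicator A x * ?Q x = p e x * ?Q x + r e x * ?Q x" by (simp add: distrib_right)
    moreover have "r e x * ?Q x \<le> r e x * \<bar>?Q x\<bar>" using r_bounds[OF e] by (intro mult_left_mono) auto
    ultimately show "indicator A x * ?Q x - r e x * \<bar>?Q x\<bar> \<le> p e x * ?Q x" by simp
  qed (use iA ira ip in auto)
  finally have qq: "I\<^sub>A - (\<integral>x. r e x * \<bar>?Q x\<bar> \<partial>\<mu>) \<le> (\<integral>z. ?q z * ?Q (fst z) \<partial>\<rho>)" using qi by simp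
  have Ti: "integrable \<rho> T" unfolding T_def using si qi bi by auto
  have "(\<integral>z. T z \<partial>\<rho>) = - ln (2 * e) * measure \<mu> A - (\<integral>z. ?q z * ?Q (fst z) \<partial>\<rho>) + (\<integral>z. ?b z * ?B (fst z) \<partial>\<rho>)"
    unfolding T_def using si qi(1) bi(1) by simp
  then have Tv: "(\<integral>z. T z \<partial>\<rho>) \<le> - ln (2 * e) * measure \<mu> A - I\<^sub>A
      + (\<integral>x. r e x * \<bar>ln (f x)\<bar> \<partial>\<mu>) + (1 - ln \<eta>) * deficit e + \<eta> * (6 * L + 4 * e)"
    using bb qq by simp
  have bd: "AE z in \<rho>. ?s z * ln (?s z) \<le> T z - ?s z * \<bar>snd z - fst z\<bar> / e"
    using AE_\<rho>_fst[OF AE_f_pos]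
  proof eventually_elim
    case (elim z)
    then show ?case using s_entropy_bound[OF e \<eta>, of "fst z" "snd z"] unfolding T_def by linarith
  qed
  have ui: "integrable \<rho> (\<lambda>z. T z - ?s z * \<bar>snd z - fst z\<bar> / e)" using Ti sd by auto
  \<comment> \<open>From below the function is at least \<open>- 1\<close>, from above it is at most
    the integrable bound \<open>bd\<close>; no control of \<open>s\<close> itself from below is
    required.\<close>
  have sl: "integrable \<rho> (\<lambda>z. ?s z * ln (?s z))"
  proof (rule Bochner_Integration.integrable_bound[where f="\<lambda>z. 1 + \<bar>T z - ?s z * \<bar>snd z - fst z\<bar> / e\<bar>"])
    show "integrable \<rho> (\<lambda>z. 1 + \<bar>T z - ?s z * \<bar>snd z - fst z\<bar> / e\<bar>)"
      using ui finite_measure.integrable_const[OF finite_measure_\<rho>, of "1::real"] by auto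
    show "AE z in \<rho>. norm (?s z * ln (?s z)) \<le> norm (1 + \<bar>T z - ?s z * \<bar>snd z - fst z\<bar> / e\<bar>)"
      using bd
    proof eventually_elim
      case (elim z)
      then show ?case using xlnx_ge[OF s_nonneg[OF e, of "fst z" "snd z"]] by auto
    qed
  qed measurable
  have sv: "(\<integral>z. ?s z * ln (?s z) \<partial>\<rho>) \<le> (\<integral>z. T z \<partial>\<rho>) - (cost1 (plan e) - W1 \<mu> \<nu>) / e"
  proof -
    have "(\<integral>z. ?s z * ln (?s z) \<partial>\<rho>) \<le> (\<integral>z. T z - ?s z * \<bar>snd z - fst z\<bar> / e \<partial>\<rho>)"
      by (rule integral_mono_AE[OF sl ui bd])
    then show ?thesis using Ti sd unfolding cost1_plan[OF e] by simp
  qed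
  have dis: "(g z + ?s z) * ln (g z + ?s z) = g z * ln (g z) + ?s z * ln (?s z)" for z
  proof (cases "z \<in> E")
    case True
    then have "?s z = 0" by (intro s_outside(3)) auto
    then show ?thesis by simp
  qed (simp add: gE)
  have gs: "integrable \<rho> (\<lambda>z. (g z + ?s z) * ln (g z + ?s z))" unfolding dis using gi sl by auto
  have "Ent (plan e) \<rho> = ereal (\<integral>z. (g z + ?s z) * ln (g z + ?s z) \<partial>\<rho>)"
    unfolding plan_def by (rule Ent_density[OF finite_measure_\<rho> _ _ gs]) (auto simp: g0 s_nonneg[OF e])
  also have "\<dots> = ereal ((\<integral>z. g z * ln (g z) \<partial>\<rho>) + (\<integral>z. ?s z * ln (?s z) \<partial>\<rho>))"
    unfolding dis using gi sl by simp
  finally show ?thesis using sv Tv unfolding Eg by simp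
qed

text \<open>Over \<open>A\<close> the optimal plan is the diagonal image of \<open>\<mu>\<close>,
  whose first marginal \<open>s\<close> shares, so the integrals differ by that of \<open>s\<close>
  times \<open>h (x, y) - h (x, x)\<close>. Near the diagonal uniform continuity on the window
  bounds this difference, and at distance at least \<open>\<delta>\<close> it is bounded by a
  multiple of the distance, of mean at most \<open>2 * e\<close>.\<close>

lemma plan_narrow_conv: "narrow_conv plan \<gamma>0 (at_right 0)"
  unfolding narrow_conv_def
proof (intro allI impI, elim conjE)
  fix h :: "real \<times> real \<Rightarrow> real"
  assume hc: "continuous_on UNIV h" and "bounded (range h)"
  then obtain B where B: "\<And>z. \<bar>h z\<bar> \<le> B" by (auto simp: bounded_iff)
  have B0: "0 \<le> B" by (rule order_trans[OF abs_ge_zero B[of "(0, 0)"]])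
  note hm[measurable] = continuous_measurable_pair[OF hc]
  have hi: "integrable \<gamma>0 h" by (rule bounded_integrable_coupling[OF cpl hm B])
  have diag: "continuous_on UNIV (\<lambda>x. h (x, x))"
    by (rule continuous_on_compose2[OF hc]) (auto intro!: continuous_intros)
  have [measurable]: "(\<lambda>x. h (x, x)) \<in> borel_measurable borel" by (rule borel_measurable_continuous_onI[OF diag])
  have hA: "integrable \<mu> (\<lambda>x. indicator A x * h (x, x))"
    by (rule \<mu>.integrable_const_bound[where B=B]) (use B B0 in \<open>auto split: split_indicator\<close>)
  have split: "(\<integral>z. h z \<partial>\<gamma>0) = (\<integral>z. indicator E z * h z \<partial>\<gamma>0) + (\<integral>x. indicator A x * h (x, x) \<partial>\<mu>)"
  proof -
    have m: "(\<lambda>z. h (fst z, fst z)) \<in> borel_measurable \<gamma>0"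
      using measurable_compose[OF measurable_fst'' \<open>(\<lambda>x. h (x, x)) \<in> borel_measurable borel\<close>] by measurable
    have "(\<integral>z. h z \<partial>\<gamma>0) = (\<integral>z. indicator E z * h z + indicator A (fst z) * h (fst z, fst z) \<partial>\<gamma>0)"
    proof (rule integral_cong_AE)
      show "AE z in \<gamma>0. h z = indicator E z * h z + indicator A (fst z) * h (fst z, fst z)"
        using opt1_AE_diagonal[OF opt]
      proof eventually_elim
        case (elim z)
        obtain x y where z: "z = (x, y)" by (cases z)
        show ?case
        proof (cases "x \<in> A \<or> y \<in> A")
          case True
          then have "y = x" using elim unfolding z fst_conv snd_conv by blast
          then show ?thesis using True by (simp add: z)
        qed (simp add: z)
      qed
    qed (use m in measurable)
    also have "\<dots> = (\<integral>z. indicator E z * h z \<partial>\<gamma>0) + (\<integral>z. indicator A (fst z) * h (fst z, fst z) \<partial>\<gamma>0)"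
      using hA integral_marginals(3)[OF cpl, of "\<lambda>x. indicator A x * h (x, x)"]
        integrable_real_mult_indicator[OF E_measurable(2) hi]
      by (intro Bochner_Integration.integral_add) (auto simp: mult.commute)
    also have "(\<integral>z. indicator A (fst z) * h (fst z, fst z) \<partial>\<gamma>0) = (\<integral>x. indicator A x * h (x, x) \<partial>\<mu>)"
      by (rule integral_marginals(1)[OF cpl]) measurable
    finally show ?thesis .
  qed
  let ?s = "\<lambda>e z. s e (fst z) (snd z)"
  have diff: "(\<integral>z. h z \<partial>plan e) - (\<integral>z. h z \<partial>\<gamma>0) = (\<integral>z. ?s e z * (h z - h (fst z, fst z)) \<partial>\<rho>)"
    and sB: "integrable \<rho> (\<lambda>z. ?s e z * (h z - h (fst z, fst z)))" if e: "0 < e" for e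
  proof -
    have s1: "integrable \<rho> (\<lambda>z. ?s e z * h z)"
    proof (rule Bochner_Integration.integrable_bound[where f="\<lambda>z. ?s e z * B"])
      show "AE z in \<rho>. norm (?s e z * h z) \<le> norm (?s e z * B)"
        using B B0 s_nonneg[OF e] by (auto simp: abs_mult intro!: mult_left_mono)
    qed (use integral_s_total[OF e] in auto)
    have s2: "integrable \<rho> (\<lambda>z. ?s e z * h (fst z, fst z))"
      "(\<integral>z. ?s e z * h (fst z, fst z) \<partial>\<rho>) = (\<integral>x. indicator A x * h (x, x) \<partial>\<mu>)"
      by (rule kernel_integral[OF _ s_nonneg[OF e] _ _ _ nn_integral_s(1)[OF e] hA]; simp)+
    show "(\<integral>z. h z \<partial>plan e) - (\<integral>z. h z \<partial>\<gamma>0) = (\<integral>z. ?s e z * (h z - h (fst z, fst z)) \<partial>\<rho>)"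
      unfolding integral_plan[OF e hm hi s1] split using s1 s2 by (simp add: right_diff_distrib)
    show "integrable \<rho> (\<lambda>z. ?s e z * (h z - h (fst z, fst z)))"
      using s1 s2 by (simp add: right_diff_distrib)
  qed
  show "((\<lambda>e. \<integral>z. h z \<partial>plan e) \<longlongrightarrow> (\<integral>z. h z \<partial>\<gamma>0)) (at_right 0)"
  proof (rule tendstoI)
    fix \<epsilon> :: real assume \<epsilon>: "\<epsilon> > 0"
    have "uniformly_continuous_on ({-L..L} \<times> {-L..L}) h"
      by (intro compact_uniformly_continuous continuous_on_subset[OF hc] compact_Times) auto
    then obtain \<delta> where \<delta>: "\<delta> > 0" and uc: "\<And>z z'. z \<in> {-L..L} \<times> {-L..L} \<Longrightarrow> z' \<in> {-L..L} \<times> {-L..L} \<Longrightarrow> dist z' z < \<delta> \<Longrightarrow> dist (h z') (h z) < \<epsilon> / 2"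
      using \<epsilon> unfolding uniformly_continuous_on_def by (metis half_gt_zero)
    have pt: "\<bar>h (x, y) - h (x, x)\<bar> \<le> \<epsilon> / 2 + 2 * B / \<delta> * \<bar>y - x\<bar>" if "\<bar>x\<bar> \<le> L" "\<bar>y\<bar> \<le> L" for x y
    proof (cases "\<bar>y - x\<bar> < \<delta>")
      case True
      then have "dist (h (x, y)) (h (x, x)) < \<epsilon> / 2"
        using that by (intro uc) (auto simp: dist_Pair_Pair dist_real_def abs_le_iff)
      moreover have "0 \<le> 2 * B / \<delta> * \<bar>y - x\<bar>" using B0 \<delta> by simp
      ultimately show ?thesis by (simp add: dist_real_def)
    next
      case False
      have "\<bar>h (x, y) - h (x, x)\<bar> \<le> 2 * B" using B[of "(x, y)"] B[of "(x, x)"] by linarith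
      also have "2 * B \<le> 2 * B / \<delta> * \<bar>y - x\<bar>" using False \<delta> B0 by (simp add: field_simps mult_left_mono)
      finally show ?thesis using \<epsilon> by simp
    qed
    have bnd: "\<bar>(\<integral>z. h z \<partial>plan e) - (\<integral>z. h z \<partial>\<gamma>0)\<bar> \<le> \<epsilon> / 2 + 2 * B / \<delta> * (2 * e)" if e: "0 < e" for e
    proof -
      note sd = integral_s_dist[OF e] and st = integral_s_total[OF e]
      have "\<bar>(\<integral>z. h z \<partial>plan e) - (\<integral>z. h z \<partial>\<gamma>0)\<bar> \<le> (\<integral>z. \<bar>?s e z * (h z - h (fst z, fst z))\<bar> \<partial>\<rho>)"
        unfolding diff[OF e] by (rule integral_abs_bound)
      also have "\<dots> \<le> (\<integral>z. \<epsilon> / 2 * ?s e z + 2 * B / \<delta> * (?s e z * \<bar>snd z - fst z\<bar>) \<partial>\<rho>)"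
      proof (rule integral_mono_AE)
        show "AE z in \<rho>. \<bar>?s e z * (h z - h (fst z, fst z))\<bar> \<le> \<epsilon> / 2 * ?s e z + 2 * B / \<delta> * (?s e z * \<bar>snd z - fst z\<bar>)"
          using AE_bounds[OF product_coupling]
        proof eventually_elim
          case (elim z)
          have "\<bar>?s e z * (h z - h (fst z, fst z))\<bar> = ?s e z * \<bar>h (fst z, snd z) - h (fst z, fst z)\<bar>"
            using s_nonneg[OF e] by (simp add: abs_mult)
          also have "\<dots> \<le> ?s e z * (\<epsilon> / 2 + 2 * B / \<delta> * \<bar>snd z - fst z\<bar>)"
            using elim s_nonneg[OF e] by (intro mult_left_mono pt) auto
          finally show ?case by (simp add: algebra_simps)
        qed
      qed (use sB[OF e] sd st in auto)
      also have "\<dots> = \<epsilon> / 2 * measure \<mu> A + 2 * B / \<delta> * (\<integral>z. ?s e z * \<bar>snd z - fst z\<bar> \<partial>\<rho>)"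
        using sd st by simp
      also have "\<dots> \<le> \<epsilon> / 2 * 1 + 2 * B / \<delta> * (2 * e)"
        using sd(2) \<epsilon> B0 \<delta> by (intro add_mono mult_left_mono) auto
      finally show ?thesis by simp
    qed
    have "((\<lambda>e. \<epsilon> / 2 + 2 * B / \<delta> * (2 * e)) \<longlongrightarrow> \<epsilon> / 2 + 2 * B / \<delta> * (2 * 0)) (at_right 0)"
      by (intro tendsto_intros)
    then have "eventually (\<lambda>e. \<epsilon> / 2 + 2 * B / \<delta> * (2 * e) < \<epsilon>) (at_right 0)"
      by (rule order_tendstoD) (use \<epsilon> in simp)
    moreover have "eventually (\<lambda>e::real. e > 0) (at_right 0)" by (rule eventually_at_right_less)
    ultimately show "eventually (\<lambda>e. dist (\<integral>z. h z \<partial>plan e) (\<integral>z. h z \<partial>\<gamma>0) < \<epsilon>) (at_right 0)"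
    proof eventually_elim
      case (elim e)
      then show ?case using bnd[of e] by (simp add: dist_real_def)
    qed
  qed
qed

lemma plan_limsup:
  "Limsup (at_right 0) (\<lambda>e. ereal ((cost1 (plan e) - W1 \<mu> \<nu>) / e) + Ent (plan e) \<rho>
             - ereal (\<bar>ln (2 * e)\<bar> * measure \<mu> A)) \<le> Ent (restr \<gamma>0 E) \<rho> - ereal I\<^sub>A"
  unfolding Limsup_le_iff
proof (intro allI impI)
  define G where "G = (\<integral>z. g z * ln (g z) \<partial>\<rho>) - I\<^sub>A"
  fix y assume "y > Ent (restr \<gamma>0 E) \<rho> - ereal I\<^sub>A"
  then have "ereal G < y" unfolding Eg G_def by simp
  then obtain c where c: "G < c" "ereal c < y" using ereal_dense2[of "ereal G" y] by auto
  \<comment> \<open>Makes \<open>6 * L * \<eta>\<close> half of the gap \<open>c - G\<close>; with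
    \<open>\<eta>\<close> fixed, all other error terms vanish with \<open>e\<close>, even though
    \<open>- ln \<eta>\<close> may be large.\<close>
  define \<eta> where "\<eta> = (c - G) / (12 * L)"
  have \<eta>: "\<eta> > 0" using c L_pos by (simp add: \<eta>_def)
  define err where "err e = (\<integral>x. r e x * \<bar>ln (f x)\<bar> \<partial>\<mu>) + (1 - ln \<eta>) * deficit e + \<eta> * (6 * L + 4 * e)" for e
  have "(err \<longlongrightarrow> 0 + (1 - ln \<eta>) * 0 + \<eta> * (6 * L + 4 * 0)) (at_right 0)"
    unfolding err_def by (intro tendsto_intros integral_r_tendsto_0 ln_f_integrable deficit_tendsto_0)
  moreover have "0 + (1 - ln \<eta>) * 0 + \<eta> * (6 * L + 4 * 0) < c - G"
    using c L_pos by (simp add: \<eta>_def)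
  ultimately have "eventually (\<lambda>e. err e < c - G) (at_right 0)" by (rule order_tendstoD)
  moreover have "eventually (\<lambda>e::real. e \<in> {0<..<1/2}) (at_right 0)"
    by (rule eventually_at_right_real) simp
  ultimately show "eventually (\<lambda>e. ereal ((cost1 (plan e) - W1 \<mu> \<nu>) / e) + Ent (plan e) \<rho>
             - ereal (\<bar>ln (2 * e)\<bar> * measure \<mu> A) < y) (at_right 0)"
  proof eventually_elim
    case (elim e)
    then have e: "e > 0" "\<bar>ln (2 * e)\<bar> = - ln (2 * e)" by auto
    have "ereal ((cost1 (plan e) - W1 \<mu> \<nu>) / e) + Ent (plan e) \<rho> \<le> ereal (G - ln (2 * e) * measure \<mu> A + err e)"
      using plan_upper_bound[OF e(1) \<eta>] unfolding Eg G_def err_def by (simp add: algebra_simps)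
    also have "\<dots> < ereal (c - ln (2 * e) * measure \<mu> A)" using elim by simp
    finally have "ereal ((cost1 (plan e) - W1 \<mu> \<nu>) / e) + Ent (plan e) \<rho>
             - ereal (\<bar>ln (2 * e)\<bar> * measure \<mu> A) \<le> ereal c"
      unfolding e(2) by (cases "Ent (plan e) \<rho>") auto
    then show ?case using c(2) by (rule le_less_trans)
  qed
qed

end

lemma ex_recovery_sequence:
  "\<exists>\<gamma>s. (\<forall>e>0. \<gamma>s e \<in> couplings \<mu> \<nu>) \<and> narrow_conv \<gamma>s \<gamma>0 (at_right 0) \<and>
    Limsup (at_right 0) (\<lambda>e. ereal ((cost1 (\<gamma>s e) - W1 \<mu> \<nu>) / e) + Ent (\<gamma>s e) \<rho>
             - ereal (\<bar>ln (2 * e)\<bar> * measure \<mu> A)) \<le> Ent (restr \<gamma>0 E) \<rho> - ereal I\<^sub>A"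
proof (cases "Ent (restr \<gamma>0 E) \<rho> < \<infinity>")
  case True
  then obtain g where "g \<in> borel_measurable \<rho>" "\<And>z. 0 \<le> g z" "\<And>z. z \<notin> E \<Longrightarrow> g z = 0"
    "restr \<gamma>0 E = density \<rho> (\<lambda>z. ennreal (g z))" "integrable \<rho> (\<lambda>z. g z * ln (g z))"
    "Ent (restr \<gamma>0 E) \<rho> = ereal (\<integral>z. g z * ln (g z) \<partial>\<rho>)"
    using ex_density by blast
  note g = this
  show ?thesis
    using plan_coupling[OF g] plan_narrow_conv[OF g] plan_limsup[OF g] by (intro exI[of _ "plan g"]) auto
next
  case False
  \<comment> \<open>The target value is \<open>\<infinity>\<close>, so the constant family recovers
    it.\<close>
  then show ?thesis using cpl by (intro exI[of _ "\<lambda>_. \<gamma>0"]) (auto simp: narrow_conv_def)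
qed

end

section \<open>Gamma-convergence\<close>

text \<open>The complement of the support is a union of null balls; by the Lindelof property
  countably many of them cover it.\<close>

lemma AE_in_supp:
  fixes M :: "real measure"
  assumes [measurable_cong, simp]: "sets M = sets borel"
  shows "AE x in M. x \<in> supp M"
proof -
  define F where "F = {ball x e |x e. 0 < e \<and> emeasure M (ball x e) = 0}"
  have "\<And>S. S \<in> F \<Longrightarrow> open S" by (auto simp: F_def)
  then obtain F' where F': "F' \<subseteq> F" "countable F'" "\<Union>F' = \<Union>F" by (rule Lindelof)
  have "(\<Union>S\<in>F'. S) \<in> null_sets M"
    using F' by (intro null_sets_UN') (auto simp: F_def null_sets_def)
  then have "AE x in M. x \<notin> \<Union>F" using F'(3) AE_not_in by fastforce
  then show ?thesis
  proof eventually_elim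
    case (elim x)
    have "emeasure M (ball x e) \<noteq> 0" if "0 < e" for e
    proof
      assume "emeasure M (ball x e) = 0"
      then have "ball x e \<in> F" using that by (auto simp: F_def)
      then show False using elim that by (auto intro: centre_in_ball[THEN iffD2])
    qed
    then show ?case by (auto simp: supp_def zero_less_iff_neq_zero)
  qed
qed

text \<open>Lebesgue measure is infinite, so a lower bound on \<open>f * ln f\<close> does not
  suffice by itself. Bounded support makes \<open>f\<close> vanish almost everywhere outside a
  window, which bounds the negative part by the length of the window.\<close>

lemma line_pair_of_entropy:
  assumes p: "prob_space \<mu>" "sets \<mu> = sets borel" "prob_space \<nu>" "sets \<nu> = sets borel"
    and b: "bounded (supp \<mu>)" "bounded (supp \<nu>)" and E: "Ent \<mu> lborel < \<infinity>" "Ent \<nu> lborel < \<infinity>"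
  shows "\<exists>L. line_pair \<mu> \<nu> (\<lambda>x. enn2real (RN_deriv lborel \<mu> x)) L"
proof -
  have "bounded (supp \<mu> \<union> supp \<nu>)" using b by simp
  then obtain L where L: "L > 0" "\<And>x. x \<in> supp \<mu> \<union> supp \<nu> \<Longrightarrow> \<bar>x\<bar> \<le> L"
    unfolding bounded_pos by (auto simp: real_norm_def)
  have ae: "AE x in \<mu>. \<bar>x\<bar> \<le> L" "AE x in \<nu>. \<bar>x\<bar> \<le> L"
    using AE_in_supp[OF p(2)] AE_in_supp[OF p(4)] L(2) by (auto elim!: eventually_mono)
  interpret \<mu>: prob_space \<mu> by fact
  define f where "f = (\<lambda>x. enn2real (RN_deriv lborel \<mu> x))"
  obtain g where "g \<in> borel_measurable lborel" "\<forall>x. 0 \<le> g x" "\<mu> = density lborel (\<lambda>x. ennreal (g x))" "g = f"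
    "(\<integral>\<^sup>+ x. ennreal (g x * ln (g x)) \<partial>lborel) < \<infinity>"
    using Ent_finiteD[OF lborel.sigma_finite_measure_axioms \<mu>.finite_measure_axioms E(1)] unfolding f_def by blast
  then have f[measurable]: "f \<in> borel_measurable borel" and f0: "\<And>x. 0 \<le> f x"
    and d: "\<mu> = density lborel (\<lambda>x. ennreal (f x))" and P: "(\<integral>\<^sup>+ x. ennreal (f x * ln (f x)) \<partial>lborel) < \<infinity>"
    by auto
  have fb: "AE x in lborel. 0 < f x \<longrightarrow> \<bar>x\<bar> \<le> L"
    using ae(1) unfolding d by (subst (asm) AE_density) auto
  have "(\<integral>\<^sup>+ x. ennreal (- (f x * ln (f x))) \<partial>lborel) \<le> (\<integral>\<^sup>+ x. indicator {-L..L} x \<partial>lborel)"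
  proof (rule nn_integral_mono_AE, use fb in eventually_elim)
    case (elim x)
    have "- (f x * ln (f x)) \<le> 1" using xlnx_ge[OF f0[of x]] by simp
    then have "ennreal (- (f x * ln (f x))) \<le> 1" by (simp add: ennreal_le_1)
    then show ?case using elim f0[of x] by (cases "f x = 0") (auto simp: abs_le_iff)
  qed
  also have "\<dots> < \<infinity>" using L(1) by simp
  finally have "integrable lborel (\<lambda>x. f x * ln (f x))" using P by (auto simp: real_integrable_def)
  then have li: "integrable \<mu> (\<lambda>x. ln (f x))"
    unfolding d by (subst integrable_density) (auto simp: f0)
  have "absolutely_continuous lborel \<nu>" using E(2) by (auto simp: Ent_def split: if_splits)
  from line_pair.intro[OF p L(1) ae f f0 d li this] show ?thesis unfolding f_def by blast
qed

theorem mainTheorem6: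
  fixes \<mu> \<nu> :: "real measure"
  assumes "prob_space \<mu>" and "sets \<mu> = sets borel"
    and "prob_space \<nu>" and "sets \<nu> = sets borel"
    and "bounded (supp \<mu>)" and "bounded (supp \<nu>)"
    and "Ent \<mu> lborel < \<infinity>" and "Ent \<nu> lborel < \<infinity>"
    and H1: "frontier (eqset \<mu> \<nu> \<inter> supp \<mu>) \<in> null_sets lborel \<and>
      (\<exists>a b :: nat \<Rightarrow> real.
         (\<forall>i. a i \<le> b i) \<and>
         interior (eqset \<mu> \<nu> \<inter> supp \<mu>) = (\<Union>i. {a i<..<b i}) \<and>
         disjoint_family (\<lambda>i. {a i<..<b i}) \<and>
         (\<Sum>i. \<integral>\<^sup>+ x\<in>{a i<..<b i}. ennreal (- ln (min (x - a i) (b i - x))) \<partial>\<mu>) < \<infinity>)"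
    and H2: "\<exists>\<gamma>\<in>opt1 \<mu> \<nu>.
      Ent (restr \<gamma> ((- eqset \<mu> \<nu>) \<times> (- eqset \<mu> \<nu>))) (\<mu> \<Otimes>\<^sub>M \<nu>) < \<infinity>"
  shows "gamma_conv (couplings \<mu> \<nu>)
     (\<lambda>e \<gamma>. ereal ((cost1 \<gamma> - W1 \<mu> \<nu>) / e) + Ent \<gamma> (\<mu> \<Otimes>\<^sub>M \<nu>)
             - ereal (\<bar>ln (2 * e)\<bar> * measure \<mu> (eqset \<mu> \<nu>)))
     (\<lambda>\<gamma>. if \<gamma> \<in> opt1 \<mu> \<nu> then
             Ent (restr \<gamma> ((- eqset \<mu> \<nu>) \<times> (- eqset \<mu> \<nu>))) (\<mu> \<Otimes>\<^sub>M \<nu>)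
             - ereal (\<integral> x \<in> eqset \<mu> \<nu>. ln (enn2real (RN_deriv lborel \<mu> x)) \<partial>\<mu>)
           else \<infinity>)"
proof -
  \<comment> \<open>The locale is instantiated with the very version of the density that occurs in
    the limit functional, so the integrals of its logarithm agree syntactically.\<close>
  obtain L where lp: "line_pair \<mu> \<nu> (\<lambda>x. enn2real (RN_deriv lborel \<mu> x)) L"
    using line_pair_of_entropy assms(1-8) by blast
  interpret line_pair \<mu> \<nu> "\<lambda>x. enn2real (RN_deriv lborel \<mu> x)" L by (rule lp)
  show ?thesis
    unfolding gamma_conv_def
  proof (intro ballI conjI allI impI, goal_cases)
    case (1 \<gamma> \<gamma>s)
    then show ?case
      using liminf_optimal[of \<gamma>s \<gamma>] liminf_not_optimal[of \<gamma>s \<gamma>] by (cases "\<gamma> \<in> opt1 \<mu> \<nu>") simp_all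
  next
    case (2 \<gamma>)
    show ?case
    proof (cases "\<gamma> \<in> opt1 \<mu> \<nu>")
      case True
      then have "line_optimal \<mu> \<nu> (\<lambda>x. enn2real (RN_deriv lborel \<mu> x)) L \<gamma>"
        using lp by (simp add: line_optimal_def line_optimal_axioms_def)
      from line_optimal.ex_recovery_sequence[OF this] show ?thesis using True by simp
    next
      case False
      then show ?thesis using 2 by (intro exI[of _ "\<lambda>_. \<gamma>"]) (simp add: narrow_conv_def)
    qed
  qed
qed

end
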